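(* Let $(R,\mathfrak{m})$ be a Noetherian local ring, $M$ a finitely generated $R$-module, $I$ an ideal of $R$, and $J$ a reduction of $I$ with respect to $M$. Let $\alpha_I(M)$, $\beta_I(M)$, $\gamma^I_J(M)$ be the constant values, for $k\gg 0$, of $\dim I^kM/I^{k+1}M$, $\dim I^kM$ and $\dim I^kM/J^kM$, respectively. Then for $k\gg 0$: (a) $e_i(I^kM/I^{k+1}M)$ is a polynomial in $k$ of degree $\le \alpha_I(M)+s(I)-i-1$, for $0\le i\le \alpha_I(M)$. (b) $e_i(I^kM)$ is a polynomial in $k$ of degree $\le \beta_I(M)+s(I)-i-1$, for $0\le i\le\beta_I(M)$. (c) $e_i(I^kM/J^kM)$ is a polynomial in $k$ of degree $\le\gamma^I_J(M)+s(J)-i-1$, for $0\le i\le\gamma^I_J(M)$.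
   Context: $J$ is a reduction of $I$ with respect to $M$ if $J\subseteq I$ and $I^{m+1}M=JI^mM$ for some $m$. The dimensions $\dim I^kM/I^{k+1}M$, $\dim I^kM$ and $\dim I^kM/J^kM$ are known to stabilize for $k\gg0$. $s(I)=\dim\bigoplus_{k\ge0}I^k/\mathfrak{m}I^k$ is the analytic spread of $I$. For a finitely generated $R$-module $N$ of dimension $r$, the Hilbert coefficients $e_0(N),\ldots,e_r(N)$ (with respect to $\mathfrak{m}$) are the integers with $$\ell(N/\mathfrak{m}^{n+1}N)=\sum_{i=0}^{r}(-1)^ie_i(N)\binom{n+r-i}{r-i}\quad\text{for all } n\gg0.$$ *)

theory Defs
  imports
    "HOL-Algebra.Module"
    "HOL-Algebra.QuotRing"
    "HOL-Algebra.Ideal_Product"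
    "HOL-Algebra.Ring_Divisibility"
    "HOL-Library.Extended_Real"
    "HOL-Computational_Algebra.Polynomial"
begin

section \<open>Local rings and modules\<close>

locale noetherian_local_ring = cring R + noetherian_ring R for R (structure) +
  fixes \<mm> :: "'a set"
  assumes maximal: "maximalideal \<mm> R"
    and unique_maximal: "maximalideal \<pp> R \<Longrightarrow> \<pp> = \<mm>"

definition finitely_generated_module ::
    "('a, 'r) ring_scheme \<Rightarrow> ('a, 'b, 's) module_scheme \<Rightarrow> bool" where
  "finitely_generated_module R M \<longleftrightarrow>
     (\<exists>A. finite A \<and> A \<subseteq> carrier M \<and>
          (\<forall>N. submodule N R M \<longrightarrow> A \<subseteq> N \<longrightarrow> N = carrier M))"

definition annihilator :: "('a, 'r) ring_scheme \<Rightarrow> ('a, 'b, 's) module_scheme \<Rightarrow> 'a set" where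
  "annihilator R M = {a \<in> carrier R. \<forall>x \<in> carrier M. a \<odot>\<^bsub>M\<^esub> x = \<zero>\<^bsub>M\<^esub>}"

text \<open>Powers are taken in the monoid of ideals, so the zeroth power of any ideal is the
  whole ring.\<close>

definition ideal_pow :: "('a, 'r) ring_scheme \<Rightarrow> 'a set \<Rightarrow> nat \<Rightarrow> 'a set" where
  "ideal_pow R I k = I [^]\<^bsub>ideals_set R\<^esub> k"

text \<open>The submodule \<open>I N\<close> of all finite sums of products \<open>a \<odot> x\<close> with \<open>a \<in> I\<close> and \<open>x \<in> N\<close>,
  for an ideal \<open>I\<close> and a submodule \<open>N\<close> of \<open>M\<close>; compare \<^const>\<open>ideal_prod\<close>.\<close>

inductive_set ideal_smult :: "('a, 'b, 's) module_scheme \<Rightarrow> 'a set \<Rightarrow> 'b set \<Rightarrow> 'b set"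
  for M and I and N where
    smult: "\<lbrakk> a \<in> I; x \<in> N \<rbrakk> \<Longrightarrow> a \<odot>\<^bsub>M\<^esub> x \<in> ideal_smult M I N"
  | add: "\<lbrakk> x \<in> ideal_smult M I N; y \<in> ideal_smult M I N \<rbrakk> \<Longrightarrow>
            x \<oplus>\<^bsub>M\<^esub> y \<in> ideal_smult M I N"

text \<open>Module records extend ring records; the ring multiplication and unit play no role for
  modules and are left unspecified here.\<close>

definition quot_module :: "('a, 'b, 's) module_scheme \<Rightarrow> 'b set \<Rightarrow> ('a, 'b set) module" where
  "quot_module M N =
     \<lparr>carrier = a_rcosets\<^bsub>M\<^esub> N, monoid.mult = undefined, monoid.one = undefined,
      zero = N, add = set_add M,
      module.smult = (\<lambda>a X. \<Union>x\<in>X. N +>\<^bsub>M\<^esub> (a \<odot>\<^bsub>M\<^esub> x))\<rparr>"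

section \<open>Dimension and length\<close>

text \<open>The supremum is taken in the extended reals so that the zero ring, and hence the zero
  module, has dimension \<open>-\<infinity>\<close>.\<close>

definition krull_dim :: "('a, 'r) ring_scheme \<Rightarrow> ereal" where
  "krull_dim R =
     Sup {ereal (real n) | n. \<exists>P :: nat \<Rightarrow> 'a set.
            (\<forall>i\<le>n. primeideal (P i) R) \<and> (\<forall>i<n. P i \<subset> P (Suc i))}"

definition module_dim :: "('a, 'r) ring_scheme \<Rightarrow> ('a, 'b, 's) module_scheme \<Rightarrow> ereal" where
  "module_dim R M = krull_dim (R Quot (annihilator R M))"

definition module_length :: "('a, 'r) ring_scheme \<Rightarrow> ('a, 'b, 's) module_scheme \<Rightarrow> enat" where
  "module_length R M =
     Sup {enat n | n. \<exists>C :: nat \<Rightarrow> 'b set.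
            (\<forall>i\<le>n. submodule (C i) R M) \<and> (\<forall>i<n. C i \<subset> C (Suc i))}"

section \<open>Hilbert coefficients\<close>

definition is_hilbert_coeffs ::
    "('a, 'r) ring_scheme \<Rightarrow> 'a set \<Rightarrow> ('a, 'b, 's) module_scheme \<Rightarrow> nat \<Rightarrow> (nat \<Rightarrow> int) \<Rightarrow> bool" where
  "is_hilbert_coeffs R \<mm> N r e \<longleftrightarrow>
     (\<forall>\<^sub>F n in sequentially. \<exists>l.
        module_length R (quot_module N (ideal_smult N (ideal_pow R \<mm> (n + 1)) (carrier N))) = enat l \<and>
        int l = (\<Sum>i\<le>r. (-1) ^ i * e i * int ((n + r - i) choose (r - i))))"

text \<open>Only the coefficients with index at most \<open>dim N\<close> are meaningful; the remaining ones are
  set to zero, which makes the description unique.\<close>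

definition hilbert_coeff ::
    "('a, 'r) ring_scheme \<Rightarrow> 'a set \<Rightarrow> ('a, 'b, 's) module_scheme \<Rightarrow> nat \<Rightarrow> int" where
  "hilbert_coeff R \<mm> N =
     (THE e. \<exists>r. module_dim R N = ereal (real r) \<and> is_hilbert_coeffs R \<mm> N r e \<and> (\<forall>i>r. e i = 0))"

section \<open>Analytic spread\<close>

text \<open>The ring \<open>\<Oplus>\<^sub>k I\<^sup>k / \<mm> I\<^sup>k\<close>. An element is a sequence of cosets, the \<open>k\<close>-th one being a coset
  of \<open>\<mm> I\<^sup>k\<close> contained in \<open>I\<^sup>k\<close>, almost all of them zero. The product of the cosets of
  \<open>a \<in> I\<^sup>i\<close> and \<open>b \<in> I\<^sup>j\<close> is the coset of \<open>a b\<close> modulo \<open>\<mm> I\<^sup>i\<^sup>+\<^sup>j\<close>; the components of a product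
  are summed up in \<open>R / \<mm> I\<^sup>k\<close>, which contains \<open>I\<^sup>k / \<mm> I\<^sup>k\<close>.\<close>

definition fiber_cone :: "('a, 'r) ring_scheme \<Rightarrow> 'a set \<Rightarrow> 'a set \<Rightarrow> (nat \<Rightarrow> 'a set) ring" where
  "fiber_cone R \<mm> I =
     (let U = (\<lambda>k. ideal_prod R \<mm> (ideal_pow R I k)) in
      \<lparr>carrier = {f. (\<forall>k. \<exists>x \<in> ideal_pow R I k. f k = U k +>\<^bsub>R\<^esub> x) \<and> finite {k. f k \<noteq> U k}},
       monoid.mult = (\<lambda>f g k. \<Oplus>\<^bsub>R Quot U k\<^esub>i\<in>{..k}. rcoset_mult R (U k) (f i) (g (k - i))),
       monoid.one = (\<lambda>k. if k = 0 then U 0 +>\<^bsub>R\<^esub> \<one>\<^bsub>R\<^esub> else U k),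
       zero = U,
       add = (\<lambda>f g k. f k <+>\<^bsub>R\<^esub> g k)\<rparr>)"

definition analytic_spread :: "('a, 'r) ring_scheme \<Rightarrow> 'a set \<Rightarrow> 'a set \<Rightarrow> ereal" where
  "analytic_spread R \<mm> I = krull_dim (fiber_cone R \<mm> I)"

section \<open>Reductions and the modules under consideration\<close>

definition pow_sub :: "('a, 'r) ring_scheme \<Rightarrow> ('a, 'b, 's) module_scheme \<Rightarrow> 'a set \<Rightarrow> nat \<Rightarrow> 'b set" where
  "pow_sub R M I k = ideal_smult M (ideal_pow R I k) (carrier M)"

text \<open>\<open>J\<close> is a reduction of \<open>I\<close> with respect to \<open>M\<close>.\<close>

definition is_reduction ::
    "('a, 'r) ring_scheme \<Rightarrow> ('a, 'b, 's) module_scheme \<Rightarrow> 'a set \<Rightarrow> 'a set \<Rightarrow> bool" where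
  "is_reduction R M I J \<longleftrightarrow>
     ideal J R \<and> J \<subseteq> I \<and> (\<exists>n. pow_sub R M I (n + 1) = ideal_smult M J (pow_sub R M I n))"

text \<open>The modules \<open>I\<^sup>k M\<close>, \<open>I\<^sup>k M / I\<^sup>k\<^sup>+\<^sup>1 M\<close> and \<open>I\<^sup>k M / J\<^sup>k M\<close>.\<close>

definition pow_module ::
    "('a, 'r) ring_scheme \<Rightarrow> ('a, 'b, 's) module_scheme \<Rightarrow> 'a set \<Rightarrow> nat \<Rightarrow> ('a, 'b, 's) module_scheme" where
  "pow_module R M I k = M\<lparr>carrier := pow_sub R M I k\<rparr>"

definition pow_succ_quot ::
    "('a, 'r) ring_scheme \<Rightarrow> ('a, 'b, 's) module_scheme \<Rightarrow> 'a set \<Rightarrow> nat \<Rightarrow> ('a, 'b set) module" where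
  "pow_succ_quot R M I k = quot_module (pow_module R M I k) (pow_sub R M I (k + 1))"

definition pow_pow_quot ::
    "('a, 'r) ring_scheme \<Rightarrow> ('a, 'b, 's) module_scheme \<Rightarrow> 'a set \<Rightarrow> 'a set \<Rightarrow> nat \<Rightarrow> ('a, 'b set) module" where
  "pow_pow_quot R M I J k = quot_module (pow_module R M I k) (pow_sub R M J k)"

text \<open>The value of an eventually constant sequence; unspecified for any other sequence.\<close>

definition eventual_value :: "(nat \<Rightarrow> 'c) \<Rightarrow> 'c" where
  "eventual_value f = (THE c. \<forall>\<^sub>F k in sequentially. f k = c)"

definition alpha_dim :: "('a, 'r) ring_scheme \<Rightarrow> ('a, 'b, 's) module_scheme \<Rightarrow> 'a set \<Rightarrow> ereal" where
  "alpha_dim R M I = eventual_value (\<lambda>k. module_dim R (pow_succ_quot R M I k))"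

definition beta_dim :: "('a, 'r) ring_scheme \<Rightarrow> ('a, 'b, 's) module_scheme \<Rightarrow> 'a set \<Rightarrow> ereal" where
  "beta_dim R M I = eventual_value (\<lambda>k. module_dim R (pow_module R M I k))"

definition gamma_dim ::
    "('a, 'r) ring_scheme \<Rightarrow> ('a, 'b, 's) module_scheme \<Rightarrow> 'a set \<Rightarrow> 'a set \<Rightarrow> ereal" where
  "gamma_dim R M I J = eventual_value (\<lambda>k. module_dim R (pow_pow_quot R M I J k))"

text \<open>The zero polynomial has degree \<open>-\<infinity>\<close> here, whereas \<^const>\<open>degree\<close> assigns \<open>0\<close> to it. An
  integer sequence agreeing eventually with a polynomial determines rational coefficients.\<close>

definition eventually_poly_deg_le :: "(nat \<Rightarrow> int) \<Rightarrow> ereal \<Rightarrow> bool" where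
  "eventually_poly_deg_le f d \<longleftrightarrow>
     (\<exists>p :: rat poly. (p = 0 \<or> ereal (real (degree p)) \<le> d) \<and>
        (\<forall>\<^sub>F k in sequentially. of_int (f k) = poly p (of_nat k)))"

end

(*
Write the modules in question as A k / C k with submodules C k of A k of M such that
A (k+1) = J A k + C (k+1), where J is I in parts (a) and (b). The length of A k / (m^(n+1) A k + C k)
is the number of standard monomials of the corresponding bidegrees in generators of m and J, acting on
finitely many generators. The nonstandard monomials form a monomial ideal, so Dickson's lemma makes
this length an integral combination of products of binomial coefficients in n and in k, for n and k
large; its coefficients with respect to n are the Hilbert coefficients, up to sign.

The degree in n is at most the dimension r of A k / C k. The degree in k is at most s(J) - 1, since
for fixed n the length is bounded by a multiple of the length of J^k / m J^k. Both bounds come from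
one Noetherian induction, in which each step from a prime to a larger ideal lowers the order of growth
by one and lengthens a chain of primes, of R / ann in the first case and of the fiber cone in the
second. So every e_i has degree at most s - 1, which is at most r + s - i - 1 because i is at most r.
*)

theory Submission
  imports Defs "HOL-Library.Fun_Lexorder" "HOL-Algebra.UnivPoly" "HOL-Algebra.Subrings"
begin

section \<open>Numerical polynomials\<close>

text \<open>The Hilbert coefficients of \<open>A k / C k\<close> are read off for \<open>n\<close>
  large, with a threshold that could depend on \<open>k\<close>. Polynomial behaviour in
  \<open>k\<close> therefore needs an expansion valid on a whole quadrant
  \<open>n, k \<ge> N\<close>. Counting monomials in both gradings at once provides it; growth
  estimates are used only afterwards, to delete coefficients. Orders of growth are numbered so that
  order \<open>d\<close> means degree below \<open>d\<close>, and the order then equals a number of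
  primes in a chain. For \<open>R\<close> modulo the annihilator a chain has at most
  \<open>r + 1\<close> primes, so the degree in \<open>n\<close> is at most \<open>r\<close>. In the
  fiber cone the maximal homogeneous ideal is left out of the count, because the quotient by it
  vanishes in positive degrees; this turns the order into \<open>s\<close> and the degree in
  \<open>k\<close> into \<open>s - 1\<close>. Krull dimensions are only ever bounded from below, by
  exhibiting chains; infinite values are treated as separate trivial cases. Part (c) obeys the
  recursion only from the reduction index on, hence a shift of \<open>k\<close> there.\<close>

definition nbinom :: "nat \<Rightarrow> nat \<Rightarrow> int" where
  "nbinom j n = int ((n + j) choose j)"

lemma nbinom_0 [simp]: "nbinom 0 n = 1"
  by (simp add: nbinom_def)

lemma nbinom_Suc_Suc: "nbinom (Suc j) (Suc n) = nbinom (Suc j) n + nbinom j (Suc n)"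
  by (simp add: nbinom_def)

lemma nbinom_rec: "int (Suc j) * nbinom (Suc j) n = nbinom j n * int (n + j + 1)"
proof -
  have "(n + Suc j choose Suc j) * Suc j = Suc (n + j) * (n + j choose j)"
    using Suc_times_binomial_eq[of "n + j" j] by simp
  then have "int ((n + Suc j choose Suc j) * Suc j) = int (Suc (n + j) * (n + j choose j))"
    by (rule arg_cong)
  then show ?thesis
    unfolding nbinom_def of_nat_mult by (simp add: mult_ac)
qed

lemma nbinom_nonneg [simp]: "0 \<le> nbinom j n"
  by (simp add: nbinom_def)

text \<open>Together with \<open>power_le_fact_nbinom\<close> this pins \<open>nbinom j n\<close>
  between \<open>(n + 1) ^ j / j!\<close> and \<open>(n + 1) ^ j\<close>; comparing orders of growth
  asks for nothing sharper.\<close>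

lemma nbinom_le: "nbinom j n \<le> (int n + 1) ^ j"
proof (induction j)
  case (Suc j)
  have "int (Suc j) * nbinom (Suc j) n = nbinom j n * int (n + j + 1)"
    by (rule nbinom_rec)
  also have "\<dots> \<le> (int n + 1) ^ j * (int (Suc j) * (int n + 1))"
    by (intro mult_mono Suc) (simp_all add: algebra_simps)
  also have "\<dots> = int (Suc j) * (int n + 1) ^ Suc j" by (simp add: algebra_simps)
  finally show ?case
    by (metis mult_le_cancel_left_pos of_nat_0_less_iff zero_less_Suc)
qed simp

lemma power_le_fact_nbinom: "(int n + 1) ^ j \<le> fact j * nbinom j n"
proof (induction j)
  case (Suc j)
  have "(int n + 1) ^ Suc j \<le> (fact j * nbinom j n) * int (n + j + 1)"
    unfolding power_Suc2 by (intro mult_mono Suc) simp_all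
  also have "\<dots> = fact j * (nbinom j n * int (n + j + 1))" by simp
  also have "\<dots> = fact (Suc j) * nbinom (Suc j) n"
    unfolding nbinom_rec[symmetric] by (simp only: fact_Suc of_nat_Suc mult_ac)
  finally show ?case .
qed simp

text \<open>The hockey-stick identity. It explains the shift \<open>n + j\<close> in
  \<open>nbinom\<close>: summing up to \<open>n\<close> raises the index by one with no correction
  term.\<close>

lemma sum_nbinom: "(\<Sum>t\<le>n. nbinom j t) = nbinom (Suc j) n"
  by (induction n) (simp_all add: nbinom_Suc_Suc, simp add: nbinom_def)

text \<open>Integral combinations of the basis \<open>nbinom j\<close>, up to finitely many values.
  The degree is left open; \<open>growth_coeffs_zero\<close> recovers it later from the size of the
  function.\<close>

definition numerical :: "(nat \<Rightarrow> int) \<Rightarrow> bool" where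
  "numerical f \<longleftrightarrow> (\<exists>c d. \<forall>\<^sub>F n in sequentially. f n = (\<Sum>j\<le>d. c j * nbinom j n))"

lemma numerical_cong:
  assumes "numerical f" "\<forall>\<^sub>F n in sequentially. f n = g n"
  shows "numerical g"
proof -
  obtain c d where "\<forall>\<^sub>F n in sequentially. f n = (\<Sum>j\<le>d. c j * nbinom j n)"
    using assms(1) numerical_def by blast
  with assms(2) have "\<forall>\<^sub>F n in sequentially. g n = (\<Sum>j\<le>d. c j * nbinom j n)"
    by eventually_elim simp
  then show ?thesis unfolding numerical_def by blast
qed

lemma numerical_nbinom: "numerical (nbinom j)"
  unfolding numerical_def
  by (rule exI[of _ "\<lambda>i. if i = j then 1 else 0"], rule exI[of _ j])
     (simp add: if_distrib[of "\<lambda>x. x * _"] cong: if_cong)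

lemma sum_pad:
  fixes c :: "nat \<Rightarrow> int"
  assumes "d \<le> d'"
  shows "(\<Sum>j\<le>d'. (if j \<le> d then c j else 0) * x j) = (\<Sum>j\<le>d. c j * x j)"
  by (rule sum.mono_neutral_cong_right) (use assms in auto)

lemma numerical_add:
  assumes "numerical f" "numerical g"
  shows "numerical (\<lambda>n. f n + g n)"
proof -
  obtain c d where f: "\<forall>\<^sub>F n in sequentially. f n = (\<Sum>j\<le>d. c j * nbinom j n)"
    using assms(1) numerical_def by blast
  obtain c' d' where g: "\<forall>\<^sub>F n in sequentially. g n = (\<Sum>j\<le>d'. c' j * nbinom j n)"
    using assms(2) numerical_def by blast
  define D where "D = max d d'"
  define e where "e = (\<lambda>j. (if j \<le> d then c j else 0) + (if j \<le> d' then c' j else 0))"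
  have "\<forall>\<^sub>F n in sequentially. f n + g n = (\<Sum>j\<le>D. e j * nbinom j n)"
    using f g
    by eventually_elim
       (simp only: e_def distrib_right sum.distrib,
        subst (1 2) sum_pad, simp_all add: D_def)
  then show ?thesis unfolding numerical_def by blast
qed

lemma numerical_scale:
  assumes "numerical f"
  shows "numerical (\<lambda>n. a * f n)"
proof -
  obtain c d where f: "\<forall>\<^sub>F n in sequentially. f n = (\<Sum>j\<le>d. c j * nbinom j n)"
    using assms(1) numerical_def by blast
  then have "\<forall>\<^sub>F n in sequentially. a * f n = (\<Sum>j\<le>d. (a * c j) * nbinom j n)"
    by eventually_elim (simp add: sum_distrib_left mult_ac)
  then show ?thesis unfolding numerical_def by (intro exI)
qed

lemma numerical_const [simp]: "numerical (\<lambda>n. a)"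
  using numerical_scale[OF numerical_nbinom[of 0], of a] by simp

lemma numerical_eventually_const: "\<forall>\<^sub>F n in sequentially. f n = a \<Longrightarrow> numerical f"
  by (rule numerical_cong[OF numerical_const[of a]]) (simp add: eq_commute)

lemma numerical_sum:
  assumes "\<And>i. i \<in> A \<Longrightarrow> numerical (f i)"
  shows "numerical (\<lambda>n. \<Sum>i\<in>A. f i n)"
  using assms by (induction A rule: infinite_finite_induct) (auto intro: numerical_add)

text \<open>The hypothesis \<open>cong\<close> asks only that being numerical survives a change of
  finitely many values. Partial sums are the reason for this weak form: altering finitely many
  values of \<open>f\<close> changes them by a constant.\<close>

lemma numerical_linear_image:
  assumes f: "numerical f"
    and basis: "\<And>j. numerical (T (nbinom j))"
    and cong: "\<And>f g. \<forall>\<^sub>F n in sequentially. f n = g n \<Longrightarrow> numerical (T f) \<Longrightarrow> numerical (T g)"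
    and lin: "\<And>c d. \<forall>\<^sub>F n in sequentially.
      T (\<lambda>n. \<Sum>j\<le>(d::nat). c j * nbinom j n) n = (\<Sum>j\<le>d. c j * T (nbinom j) n)"
  shows "numerical (T f)"
proof -
  obtain c d where f: "\<forall>\<^sub>F n in sequentially. f n = (\<Sum>j\<le>d. c j * nbinom j n)"
    using assms(1) numerical_def by blast
  have "numerical (\<lambda>n. \<Sum>j\<le>d. c j * T (nbinom j) n)"
    by (intro numerical_sum numerical_scale basis)
  then have "numerical (T (\<lambda>n. \<Sum>j\<le>d. c j * nbinom j n))"
    by (rule numerical_cong) (use lin[of c d] in eventually_elim, simp)
  then show ?thesis
    by (rule cong[rotated]) (use f in eventually_elim, simp)
qed

lemma numerical_shift1:
  assumes "numerical f"
  shows "numerical (\<lambda>n. f (n - 1))"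
proof (rule numerical_linear_image[where T = "\<lambda>f n. f (n - 1)", OF assms])
  fix j
  show "numerical (\<lambda>n. nbinom j (n - 1))"
  proof (cases j)
    case 0 then show ?thesis by simp
  next
    case (Suc i)
    \<comment> \<open>Pascal's rule solved for the value at \<open>n - 1\<close>.\<close>
    have "numerical (\<lambda>n. nbinom (Suc i) n + (-1) * nbinom i n)"
      by (intro numerical_add numerical_scale numerical_nbinom)
    then show ?thesis
    proof (rule numerical_cong)
      show "\<forall>\<^sub>F n in sequentially. nbinom (Suc i) n + (-1) * nbinom i n = nbinom j (n - 1)"
        using eventually_ge_at_top[of 1]
      proof eventually_elim
        case (elim n)
        then obtain m where "n = Suc m" by (cases n) auto
        then show ?case by (simp add: Suc nbinom_Suc_Suc)
      qed
    qed
  qed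
next
  fix f g :: "nat \<Rightarrow> int"
  assume *: "\<forall>\<^sub>F n in sequentially. f n = g n" "numerical (\<lambda>n. f (n - 1))"
  from *(1) obtain N where "\<And>n. n \<ge> N \<Longrightarrow> f n = g n"
    by (auto simp: eventually_sequentially)
  then have "\<forall>\<^sub>F n in sequentially. f (n - 1) = g (n - 1)"
    by (auto simp: eventually_sequentially intro!: exI[of _ "Suc N"])
  with *(2) show "numerical (\<lambda>n. g (n - 1))" by (rule numerical_cong)
qed simp

text \<open>Filling with zero below \<open>t\<close> is the form in which shifted summands occur in
  a convolution; eventually this is the plain shift.\<close>

lemma numerical_shift:
  assumes "numerical f"
  shows "numerical (\<lambda>n. if t \<le> n then f (n - t) else 0)"
proof -
  have "numerical (\<lambda>n. f (n - t))"
  proof (induction t)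
    case (Suc t)
    show ?case using numerical_shift1[OF Suc] by simp
  qed (use assms in simp)
  then show ?thesis
    by (rule numerical_cong) (auto simp: eventually_sequentially)
qed

lemma numerical_partial_sum:
  assumes "numerical f"
  shows "numerical (\<lambda>n. \<Sum>t\<le>n. f t)"
proof (rule numerical_linear_image[where T = "\<lambda>f n. \<Sum>t\<le>n. f t", OF assms])
  show "numerical (\<lambda>n. \<Sum>t\<le>n. nbinom j t)" for j
    by (simp add: sum_nbinom numerical_nbinom)
next
  fix f g :: "nat \<Rightarrow> int"
  assume *: "\<forall>\<^sub>F n in sequentially. f n = g n" "numerical (\<lambda>n. \<Sum>t\<le>n. f t)"
  from *(1) obtain N where N: "\<And>n. n \<ge> N \<Longrightarrow> f n = g n"
    by (auto simp: eventually_sequentially)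
  \<comment> \<open>Beyond \<open>N\<close> the two partial sums differ by the constant collected up
    to \<open>N\<close>.\<close>
  have "(\<Sum>t\<le>n. f t) + (\<Sum>t\<le>N. g t - f t) = (\<Sum>t\<le>n. g t)" if "n \<ge> N" for n
  proof -
    have "(\<Sum>t\<le>N. g t - f t) = (\<Sum>t\<le>n. g t - f t)"
      by (rule sum.mono_neutral_left) (use that N in auto)
    then show ?thesis by (simp add: sum_subtractf)
  qed
  then have "\<forall>\<^sub>F n in sequentially. (\<Sum>t\<le>n. f t) + (\<Sum>t\<le>N. g t - f t) = (\<Sum>t\<le>n. g t)"
    by (auto simp: eventually_sequentially)
  then show "numerical (\<lambda>n. \<Sum>t\<le>n. g t)"
    by (rule numerical_cong[rotated]) (intro numerical_add *(2) numerical_const)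
next
  show "\<forall>\<^sub>F n in sequentially. (\<Sum>t\<le>n. \<Sum>j\<le>d. c j * nbinom j t)
      = (\<Sum>j\<le>d. c j * (\<Sum>t\<le>n. nbinom j t))" for c and d :: nat
    by (rule always_eventually) (auto simp: sum_distrib_left intro: sum.swap)
qed

text \<open>Growth of order \<open>d\<close> means \<open>O(k\<^sup>d\<^sup>-\<^sup>1)\<close>, where order \<open>0\<close> stands for eventual vanishing.\<close>

fun growth :: "nat \<Rightarrow> (nat \<Rightarrow> nat) \<Rightarrow> bool" where
  "growth 0 f \<longleftrightarrow> (\<forall>\<^sub>F k in sequentially. f k = 0)"
| "growth (Suc d) f \<longleftrightarrow> (\<exists>C. \<forall>\<^sub>F k in sequentially. f k \<le> C * (k + 1) ^ d)"

lemma growth_mono: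
  assumes "growth d f" "d \<le> d'"
  shows "growth d' f"
proof (cases d')
  case 0 with assms show ?thesis by simp
next
  case (Suc e')
  show ?thesis
  proof (cases d)
    case 0
    with assms(1) have "\<forall>\<^sub>F k in sequentially. f k = 0" by simp
    then have "\<forall>\<^sub>F k in sequentially. f k \<le> 0 * (k + 1) ^ e'"
      by eventually_elim simp
    then show ?thesis unfolding Suc growth.simps by (rule exI)
  next
    case (Suc e)
    with assms(1) obtain C where "\<forall>\<^sub>F k in sequentially. f k \<le> C * (k + 1) ^ e" by auto
    then have "\<forall>\<^sub>F k in sequentially. f k \<le> C * (k + 1) ^ e'"
    proof eventually_elim
      case (elim k)
      have "(k + 1) ^ e \<le> (k + 1) ^ e'"
        using assms(2) Suc \<open>d' = Suc e'\<close> by (intro power_increasing) auto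
      with elim show ?case using mult_le_mono2 order_trans by blast
    qed
    then show ?thesis unfolding \<open>d' = Suc e'\<close> growth.simps by (rule exI)
  qed
qed

lemma growth_le:
  assumes "growth d f" "\<forall>\<^sub>F k in sequentially. g k \<le> f k"
  shows "growth d g"
proof (cases d)
  case 0
  with assms(1) have "\<forall>\<^sub>F k in sequentially. f k = 0" by simp
  with assms(2) have "\<forall>\<^sub>F k in sequentially. g k = 0" by eventually_elim simp
  then show ?thesis using 0 by simp
next
  case (Suc e)
  with assms(1) obtain C where "\<forall>\<^sub>F k in sequentially. f k \<le> C * (k + 1) ^ e" by auto
  with assms(2) have "\<forall>\<^sub>F k in sequentially. g k \<le> C * (k + 1) ^ e"
    by eventually_elim simp
  then show ?thesis unfolding Suc growth.simps by (rule exI)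
qed

lemma growth_add:
  assumes "growth d f" "growth d g"
  shows "growth d (\<lambda>k. f k + g k)"
proof (cases d)
  case 0
  with assms have "\<forall>\<^sub>F k in sequentially. f k = 0" "\<forall>\<^sub>F k in sequentially. g k = 0" by simp_all
  then have "\<forall>\<^sub>F k in sequentially. f k + g k = 0" by eventually_elim simp
  then show ?thesis using 0 by simp
next
  case (Suc e)
  with assms obtain C C' where "\<forall>\<^sub>F k in sequentially. f k \<le> C * (k + 1) ^ e"
    "\<forall>\<^sub>F k in sequentially. g k \<le> C' * (k + 1) ^ e" by auto
  then have "\<forall>\<^sub>F k in sequentially. f k + g k \<le> (C + C') * (k + 1) ^ e"
    by eventually_elim (simp add: algebra_simps)
  then show ?thesis unfolding Suc growth.simps by (rule exI)
qed

lemma growth_scale: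
  assumes "growth d f"
  shows "growth d (\<lambda>k. a * f k)"
proof (induction a)
  case 0
  have "growth 0 (\<lambda>k. 0 * f k)" by simp
  then show ?case by (rule growth_mono) simp
next
  case (Suc a)
  show ?case using growth_add[OF assms Suc] by simp
qed

lemma growth_shift:
  assumes "growth d f"
  shows "growth d (\<lambda>k. f (k - i))"
proof (cases d)
  case 0
  with assms obtain N where "\<And>k. k \<ge> N \<Longrightarrow> f k = 0" by (auto simp: eventually_sequentially)
  then have "\<forall>k\<ge>N + i. f (k - i) = 0" by simp
  then show ?thesis using 0 by (auto simp: eventually_sequentially)
next
  case (Suc e)
  with assms obtain C N where *: "\<And>k. k \<ge> N \<Longrightarrow> f k \<le> C * (k + 1) ^ e"
    by (auto simp: eventually_sequentially)
  have "f (k - i) \<le> C * (k + 1) ^ e" if "k \<ge> N + i" for k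
  proof -
    have "f (k - i) \<le> C * ((k - i) + 1) ^ e" by (rule *) (use that in simp)
    also have "\<dots> \<le> C * (k + 1) ^ e" by (intro mult_le_mono power_mono) auto
    finally show ?thesis .
  qed
  then show ?thesis using Suc by (auto simp: eventually_sequentially)
qed

text \<open>Summation costs one order: differences of size \<open>O(k^(d-1))\<close> add up to
  \<open>O(k^d)\<close>. For \<open>d = 0\<close> the function is eventually nonincreasing, hence
  bounded, which is order 1.\<close>

lemma growth_Suc_of_difference:
  assumes g: "growth d g" and f: "\<forall>\<^sub>F k in sequentially. 1 \<le> k \<and> f k \<le> f (k - 1) + g k"
  shows "growth (Suc d) f"
proof (cases d)
  case 0
  with g have "\<forall>\<^sub>F k in sequentially. g k = 0" by simp
  with f have "\<forall>\<^sub>F k in sequentially. f k \<le> f (k - 1)" by eventually_elim simp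
  then obtain N where N: "\<And>k. k \<ge> N \<Longrightarrow> f k \<le> f (k - 1)" by (auto simp: eventually_sequentially)
  have "f k \<le> f N" if "k \<ge> N" for k
    using that
  proof (induction k rule: dec_induct)
    case (step k)
    then show ?case using N[of "Suc k"] by simp
  qed simp
  then show ?thesis using 0 by (auto simp: eventually_sequentially)
next
  case (Suc e)
  with g obtain C where "\<forall>\<^sub>F k in sequentially. g k \<le> C * (k + 1) ^ e" by auto
  with f have "\<forall>\<^sub>F k in sequentially. f k \<le> f (k - 1) + C * (k + 1) ^ e"
    by eventually_elim simp
  then obtain N where N: "\<And>k. k \<ge> N \<Longrightarrow> f k \<le> f (k - 1) + C * (k + 1) ^ e"
    by (auto simp: eventually_sequentially)
  \<comment> \<open>Each of the at most \<open>k\<close> increments is bounded by the last one,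
    since \<open>(k + 1) ^ e\<close> increases.\<close>
  have "f k \<le> f N + k * (C * (k + 1) ^ e)" if "k \<ge> N" for k
    using that
  proof (induction k rule: dec_induct)
    case (step k)
    have "f (Suc k) \<le> f k + C * (Suc k + 1) ^ e"
      using N[of "Suc k"] step by simp
    also have "\<dots> \<le> (f N + k * (C * (k + 1) ^ e)) + C * (Suc k + 1) ^ e"
      using step by simp
    also have "\<dots> \<le> (f N + k * (C * (Suc k + 1) ^ e)) + C * (Suc k + 1) ^ e"
      by (intro add_mono mult_le_mono power_mono order_refl) simp_all
    also have "\<dots> = f N + Suc k * (C * (Suc k + 1) ^ e)" by simp
    finally show ?case .
  qed simp
  moreover have "f N + k * (C * (k + 1) ^ e) \<le> (f N + C) * (k + 1) ^ Suc e" for k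
  proof -
    have "f N * 1 \<le> f N * (k + 1) ^ Suc e" by (intro mult_le_mono order_refl one_le_power) simp
    moreover have "k * (C * (k + 1) ^ e) \<le> (k + 1) * (C * (k + 1) ^ e)" by simp
    ultimately show ?thesis by (simp add: algebra_simps)
  qed
  ultimately have "\<forall>k\<ge>N. f k \<le> (f N + C) * (k + 1) ^ Suc e"
    using order_trans by blast
  then show ?thesis unfolding Suc growth.simps eventually_sequentially by blast
qed

text \<open>If the largest index \<open>m\<close> with \<open>c m \<noteq> 0\<close> were at least
  \<open>r\<close>, the term \<open>c m * nbinom m n\<close> would be of exact order
  \<open>n ^ m\<close>, too large to be balanced by \<open>g\<close> and the lower terms. With
  \<open>r = 0\<close> and \<open>g = 0\<close> this is the uniqueness of the coefficients.\<close>

lemma growth_coeffs_zero: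
  assumes gr: "growth r g"
    and eq: "\<forall>\<^sub>F n in sequentially. (\<Sum>j\<le>d. c j * nbinom j n) = int (g n)"
    and j: "r \<le> j" "j \<le> d"
  shows "c j = 0"
proof (rule ccontr)
  assume nz: "c j \<noteq> 0"
  define m where "m = Max {j. j \<le> d \<and> c j \<noteq> 0}"
  have fin: "finite {j. j \<le> d \<and> c j \<noteq> 0}" by simp
  have m: "m \<le> d" "c m \<noteq> 0" using Max_in[OF fin] nz j unfolding m_def by blast+
  have "j \<le> m" using Max_ge[OF fin] nz j unfolding m_def by blast
  then have rm: "r \<le> m" using j by simp
  have above: "c i = 0" if "m < i" "i \<le> d" for i
    using Max_ge[OF fin, of i] that unfolding m_def by fastforce
  have split: "(\<Sum>j\<le>d. c j * nbinom j n) = (\<Sum>j<m. c j * nbinom j n) + c m * nbinom m n" for n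
  proof -
    have "(\<Sum>j\<le>d. c j * nbinom j n) = (\<Sum>j\<le>m. c j * nbinom j n)"
      by (rule sum.mono_neutral_right) (use m above in auto)
    then show ?thesis by (simp add: lessThan_Suc_atMost[symmetric])
  qed
  have grm: "growth m g" by (rule growth_mono[OF gr rm])
  show False
  proof (cases m)
    case 0
    with grm have "\<forall>\<^sub>F n in sequentially. g n = 0" by simp
    with eq have "\<forall>\<^sub>F n in sequentially. c m = 0"
      by eventually_elim (simp add: split[unfolded 0] 0)
    then show False using m by simp
  next
    case (Suc i)
    with grm obtain C where "\<forall>\<^sub>F n in sequentially. g n \<le> C * (n + 1) ^ i" by auto
    with eq have "\<forall>\<^sub>F n in sequentially. (\<Sum>j\<le>d. c j * nbinom j n) = int (g n) \<and> g n \<le> C * (n + 1) ^ i"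
      by eventually_elim simp
    then obtain N where N: "\<And>n. n \<ge> N \<Longrightarrow> (\<Sum>j\<le>d. c j * nbinom j n) = int (g n) \<and> g n \<le> C * (n + 1) ^ i"
      by (auto simp: eventually_sequentially)
    \<comment> \<open>\<open>C\<close> comes from the bound on \<open>g\<close>, the sum from the
      lower terms and the factorial from \<open>power_le_fact_nbinom\<close>. Together they give
      \<open>(n + 1) ^ m \<le> K * (n + 1) ^ (m - 1)\<close>, impossible for large
      \<open>n\<close>.\<close>
    define K where "K = fact m * (int C + (\<Sum>j<m. \<bar>c j\<bar>))"
    have "int n + 1 \<le> K" if "n \<ge> N" for n
    proof -
      let ?x = "int n + 1"
      have x: "?x \<ge> 1" by simp
      have "\<bar>\<Sum>j<m. c j * nbinom j n\<bar> \<le> (\<Sum>j<m. \<bar>c j * nbinom j n\<bar>)" by (rule sum_abs)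
      also have "\<dots> \<le> (\<Sum>j<m. \<bar>c j\<bar> * ?x ^ i)"
      proof (rule sum_mono)
        fix j assume "j \<in> {..<m}"
        then have "?x ^ j \<le> ?x ^ i" using Suc by (intro power_increasing) auto
        with nbinom_le[of j n] have "nbinom j n \<le> ?x ^ i" by simp
        then show "\<bar>c j * nbinom j n\<bar> \<le> \<bar>c j\<bar> * ?x ^ i"
          by (simp add: abs_mult mult_left_mono)
      qed
      finally have low: "\<bar>\<Sum>j<m. c j * nbinom j n\<bar> \<le> (\<Sum>j<m. \<bar>c j\<bar>) * ?x ^ i"
        by (simp add: sum_distrib_right)
      from N[OF that] have "c m * nbinom m n = int (g n) - (\<Sum>j<m. c j * nbinom j n)"
        and gC: "g n \<le> C * (n + 1) ^ i"
        using split[of n] by simp_all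
      moreover have "int (g n) \<le> int C * ?x ^ i"
      proof -
        have "int (g n) \<le> int (C * (n + 1) ^ i)" using gC by (simp only: of_nat_le_iff)
        then show ?thesis by (simp add: add.commute)
      qed
      ultimately have "\<bar>c m * nbinom m n\<bar> \<le> int C * ?x ^ i + (\<Sum>j<m. \<bar>c j\<bar>) * ?x ^ i"
        using low by linarith
      moreover have "nbinom m n \<le> \<bar>c m * nbinom m n\<bar>"
      proof -
        have "1 \<le> \<bar>c m\<bar>" using m by simp
        then show ?thesis using mult_right_mono[of 1 "\<bar>c m\<bar>" "nbinom m n"] by (simp add: abs_mult)
      qed
      ultimately have "nbinom m n \<le> (int C + (\<Sum>j<m. \<bar>c j\<bar>)) * ?x ^ i"
        by (simp add: algebra_simps)
      then have "fact m * nbinom m n \<le> fact m * ((int C + (\<Sum>j<m. \<bar>c j\<bar>)) * ?x ^ i)"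
        by (intro mult_left_mono) simp_all
      with power_le_fact_nbinom[of n m] have "?x ^ m \<le> K * ?x ^ i"
        unfolding K_def mult.assoc by linarith
      then have "?x * ?x ^ i \<le> K * ?x ^ i" using Suc by simp
      then show ?thesis using x by (simp add: mult_le_cancel_right)
    qed
    from this[of "N + nat \<bar>K\<bar>"] show False by simp
  qed
qed

section \<open>Functions of two variables\<close>

text \<open>Finite sums of products \<open>f(n) g(k)\<close>. This is stronger than being numerical
  in each variable separately, since the thresholds in \<open>n\<close> and \<open>k\<close> do not
  depend on each other.\<close>

inductive binumerical :: "(nat \<Rightarrow> nat \<Rightarrow> int) \<Rightarrow> bool" where
  prod: "numerical f \<Longrightarrow> numerical g \<Longrightarrow> binumerical (\<lambda>n k. f n * g k)"
| add: "binumerical f \<Longrightarrow> binumerical g \<Longrightarrow> binumerical (\<lambda>n k. f n k + g n k)"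

lemma binumerical_zero: "binumerical (\<lambda>n k. 0)"
  using binumerical.prod[of "\<lambda>_. 0" "\<lambda>_. 0"] by simp

lemma binumerical_swap:
  assumes "binumerical f"
  shows "binumerical (\<lambda>n k. f k n)"
  using assms
proof induction
  case (prod f g)
  then show ?case using binumerical.prod[of g f] by (simp add: mult.commute)
qed (rule binumerical.add)

lemma binumerical_linear_image:
  assumes "binumerical f"
    and "\<And>f. numerical f \<Longrightarrow> numerical (T f)"
    and "\<And>f g n. T (\<lambda>n. f n + g n) n = T f n + T g n"
    and "\<And>f c n. T (\<lambda>n. f n * c) n = T f n * c"
  shows "binumerical (\<lambda>n k. T (\<lambda>n. f n k) n)"
  using assms(1)
proof induction
  case (prod f g)
  then show ?case using binumerical.prod[OF assms(2)] by (simp add: assms(4))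
next
  case (add f g)
  then show ?case using binumerical.add by (simp add: assms(3))
qed

lemma binumerical_uminus: "binumerical f \<Longrightarrow> binumerical (\<lambda>n k. - f n k)"
  using binumerical_linear_image[where T = "\<lambda>f n. - f n" and f = f]
    numerical_scale[where a = "-1"] by simp

lemma binumerical_diff: "binumerical f \<Longrightarrow> binumerical g \<Longrightarrow> binumerical (\<lambda>n k. f n k - g n k)"
  using binumerical.add[OF _ binumerical_uminus] by fastforce

lemma binumerical_sum:
  assumes "\<And>i. i \<in> A \<Longrightarrow> binumerical (f i)"
  shows "binumerical (\<lambda>n k. \<Sum>i\<in>A. f i n k)"
  using assms by (induction A rule: infinite_finite_induct) (auto intro: binumerical.add binumerical_zero)

lemma binumerical_shift:
  "binumerical f \<Longrightarrow> binumerical (\<lambda>n k. if t \<le> n then f (n - t) k else 0)"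
  by (rule binumerical_linear_image[where T = "\<lambda>f n. if t \<le> n then f (n - t) else 0"])
     (auto intro: numerical_shift)

lemma binumerical_partial_sum:
  "binumerical f \<Longrightarrow> binumerical (\<lambda>n k. \<Sum>t\<le>n. f t k)"
  by (rule binumerical_linear_image[where T = "\<lambda>f n. \<Sum>t\<le>n. f t"])
     (auto intro: numerical_partial_sum simp: sum.distrib sum_distrib_right)

text \<open>All terms with \<open>t \<ge> T\<close> share the kernel \<open>c T\<close>, so the
  convolution is the partial sum of \<open>c T\<close> plus finitely many shifted corrections, one
  for each \<open>t < T\<close>.\<close>

lemma binumerical_convolution:
  assumes c: "\<And>t. binumerical (c t)" and stable: "\<And>t. t \<ge> T \<Longrightarrow> c t = c T"
  shows "binumerical (\<lambda>n k. \<Sum>t\<le>n. c t (n - t) k)"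
proof -
  have eq: "(\<Sum>t\<le>n. c t (n - t) k) = (\<Sum>t\<le>n. c T t k) +
      (\<Sum>t<T. (if t \<le> n then c t (n - t) k - c T (n - t) k else 0))" for n k
  proof -
    have "(\<Sum>t\<le>n. c T t k) = (\<Sum>t\<le>n. c T (n - t) k)"
      by (rule sum.reindex_bij_witness[of _ "\<lambda>t. n - t" "\<lambda>t. n - t"]) auto
    moreover have "(\<Sum>t<T. (if t \<le> n then c t (n - t) k - c T (n - t) k else 0))
        = (\<Sum>t\<le>n. c t (n - t) k - c T (n - t) k)"
    proof -
      have "(\<Sum>t<T. (if t \<le> n then c t (n - t) k - c T (n - t) k else 0))
          = (\<Sum>t\<in>{..<T} \<inter> {..n}. c t (n - t) k - c T (n - t) k)"
        by (subst sum.inter_restrict) (auto intro!: sum.cong)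
      also have "\<dots> = (\<Sum>t\<le>n. c t (n - t) k - c T (n - t) k)"
      proof (rule sum.mono_neutral_left)
        show "\<forall>t\<in>{..n} - {..<T} \<inter> {..n}. c t (n - t) k - c T (n - t) k = 0"
        proof
          fix t assume "t \<in> {..n} - {..<T} \<inter> {..n}"
          then have "c t = c T" by (intro stable) auto
          then show "c t (n - t) k - c T (n - t) k = 0" by simp
        qed
      qed auto
      finally show ?thesis .
    qed
    ultimately show ?thesis by (simp add: sum_subtractf)
  qed
  have "binumerical (\<lambda>n k. if t \<le> n then c t (n - t) k - c T (n - t) k else 0)" for t
    using binumerical_shift[OF binumerical_diff[OF c[of t] c[of T]], of t] .
  then have "binumerical (\<lambda>n k. \<Sum>t<T. (if t \<le> n then c t (n - t) k - c T (n - t) k else 0))"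
    by (rule binumerical_sum)
  from binumerical.add[OF binumerical_partial_sum[OF c[of T]] this]
  show ?thesis unfolding eq .
qed

text \<open>One table \<open>E\<close> and one threshold \<open>N\<close> serve both variables; all
  products in the sum are padded to a common degree \<open>d\<close>.\<close>

lemma binumerical_expansion:
  assumes "binumerical f"
  obtains E d N where "\<And>n k. N \<le> n \<Longrightarrow> N \<le> k \<Longrightarrow>
    f n k = (\<Sum>j\<le>d. \<Sum>l\<le>d. E j l * nbinom j n * nbinom l k)"
proof -
  have "\<exists>E d N. \<forall>n\<ge>N. \<forall>k\<ge>N. f n k = (\<Sum>j\<le>d. \<Sum>l\<le>(d::nat). E j l * nbinom j n * nbinom l k)"
    using assms
  proof induction
    case (prod f g)
    then obtain c d c' d' where
      "\<forall>\<^sub>F n in sequentially. f n = (\<Sum>j\<le>d. c j * nbinom j n)"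
      "\<forall>\<^sub>F n in sequentially. g n = (\<Sum>j\<le>d'. c' j * nbinom j n)"
      unfolding numerical_def by blast
    then obtain N N' where N: "\<And>n. n \<ge> N \<Longrightarrow> f n = (\<Sum>j\<le>d. c j * nbinom j n)"
      "\<And>n. n \<ge> N' \<Longrightarrow> g n = (\<Sum>j\<le>d'. c' j * nbinom j n)"
      unfolding eventually_sequentially by blast
    define D where "D = max d d'"
    define b where "b j = (if j \<le> d then c j else 0)" for j
    define b' where "b' j = (if j \<le> d' then c' j else 0)" for j
    have "f n * g k = (\<Sum>j\<le>D. \<Sum>l\<le>D. (b j * b' l) * nbinom j n * nbinom l k)"
      if "n \<ge> max N N'" "k \<ge> max N N'" for n k
    proof -
      have "f n = (\<Sum>j\<le>D. b j * nbinom j n)"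
        unfolding b_def by (subst sum_pad) (use that N in \<open>auto simp: D_def\<close>)
      moreover have "g k = (\<Sum>j\<le>D. b' j * nbinom j k)"
        unfolding b'_def by (subst sum_pad) (use that N in \<open>auto simp: D_def\<close>)
      ultimately show ?thesis
        by (simp only: sum_product) (intro sum.cong refl, simp only: mult_ac)
    qed
    then show ?case by (intro exI allI impI) assumption
  next
    case (add f g)
    then obtain E d N E' d' N' where
      f: "\<And>n k. n \<ge> N \<Longrightarrow> k \<ge> N \<Longrightarrow> f n k = (\<Sum>j\<le>d. \<Sum>l\<le>(d::nat). E j l * nbinom j n * nbinom l k)"
      and g: "\<And>n k. n \<ge> N' \<Longrightarrow> k \<ge> N' \<Longrightarrow> g n k = (\<Sum>j\<le>d'. \<Sum>l\<le>(d'::nat). E' j l * nbinom j n * nbinom l k)"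
      by blast
    define D where "D = max d d'"
    define pad :: "nat \<Rightarrow> (nat \<Rightarrow> nat \<Rightarrow> int) \<Rightarrow> nat \<Rightarrow> nat \<Rightarrow> int"
      where "pad d E j l = (if l \<le> d then (if j \<le> d then E j l else 0) else 0)" for d E j l
    have pad: "(\<Sum>j\<le>D. \<Sum>l\<le>D. pad d E j l * nbinom j n * nbinom l k)
        = (\<Sum>j\<le>d. \<Sum>l\<le>d. E j l * nbinom j n * nbinom l k)" if "d \<le> D" for d E n k
    proof -
      have "(\<Sum>j\<le>D. \<Sum>l\<le>D. pad d E j l * nbinom j n * nbinom l k)
          = (\<Sum>j\<le>d. \<Sum>l\<le>D. pad d E j l * nbinom j n * nbinom l k)"
        by (rule sum.mono_neutral_right) (use that in \<open>auto simp: pad_def intro!: sum.neutral\<close>)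
      also have "\<dots> = (\<Sum>j\<le>d. \<Sum>l\<le>d. E j l * nbinom j n * nbinom l k)"
        by (intro sum.cong refl sum.mono_neutral_cong_right) (use that in \<open>auto simp: pad_def\<close>)
      finally show ?thesis .
    qed
    have "f n k + g n k = (\<Sum>j\<le>D. \<Sum>l\<le>D. (pad d E j l + pad d' E' j l) * nbinom j n * nbinom l k)"
      if "n \<ge> max N N'" "k \<ge> max N N'" for n k
      using that
      by (simp only: distrib_right sum.distrib) (subst (1 2) pad, simp_all add: D_def f g)
    then show ?case by (intro exI allI impI) assumption
  qed
  then show ?thesis using that by blast
qed

section \<open>Complements of monomial ideals\<close>

definition exps :: "nat set \<Rightarrow> (nat \<Rightarrow> nat) set" where
  "exps V = {\<delta>. \<forall>i. i \<notin> V \<longrightarrow> \<delta> i = 0}"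

definition tdeg :: "nat set \<Rightarrow> (nat \<Rightarrow> nat) \<Rightarrow> nat" where
  "tdeg V \<delta> = (\<Sum>i\<in>V. \<delta> i)"

text \<open>\<open>D\<close> may reach outside \<open>exps V\<close>, so such sets are compared
  below through their traces \<open>D \<inter> exps V\<close>.\<close>

definition monomial_ideal :: "nat set \<Rightarrow> (nat \<Rightarrow> nat) set \<Rightarrow> bool" where
  "monomial_ideal V D \<longleftrightarrow> (\<forall>\<delta>\<in>exps V. \<forall>\<epsilon>\<in>exps V. \<delta> \<in> D \<longrightarrow> (\<lambda>i. \<delta> i + \<epsilon> i) \<in> D)"

text \<open>The variables of \<open>V\<close> in \<open>T\<close> carry the first degree, the others
  the second. With \<open>T\<close> arbitrary, passing to its complement exchanges the two degrees,
  and the induction on \<open>V\<close> has to treat only one kind of new variable.\<close>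

definition hcount :: "nat set \<Rightarrow> nat set \<Rightarrow> (nat \<Rightarrow> nat) set \<Rightarrow> nat \<Rightarrow> nat \<Rightarrow> nat" where
  "hcount V T D n k = card {\<delta> \<in> exps V. \<delta> \<notin> D \<and> tdeg (V \<inter> T) \<delta> = n \<and> tdeg (V - T) \<delta> = k}"

lemma exps_empty [simp]: "exps {} = {\<lambda>_. 0}"
  by (auto simp: exps_def)

text \<open>Every sequence has a monotone subsequence, and a decreasing one of natural numbers is
  constant from the place on where it takes its least value.\<close>

lemma nat_seq_mono_subseq:
  fixes s :: "nat \<Rightarrow> nat"
  shows "\<exists>r::nat \<Rightarrow> nat. strict_mono r \<and> mono (s \<circ> r)"
proof -
  obtain r where r: "strict_mono r" "monoseq (\<lambda>n. s (r n))"
    using seq_monosub[of s] by blast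
  show ?thesis
  proof (cases "\<forall>m. \<forall>n\<ge>m. s (r m) \<le> s (r n)")
    case True
    then show ?thesis using r(1) by (intro exI[of _ r]) (simp add: mono_def)
  next
    case False
    with r(2) have dec: "\<And>m n. m \<le> n \<Longrightarrow> s (r n) \<le> s (r m)"
      unfolding monoseq_def by blast
    define l where "l = (LEAST l. \<exists>n. s (r n) = l)"
    have "\<exists>n. s (r n) = l" unfolding l_def by (rule LeastI_ex) blast
    then obtain N where N: "s (r N) = l" by blast
    have least: "l \<le> s (r n)" for n unfolding l_def by (rule Least_le) blast
    have "s (r (n + N)) = l" for n
      using dec[of N "n + N"] least[of "n + N"] N by simp
    moreover have "strict_mono (\<lambda>n. r (n + N))"
      using r(1) by (simp add: strict_mono_def)
    ultimately show ?thesis by (intro exI[of _ "\<lambda>n. r (n + N)"]) (simp add: mono_def)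
  qed
qed

text \<open>Coordinates are treated one at a time: passing to a further subsequence keeps the
  coordinates already made monotone.\<close>

lemma dickson:
  fixes x :: "nat \<Rightarrow> nat \<Rightarrow> nat"
  assumes "finite V"
  shows "\<exists>r::nat \<Rightarrow> nat. strict_mono r \<and> (\<forall>i\<in>V. mono (\<lambda>n. x (r n) i))"
  using assms
proof (induction V)
  case empty
  then show ?case by (intro exI[of _ id]) (simp add: strict_mono_def)
next
  case (insert v V)
  then obtain r :: "nat \<Rightarrow> nat" where r: "strict_mono r" "\<forall>i\<in>V. mono (\<lambda>n. x (r n) i)" by blast
  obtain q :: "nat \<Rightarrow> nat" where q: "strict_mono q" "mono ((\<lambda>n. x (r n) v) \<circ> q)"
    using nat_seq_mono_subseq[of "\<lambda>n. x (r n) v"] by blast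
  have mq: "mono q" using q(1) by (rule strict_mono_mono)
  have "mono (\<lambda>n. x (r (q n)) i)" if "i \<in> V" for i
  proof (rule monoI)
    fix m n :: nat assume "m \<le> n"
    then have "q m \<le> q n" using mq by (simp add: mono_def)
    then show "x (r (q m)) i \<le> x (r (q n)) i" using r(2) that by (simp add: mono_def)
  qed
  with r q show ?case
    by (intro exI[of _ "r \<circ> q"]) (auto simp: strict_mono_def o_def)
qed

lemma monomial_idealD:
  "monomial_ideal V D \<Longrightarrow> \<delta> \<in> D \<Longrightarrow> \<delta> \<in> exps V \<Longrightarrow> \<epsilon> \<in> exps V \<Longrightarrow> (\<lambda>i. \<delta> i + \<epsilon> i) \<in> D"
  by (simp add: monomial_ideal_def)

text \<open>From a strictly ascending chain choose \<open>x i\<close> in \<open>f (Suc i)\<close>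
  but not in \<open>f i\<close>. Some \<open>x (r 0)\<close> divides a later \<open>x (r 1)\<close>,
  which then lies in \<open>f (r 1)\<close>, a contradiction.\<close>

lemma wf_monomial_ideals:
  assumes "finite V"
  shows "wf {(U', U). monomial_ideal V U \<and> U \<inter> exps V \<subset> U' \<inter> exps V}"
  unfolding wf_iff_no_infinite_down_chain
proof
  assume "\<exists>f. \<forall>i. (f (Suc i), f i) \<in> {(U', U). monomial_ideal V U \<and> U \<inter> exps V \<subset> U' \<inter> exps V}"
  then obtain f where "\<forall>i. (f (Suc i), f i) \<in> {(U', U). monomial_ideal V U \<and> U \<inter> exps V \<subset> U' \<inter> exps V}"
    by (rule exE)
  then have f: "\<And>i. monomial_ideal V (f i)" "\<And>i. f i \<inter> exps V \<subset> f (Suc i) \<inter> exps V"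
    by simp_all
  have "\<forall>i. \<exists>\<delta>. \<delta> \<in> exps V \<and> \<delta> \<in> f (Suc i) \<and> \<delta> \<notin> f i" using f(2) by blast
  then obtain x where x: "\<And>i. x i \<in> exps V" "\<And>i. x i \<in> f (Suc i)" "\<And>i. x i \<notin> f i" by metis
  obtain r :: "nat \<Rightarrow> nat" where r: "strict_mono r" "\<forall>i\<in>V. mono (\<lambda>n. x (r n) i)"
    using dickson[OF assms] by blast
  have le: "x (r 0) i \<le> x (r 1) i" for i
  proof (cases "i \<in> V")
    case True then show ?thesis using r(2) by (simp add: mono_def)
  next
    case False then show ?thesis using x(1)[of "r 0"] by (simp add: exps_def)
  qed
  have inc: "f i \<inter> exps V \<subseteq> f j \<inter> exps V" if "i \<le> j" for i j
    using that by (induction j rule: dec_induct) (use f(2) in blast)+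
  have "r 0 < r 1" using r(1) by (simp add: strict_mono_def)
  then have "x (r 0) \<in> f (r 1)" using inc[of "Suc (r 0)" "r 1"] x(1,2)[of "r 0"] by auto
  moreover have "(\<lambda>i. x (r 1) i - x (r 0) i) \<in> exps V"
    using x(1)[of "r 1"] by (simp add: exps_def)
  ultimately have "(\<lambda>i. x (r 0) i + (x (r 1) i - x (r 0) i)) \<in> f (r 1)"
    using monomial_idealD[OF f(1)] x(1)[of "r 0"] by blast
  then have "x (r 1) \<in> f (r 1)" using le by simp
  then show False using x(3) by blast
qed

lemma finite_exps_tdeg:
  assumes "finite V"
  shows "finite {\<delta> \<in> exps V. tdeg (V \<inter> T) \<delta> = n \<and> tdeg (V - T) \<delta> = k}"
proof (rule finite_subset)
  show "finite {\<delta>. \<forall>i. (i \<in> V \<longrightarrow> \<delta> i \<in> {..n + k}) \<and> (i \<notin> V \<longrightarrow> \<delta> i = (0::nat))}"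
    by (rule finite_set_of_finite_funs) (use assms in auto)
  show "{\<delta> \<in> exps V. tdeg (V \<inter> T) \<delta> = n \<and> tdeg (V - T) \<delta> = k} \<subseteq>
      {\<delta>. \<forall>i. (i \<in> V \<longrightarrow> \<delta> i \<in> {..n + k}) \<and> (i \<notin> V \<longrightarrow> \<delta> i = 0)}"
  proof (intro subsetI CollectI allI conjI impI)
    fix \<delta> i
    assume *: "\<delta> \<in> {\<delta> \<in> exps V. tdeg (V \<inter> T) \<delta> = n \<and> tdeg (V - T) \<delta> = k}"
    { assume "i \<notin> V" with * show "\<delta> i = 0" by (simp add: exps_def) }
    assume i: "i \<in> V"
    show "\<delta> i \<in> {..n + k}"
    proof (cases "i \<in> T")
      case True
      then have "\<delta> i \<le> tdeg (V \<inter> T) \<delta>"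
        unfolding tdeg_def using assms i by (intro member_le_sum) auto
      with * show ?thesis by simp
    next
      case False
      then have "\<delta> i \<le> tdeg (V - T) \<delta>"
        unfolding tdeg_def using assms i by (intro member_le_sum) auto
      with * show ?thesis by simp
    qed
  qed
qed

lemma hcount_swap: "hcount V T D n k = hcount V (- T) D k n"
proof -
  have "V \<inter> - T = V - T" "V - - T = V \<inter> T" by auto
  then show ?thesis unfolding hcount_def by (auto intro: arg_cong[of _ _ card])
qed

lemma hcount_cong: "D \<inter> exps V = D' \<inter> exps V \<Longrightarrow> hcount V T D n k = hcount V T D' n k"
  unfolding hcount_def by (rule arg_cong[of _ _ card]) blast

text \<open>Sorting the counted exponents by the exponent \<open>t\<close> of the new variable
  leaves exponents in \<open>V\<close> of first degree \<open>n - t\<close> that avoid the slice of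
  \<open>D\<close> at height \<open>t\<close>.\<close>

lemma hcount_insert:
  assumes fin: "finite V" and v: "v \<notin> V" "v \<in> T"
  shows "hcount (insert v V) T D n k = (\<Sum>t\<le>n. hcount V T {\<delta>. \<delta>(v := t) \<in> D} (n - t) k)"
proof -
  define S where "S = {\<delta> \<in> exps (insert v V). \<delta> \<notin> D \<and> tdeg (insert v V \<inter> T) \<delta> = n \<and> tdeg (insert v V - T) \<delta> = k}"
  define W where "W t = {\<delta> \<in> exps V. \<delta> \<notin> {\<delta>. \<delta>(v := t) \<in> D} \<and> tdeg (V \<inter> T) \<delta> = n - t \<and> tdeg (V - T) \<delta> = k}" for t
  have deg1: "tdeg (insert v V \<inter> T) \<delta> = \<delta> v + tdeg (V \<inter> T) \<delta>" for \<delta>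
    using fin v by (simp add: tdeg_def Int_insert_left)
  have deg2: "tdeg (insert v V - T) \<delta> = tdeg (V - T) \<delta>" for \<delta>
    using v by (simp add: insert_Diff_if)
  have upd1: "tdeg (V \<inter> T) (\<delta>(v := t)) = tdeg (V \<inter> T) \<delta>" for \<delta> t
    unfolding tdeg_def using v by (intro sum.cong) auto
  have upd2: "tdeg (V - T) (\<delta>(v := t)) = tdeg (V - T) \<delta>" for \<delta> t
    unfolding tdeg_def using v by (intro sum.cong) auto
  have S: "S = (\<Union>t\<le>n. (\<lambda>\<delta>. \<delta>(v := t)) ` W t)"
  proof
    show "S \<subseteq> (\<Union>t\<le>n. (\<lambda>\<delta>. \<delta>(v := t)) ` W t)"
    proof
      fix \<delta> assume \<delta>: "\<delta> \<in> S"
      have "\<delta>(v := 0) \<in> W (\<delta> v)"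
        using \<delta> unfolding S_def W_def by (auto simp: exps_def deg1 deg2 upd1 upd2)
      moreover have "\<delta> = (\<delta>(v := 0))(v := \<delta> v)" by simp
      moreover have "\<delta> v \<le> n" using \<delta> unfolding S_def by (simp add: deg1)
      ultimately show "\<delta> \<in> (\<Union>t\<le>n. (\<lambda>\<delta>. \<delta>(v := t)) ` W t)" by blast
    qed
    show "(\<Union>t\<le>n. (\<lambda>\<delta>. \<delta>(v := t)) ` W t) \<subseteq> S"
      unfolding S_def W_def by (auto simp: exps_def deg1 deg2 upd1 upd2)
  qed
  have finW: "finite (W t)" for t
    unfolding W_def by (rule finite_subset[OF _ finite_exps_tdeg[OF fin, of T "n - t" k]]) auto
  have "card S = (\<Sum>t\<le>n. card ((\<lambda>\<delta>. \<delta>(v := t)) ` W t))"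
    unfolding S
  proof (rule card_UN_disjoint)
    show "\<forall>i\<in>{..n}. \<forall>j\<in>{..n}. i \<noteq> j \<longrightarrow>
        (\<lambda>\<delta>. \<delta>(v := i)) ` W i \<inter> (\<lambda>\<delta>. \<delta>(v := j)) ` W j = {}"
      by (auto dest: fun_upd_eqD)
  qed (use finW in auto)
  also have "\<dots> = (\<Sum>t\<le>n. card (W t))"
  proof (intro sum.cong refl card_image inj_onI)
    fix t \<delta> \<epsilon> assume "\<delta> \<in> W t" "\<epsilon> \<in> W t" and eq: "\<delta>(v := t) = \<epsilon>(v := t)"
    then have "\<delta> v = 0" "\<epsilon> v = 0" using v by (auto simp: W_def exps_def)
    with eq show "\<delta> = \<epsilon>" by (metis fun_upd_triv fun_upd_upd)
  qed
  finally show ?thesis unfolding hcount_def S_def W_def .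
qed

text \<open>The slices increase with the height because multiplication by the power
  \<open>t - s\<close> of the variable \<open>v\<close> carries the slice at \<open>s\<close> into
  the slice at \<open>t\<close>.\<close>

lemma monomial_ideal_slice:
  assumes D: "monomial_ideal (insert v V) D" and v: "v \<notin> V"
  shows "monomial_ideal V {\<delta>. \<delta>(v := t) \<in> D}"
    and "s \<le> t \<Longrightarrow> {\<delta>. \<delta>(v := s) \<in> D} \<inter> exps V \<subseteq> {\<delta>. \<delta>(v := t) \<in> D} \<inter> exps V"
proof -
  show "monomial_ideal V {\<delta>. \<delta>(v := t) \<in> D}"
    unfolding monomial_ideal_def
  proof (intro ballI impI CollectI)
    fix \<delta> \<epsilon> assume *: "\<delta> \<in> exps V" "\<epsilon> \<in> exps V" "\<delta> \<in> {\<delta>. \<delta>(v := t) \<in> D}"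
    then have "\<delta>(v := t) \<in> exps (insert v V)" "\<epsilon> \<in> exps (insert v V)" by (auto simp: exps_def)
    with D * have "(\<lambda>i. (\<delta>(v := t)) i + \<epsilon> i) \<in> D" by (auto simp: monomial_ideal_def)
    moreover have "(\<lambda>i. (\<delta>(v := t)) i + \<epsilon> i) = (\<lambda>i. \<delta> i + \<epsilon> i)(v := t)"
      using * v by (auto simp: exps_def)
    ultimately show "(\<lambda>i. \<delta> i + \<epsilon> i)(v := t) \<in> D" by simp
  qed
  assume st: "s \<le> t"
  show "{\<delta>. \<delta>(v := s) \<in> D} \<inter> exps V \<subseteq> {\<delta>. \<delta>(v := t) \<in> D} \<inter> exps V"
  proof
    fix \<delta> assume *: "\<delta> \<in> {\<delta>. \<delta>(v := s) \<in> D} \<inter> exps V"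
    then have "\<delta>(v := s) \<in> exps (insert v V)" "(\<lambda>i. if i = v then t - s else 0) \<in> exps (insert v V)"
      by (auto simp: exps_def)
    with * have "(\<lambda>i. (\<delta>(v := s)) i + (if i = v then t - s else 0)) \<in> D"
      using D[unfolded monomial_ideal_def, rule_format, of "\<delta>(v := s)"] by simp
    moreover have "(\<lambda>i. (\<delta>(v := s)) i + (if i = v then t - s else 0)) = \<delta>(v := t)"
      using st by auto
    ultimately show "\<delta> \<in> {\<delta>. \<delta>(v := t) \<in> D} \<inter> exps V" using * by simp
  qed
qed

lemma monomial_ideal_chain_stabilizes:
  assumes fin: "finite V" and U: "\<And>t::nat. monomial_ideal V (U t)"
    and inc: "\<And>s t. s \<le> t \<Longrightarrow> U s \<inter> exps V \<subseteq> U t \<inter> exps V"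
  obtains T where "\<And>t. T \<le> t \<Longrightarrow> U t \<inter> exps V = U T \<inter> exps V"
proof -
  have "range U \<noteq> {}" by simp
  from wf_monomial_ideals[OF fin] this show ?thesis
  proof (rule wfE_min')
    fix Z assume Z: "Z \<in> range U"
      "\<And>Y. (Y, Z) \<in> {(U', U). monomial_ideal V U \<and> U \<inter> exps V \<subset> U' \<inter> exps V} \<Longrightarrow> Y \<notin> range U"
    then obtain T where T: "Z = U T" by blast
    show ?thesis
    proof (rule that)
      fix t assume "T \<le> t"
      then have "U T \<inter> exps V \<subseteq> U t \<inter> exps V" by (rule inc)
      moreover have "\<not> U T \<inter> exps V \<subset> U t \<inter> exps V"
        using Z(2)[of "U t"] U[of T] unfolding T by blast
      ultimately show "U t \<inter> exps V = U T \<inter> exps V" by (simp add: psubset_eq)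
    qed
  qed
qed

text \<open>A new variable turns the count into a convolution over the slices of \<open>D\<close>.
  The slices form an ascending chain of monomial ideals, so only finitely many different kernels
  occur and \<open>binumerical_convolution\<close> applies.\<close>

theorem hcount_binumerical:
  assumes "finite V" "monomial_ideal V D"
  shows "binumerical (\<lambda>n k. int (hcount V T D n k))"
  using assms
proof (induction V arbitrary: D T)
  case empty
  have eq: "int (hcount {} T D n k) = (if n = 0 then of_bool ((\<lambda>_. 0) \<notin> D) else 0) * (if k = 0 then 1 else 0)" for n k
  proof -
    have "{\<delta> \<in> exps {}. \<delta> \<notin> D \<and> tdeg ({} \<inter> T) \<delta> = n \<and> tdeg ({} - T) \<delta> = k}
       = (if (\<lambda>_. 0) \<notin> D \<and> n = 0 \<and> k = 0 then {\<lambda>_. 0} else {})"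
      unfolding exps_empty tdeg_def by (auto simp del: exps_empty)
    then have "hcount {} T D n k = card (if (\<lambda>_. 0) \<notin> D \<and> n = 0 \<and> k = 0 then {\<lambda>_::nat. 0::nat} else {})"
      unfolding hcount_def by (rule arg_cong)
    then show ?thesis by simp
  qed
  have "\<forall>\<^sub>F n in sequentially. (if n = 0 then c else 0) = 0" for c :: int
    by (auto simp: eventually_sequentially intro!: exI[of _ 1])
  then have "numerical (\<lambda>n. if n = 0 then c else 0)" for c :: int
    by (rule numerical_eventually_const)
  then show ?case unfolding eq by (intro binumerical.prod)
next
  case (insert v V)
  have *: "binumerical (\<lambda>n k. int (hcount (insert v V) T D n k))" if v: "v \<in> T" for T
  proof -
    define U where "U t = {\<delta>. \<delta>(v := t) \<in> D}" for t
    have U: "monomial_ideal V (U t)" "s \<le> t \<Longrightarrow> U s \<inter> exps V \<subseteq> U t \<inter> exps V" for s t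
      unfolding U_def using monomial_ideal_slice[OF insert.prems insert.hyps(2)] by auto
    have "\<exists>T0. \<forall>t\<ge>T0. U t \<inter> exps V = U T0 \<inter> exps V"
    proof (rule monomial_ideal_chain_stabilizes[OF insert.hyps(1), of U])
      show "monomial_ideal V (U t)" for t by (rule U)
      show "U s \<inter> exps V \<subseteq> U t \<inter> exps V" if "s \<le> t" for s t by (rule U(2)[OF that])
    qed blast
    then obtain T0 where T0: "\<And>t. T0 \<le> t \<Longrightarrow> U t \<inter> exps V = U T0 \<inter> exps V"
      by blast
    have "binumerical (\<lambda>n k. \<Sum>t\<le>n. int (hcount V T (U t) (n - t) k))"
    proof (rule binumerical_convolution[where T = T0])
      show "binumerical (\<lambda>n k. int (hcount V T (U t) n k))" for t
        by (rule insert.IH) (rule U)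
      show "(\<lambda>n k. int (hcount V T (U t) n k)) = (\<lambda>n k. int (hcount V T (U T0) n k))"
        if "T0 \<le> t" for t
        using hcount_cong[OF T0[OF that]] by auto
    qed
    then show ?thesis
      unfolding hcount_insert[OF insert.hyps v] U_def by simp
  qed
  show ?case
  proof (cases "v \<in> T")
    case True then show ?thesis by (rule *)
  next
    case False
    \<comment> \<open>A variable of the second kind becomes one of the first kind for the complement
      of \<open>T\<close>.\<close>
    then have "binumerical (\<lambda>n k. int (hcount (insert v V) (- T) D n k))" by (intro *) simp
    from binumerical_swap[OF this] show ?thesis unfolding hcount_swap[of "insert v V" T] .
  qed
qed

lemma exps_add: "\<delta> \<in> exps V \<Longrightarrow> \<epsilon> \<in> exps V \<Longrightarrow> (\<lambda>i. \<delta> i + \<epsilon> i) \<in> exps V"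
  by (simp add: exps_def)

lemma tdeg_add: "tdeg V (\<lambda>i. \<delta> i + \<epsilon> i) = tdeg V \<delta> + tdeg V \<epsilon>"
  by (simp add: tdeg_def sum.distrib)

subsection \<open>A monomial order\<close>

text \<open>Generator index first, then lexicographic order of exponents. Elements are compared only
  inside one bidegree, where finitely many occur; beyond being a strict order, what matters is
  totality and invariance under adding an exponent.\<close>

definition mless :: "nat \<times> (nat \<Rightarrow> nat) \<Rightarrow> nat \<times> (nat \<Rightarrow> nat) \<Rightarrow> bool" where
  "mless a b \<longleftrightarrow> fst a < fst b \<or> fst a = fst b \<and> less_fun (snd a) (snd b)"

lemma mless_irrefl: "\<not> mless a a"
  by (simp add: mless_def less_fun_irrefl)

lemma mless_trans: "mless a b \<Longrightarrow> mless b c \<Longrightarrow> mless a c"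
  by (auto simp: mless_def intro: less_fun_trans)

lemma mless_total:
  assumes "finite V" "snd a \<in> exps V" "snd b \<in> exps V"
  shows "mless a b \<or> a = b \<or> mless b a"
proof -
  have "finite {k. snd a k \<noteq> snd b k}"
    by (rule finite_subset[OF _ assms(1)], rule subsetI, rule ccontr)
       (use assms(2,3) in \<open>simp add: exps_def\<close>)
  then have "less_fun (snd a) (snd b) \<or> snd a = snd b \<or> less_fun (snd b) (snd a)"
    by (rule less_fun_trichotomy)
  then show ?thesis by (cases a; cases b) (auto simp: mless_def)
qed

lemma mless_add: "mless (g, \<delta>) (h, \<epsilon>) \<Longrightarrow> mless (g, \<lambda>i. \<delta> i + \<zeta> i) (h, \<lambda>i. \<epsilon> i + \<zeta> i)"
  unfolding mless_def less_fun_def fst_conv snd_conv by (simp only: add_less_cancel_right add_right_cancel)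

section \<open>Lengths of intervals in lattices of submodules\<close>

text \<open>The lattice is a predicate \<open>S\<close>, so that submodules of \<open>M\<close>,
  submodules of a quotient and ideals fall under one notion and lengths can be carried from one to
  another.\<close>

definition has_chain :: "('x set \<Rightarrow> bool) \<Rightarrow> nat \<Rightarrow> 'x set \<Rightarrow> 'x set \<Rightarrow> bool" where
  "has_chain S n X Y \<longleftrightarrow>
     (\<exists>C. (\<forall>i\<le>n. S (C i) \<and> X \<subseteq> C i \<and> C i \<subseteq> Y) \<and> (\<forall>i<n. C i \<subset> C (Suc i)))"

definition len :: "('x set \<Rightarrow> bool) \<Rightarrow> 'x set \<Rightarrow> 'x set \<Rightarrow> enat" where
  "len S X Y = Sup {enat n | n. has_chain S n X Y}"

lemma has_chain_shorter: "has_chain S n X Y \<Longrightarrow> m \<le> n \<Longrightarrow> has_chain S m X Y"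
  unfolding has_chain_def by (meson order_trans order_less_le_trans)

lemma has_chain_mono: "has_chain S n X Y \<Longrightarrow> X' \<subseteq> X \<Longrightarrow> Y \<subseteq> Y' \<Longrightarrow> has_chain S n X' Y'"
  unfolding has_chain_def by (meson order_trans)

lemma has_chain_0: "S X \<Longrightarrow> X \<subseteq> Y \<Longrightarrow> has_chain S 0 X Y"
  unfolding has_chain_def by (intro exI[of _ "\<lambda>_. X"]) simp

lemma has_chain_snoc:
  assumes "has_chain S n X Y" "Y \<subset> Y'" "S Y'"
  shows "has_chain S (Suc n) X Y'"
proof -
  obtain C where C: "\<forall>i\<le>n. S (C i) \<and> X \<subseteq> C i \<and> C i \<subseteq> Y" "\<forall>i<n. C i \<subset> C (Suc i)"
    using assms(1) unfolding has_chain_def by blast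
  let ?C = "C(Suc n := Y')"
  have "S (?C i) \<and> X \<subseteq> ?C i \<and> ?C i \<subseteq> Y'" if "i \<le> Suc n" for i
  proof (cases "i = Suc n")
    case True
    have "X \<subseteq> C n" "C n \<subseteq> Y" using C(1) by simp_all
    then show ?thesis using True assms(2,3) by auto
  next
    case False
    then have "i \<le> n" using that by simp
    then have "S (C i) \<and> X \<subseteq> C i \<and> C i \<subseteq> Y" using C(1) by blast
    then show ?thesis using False assms(2) by auto
  qed
  moreover have "?C i \<subset> ?C (Suc i)" if "i < Suc n" for i
  proof (cases "i = n")
    case True
    have "C n \<subseteq> Y" using C(1) by simp
    then show ?thesis using True assms(2) by auto
  next
    case False
    then show ?thesis using that C(2) by auto
  qed
  ultimately show ?thesis unfolding has_chain_def by (intro exI[of _ ?C]) blast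
qed

text \<open>Chains can be shortened, so the possible lengths form an initial segment and the
  supremum is determined by which \<open>n\<close> occur. Equations between lengths become
  statements about chains, infinite length included.\<close>

lemma len_ge_iff:
  assumes "S X" "X \<subseteq> Y"
  shows "enat n \<le> len S X Y \<longleftrightarrow> has_chain S n X Y"
proof
  assume le: "enat n \<le> len S X Y"
  show "has_chain S n X Y"
  proof (rule ccontr)
    assume not: "\<not> has_chain S n X Y"
    then obtain m where m: "n = Suc m" using has_chain_0[of S, OF assms] by (cases n) auto
    have "len S X Y \<le> enat m"
      unfolding len_def
    proof (rule Sup_least)
      fix x assume "x \<in> {enat n |n. has_chain S n X Y}"
      then obtain i where i: "x = enat i" "has_chain S i X Y" by blast
      have "\<not> n \<le> i" using has_chain_shorter[OF i(2), of n] not by blast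
      then show "x \<le> enat m" using i(1) m by simp
    qed
    then have "enat n \<le> enat m" using le by (rule order_trans[rotated])
    then show False using m by simp
  qed
next
  assume "has_chain S n X Y"
  then show "enat n \<le> len S X Y" unfolding len_def by (intro Sup_upper) blast
qed

lemma has_chain_image:
  assumes "has_chain S n X Y"
    and "\<And>Z. S Z \<Longrightarrow> X \<subseteq> Z \<Longrightarrow> Z \<subseteq> Y \<Longrightarrow> S' (F Z) \<and> X' \<subseteq> F Z \<and> F Z \<subseteq> Y'"
    and "\<And>Z Z'. S Z \<Longrightarrow> X \<subseteq> Z \<Longrightarrow> S Z' \<Longrightarrow> Z' \<subseteq> Y \<Longrightarrow> Z \<subset> Z' \<Longrightarrow> F Z \<subset> F Z'"
  shows "has_chain S' n X' Y'"
proof -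
  obtain C where C: "\<And>i. i \<le> n \<Longrightarrow> S (C i) \<and> X \<subseteq> C i \<and> C i \<subseteq> Y" "\<And>i. i < n \<Longrightarrow> C i \<subset> C (Suc i)"
    using assms(1) unfolding has_chain_def by blast
  have "S' (F (C i)) \<and> X' \<subseteq> F (C i) \<and> F (C i) \<subseteq> Y'" if "i \<le> n" for i
    using assms(2) C(1)[OF that] by blast
  moreover have "F (C i) \<subset> F (C (Suc i))" if "i < n" for i
    using assms(3)[of "C i" "C (Suc i)"] C(1)[of i] C(1)[of "Suc i"] C(2)[OF that] that by simp
  ultimately show ?thesis unfolding has_chain_def by (intro exI[of _ "\<lambda>i. F (C i)"]) blast
qed

lemma len_image_le:
  assumes "\<And>Z. S Z \<Longrightarrow> X \<subseteq> Z \<Longrightarrow> Z \<subseteq> Y \<Longrightarrow> S' (F Z) \<and> X' \<subseteq> F Z \<and> F Z \<subseteq> Y'"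
    and "\<And>Z Z'. S Z \<Longrightarrow> X \<subseteq> Z \<Longrightarrow> S Z' \<Longrightarrow> Z' \<subseteq> Y \<Longrightarrow> Z \<subset> Z' \<Longrightarrow> F Z \<subset> F Z'"
  shows "len S X Y \<le> len S' X' Y'"
proof -
  have "has_chain S' n X' Y'" if "has_chain S n X Y" for n
  proof (rule has_chain_image[where S = S and F = F, OF that])
    show "S' (F Z) \<and> X' \<subseteq> F Z \<and> F Z \<subseteq> Y'" if "S Z" "X \<subseteq> Z" "Z \<subseteq> Y" for Z
      using that by (rule assms(1))
    show "F Z \<subset> F Z'" if "S Z" "X \<subseteq> Z" "S Z'" "Z' \<subseteq> Y" "Z \<subset> Z'" for Z Z'
      using that by (rule assms(2))
  qed
  then show ?thesis unfolding len_def by (intro Sup_subset_mono) blast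
qed

lemma len_mono:
  assumes "X' \<subseteq> X" "Y \<subseteq> Y'"
  shows "len S X Y \<le> len S X' Y'"
  unfolding len_def using has_chain_mono[of S _ X Y, OF _ assms] by (intro Sup_subset_mono) blast

lemma len_zero_imp_eq:
  assumes "len S X Y = 0" "S X" "S Y" "X \<subseteq> Y"
  shows "X = Y"
proof (rule ccontr)
  assume "X \<noteq> Y"
  then have "has_chain S (Suc 0) X Y"
    using assms by (intro has_chain_snoc[OF has_chain_0[of S X X]]) auto
  then have "enat (Suc 0) \<le> len S X Y" using len_ge_iff[of S X Y] assms by blast
  then show False using assms(1) by (simp add: zero_enat_def)
qed

lemma len_refl: "S X \<Longrightarrow> len S X X = 0"
proof -
  assume S: "S X"
  have "\<not> has_chain S (Suc 0) X X"
  proof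
    assume "has_chain S (Suc 0) X X"
    then obtain C where C: "\<forall>i\<le>Suc 0. S (C i) \<and> X \<subseteq> C i \<and> C i \<subseteq> X" "\<forall>i<Suc 0. C i \<subset> C (Suc i)"
      unfolding has_chain_def by (elim exE conjE)
    have "C 0 = X" "C (Suc 0) = X" using C(1) by auto
    then show False using C(2)[rule_format, of 0] by simp
  qed
  then have "\<not> enat (Suc 0) \<le> len S X X" using len_ge_iff[of S X X] S by blast
  then show ?thesis by (cases "len S X X") (auto simp: zero_enat_def)
qed

lemma enat_eqI: "(\<And>n. enat n \<le> u \<longleftrightarrow> enat n \<le> v) \<Longrightarrow> u = v"
proof (rule antisym)
  have le: "x \<le> y" if "\<And>n. enat n \<le> x \<Longrightarrow> enat n \<le> y" for x y :: enat
  proof (cases x)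
    case (enat n) then show ?thesis using that[of n] by simp
  next
    case infinity
    then have *: "enat n \<le> y" for n using that by simp
    show ?thesis
    proof (cases y)
      case (enat m) with *[of "Suc m"] show ?thesis by simp
    qed simp
  qed
  assume *: "\<And>n. enat n \<le> u \<longleftrightarrow> enat n \<le> v"
  show "u \<le> v" by (rule le) (simp add: *)
  show "v \<le> u" by (rule le) (simp add: *)
qed

lemma enat_le_add_iff: "enat n \<le> u + v \<longleftrightarrow> (\<exists>a b. n \<le> a + b \<and> enat a \<le> u \<and> enat b \<le> v)"
proof
  assume n: "enat n \<le> u + v"
  show "\<exists>a b. n \<le> a + b \<and> enat a \<le> u \<and> enat b \<le> v"
  proof (cases u)
    case infinity
    then show ?thesis by (intro exI[of _ n] exI[of _ 0]) (simp add: zero_enat_def[symmetric])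
  next
    case u: (enat a)
    show ?thesis
    proof (cases v)
      case infinity
      then show ?thesis by (intro exI[of _ 0] exI[of _ n]) (simp add: zero_enat_def[symmetric])
    next
      case (enat b)
      with u n show ?thesis by (intro exI[of _ a] exI[of _ b]) simp
    qed
  qed
next
  assume "\<exists>a b. n \<le> a + b \<and> enat a \<le> u \<and> enat b \<le> v"
  then obtain a b where "n \<le> a + b" "enat a \<le> u" "enat b \<le> v" by blast
  then show "enat n \<le> u + v"
    by (metis add_mono enat_ord_simps(1) order_trans plus_enat_simps(1))
qed

subsection \<open>Generated submodules\<close>

definition span :: "('a, 'r) ring_scheme \<Rightarrow> ('a, 'b, 's) module_scheme \<Rightarrow> 'b set \<Rightarrow> 'b set" where
  "span R M X = \<Inter>{N. submodule N R M \<and> X \<subseteq> N}"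

context module
begin

abbreviation sub :: "'c set \<Rightarrow> bool" where
  "sub N \<equiv> submodule N R M"

lemma sub_subset: "sub N \<Longrightarrow> N \<subseteq> carrier M"
  by (rule submoduleE)

lemma sub_carr: "sub N \<Longrightarrow> x \<in> N \<Longrightarrow> x \<in> carrier M"
  using sub_subset by blast

lemma sub_zero: "sub N \<Longrightarrow> \<zero>\<^bsub>M\<^esub> \<in> N"
  using submodule.axioms(1) subgroup.one_closed by fastforce

lemma sub_add: "sub N \<Longrightarrow> x \<in> N \<Longrightarrow> y \<in> N \<Longrightarrow> x \<oplus>\<^bsub>M\<^esub> y \<in> N"
  by (rule submoduleE(5))

lemma sub_neg: "sub N \<Longrightarrow> x \<in> N \<Longrightarrow> \<ominus>\<^bsub>M\<^esub> x \<in> N"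
  by (rule submoduleE(3))

lemma sub_smult: "sub N \<Longrightarrow> a \<in> carrier R \<Longrightarrow> x \<in> N \<Longrightarrow> a \<odot>\<^bsub>M\<^esub> x \<in> N"
  by (rule submoduleE(4))

lemma sub_add_cancel:
  assumes "sub N" "x \<in> N" "x \<oplus>\<^bsub>M\<^esub> y \<in> N" "y \<in> carrier M"
  shows "y \<in> N"
proof -
  have x: "x \<in> carrier M" using assms sub_carr by blast
  have "\<ominus>\<^bsub>M\<^esub> x \<oplus>\<^bsub>M\<^esub> (x \<oplus>\<^bsub>M\<^esub> y) \<in> N" by (intro sub_add sub_neg assms)
  then show ?thesis using x assms(4) by (simp add: M.r_neg1)
qed

lemma sub_Inter:
  assumes "\<And>N. N \<in> \<N> \<Longrightarrow> sub N" "\<N> \<noteq> {}"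
  shows "sub (\<Inter>\<N>)"
proof (rule submoduleI)
  show "\<Inter>\<N> \<subseteq> carrier M" using assms sub_subset by blast
qed (use assms in \<open>auto intro: sub_zero sub_neg sub_add sub_smult\<close>)

lemma sub_Int: "sub N \<Longrightarrow> sub N' \<Longrightarrow> sub (N \<inter> N')"
  using sub_Inter[of "{N, N'}"] by auto

lemma sub_span: "X \<subseteq> carrier M \<Longrightarrow> sub (span R M X)"
  unfolding span_def by (rule sub_Inter) (use carrier_is_submodule in blast)+

lemma span_superset: "X \<subseteq> span R M X"
  unfolding span_def by blast

lemma span_base: "x \<in> X \<Longrightarrow> x \<in> span R M X"
  using span_superset by blast

lemma span_least: "sub N \<Longrightarrow> X \<subseteq> N \<Longrightarrow> span R M X \<subseteq> N"
  unfolding span_def by blast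

lemma span_mono: "X \<subseteq> X' \<Longrightarrow> span R M X \<subseteq> span R M X'"
  unfolding span_def by blast

lemma span_id: "sub N \<Longrightarrow> span R M N = N"
  using span_least span_superset by blast

lemma span_subset_carrier: "X \<subseteq> carrier M \<Longrightarrow> span R M X \<subseteq> carrier M"
  using sub_span sub_subset by blast

lemma sub_sum:
  assumes "sub N" "sub N'"
  shows "sub {x \<oplus>\<^bsub>M\<^esub> y | x y. x \<in> N \<and> y \<in> N'}" (is "sub ?S")
proof (rule submoduleI)
  show "?S \<subseteq> carrier M" using assms sub_carr by blast
  have "\<zero>\<^bsub>M\<^esub> = \<zero>\<^bsub>M\<^esub> \<oplus>\<^bsub>M\<^esub> \<zero>\<^bsub>M\<^esub>" by simp
  then show "\<zero>\<^bsub>M\<^esub> \<in> ?S" using sub_zero[OF assms(1)] sub_zero[OF assms(2)] by blast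
next
  fix a assume "a \<in> ?S"
  then obtain x y where *: "a = x \<oplus>\<^bsub>M\<^esub> y" "x \<in> N" "y \<in> N'" by blast
  then have "\<ominus>\<^bsub>M\<^esub> a = \<ominus>\<^bsub>M\<^esub> x \<oplus>\<^bsub>M\<^esub> \<ominus>\<^bsub>M\<^esub> y" using M.minus_add sub_carr assms by blast
  then show "\<ominus>\<^bsub>M\<^esub> a \<in> ?S" using sub_neg assms * by blast
next
  fix a b assume "a \<in> ?S" "b \<in> ?S"
  then obtain x y x' y' where *: "a = x \<oplus>\<^bsub>M\<^esub> y" "x \<in> N" "y \<in> N'"
    "b = x' \<oplus>\<^bsub>M\<^esub> y'" "x' \<in> N" "y' \<in> N'" by blast
  then have c: "x \<in> carrier M" "x' \<in> carrier M" "y \<in> carrier M" "y' \<in> carrier M"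
    using assms sub_carr by blast+
  have "a \<oplus>\<^bsub>M\<^esub> b = (x \<oplus>\<^bsub>M\<^esub> x') \<oplus>\<^bsub>M\<^esub> (y \<oplus>\<^bsub>M\<^esub> y')"
    using c unfolding * by (simp add: M.a_ac)
  moreover have "x \<oplus>\<^bsub>M\<^esub> x' \<in> N" "y \<oplus>\<^bsub>M\<^esub> y' \<in> N'" using * assms sub_add by blast+
  ultimately show "a \<oplus>\<^bsub>M\<^esub> b \<in> ?S" by blast
next
  fix a b assume a: "a \<in> carrier R" and "b \<in> ?S"
  then obtain x y where *: "b = x \<oplus>\<^bsub>M\<^esub> y" "x \<in> N" "y \<in> N'" by blast
  then have "a \<odot>\<^bsub>M\<^esub> b = a \<odot>\<^bsub>M\<^esub> x \<oplus>\<^bsub>M\<^esub> a \<odot>\<^bsub>M\<^esub> y"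
    using a assms sub_carr smult_r_distr by blast
  then show "a \<odot>\<^bsub>M\<^esub> b \<in> ?S" using * a assms sub_smult by blast
qed

lemma span_Un_iff:
  assumes "sub N" "sub N'"
  shows "z \<in> span R M (N \<union> N') \<longleftrightarrow> (\<exists>x\<in>N. \<exists>y\<in>N'. z = x \<oplus>\<^bsub>M\<^esub> y)"
proof
  have "N \<union> N' \<subseteq> {x \<oplus>\<^bsub>M\<^esub> y | x y. x \<in> N \<and> y \<in> N'}"
  proof (intro Un_least subsetI)
    fix x assume "x \<in> N"
    moreover from this have "x = x \<oplus>\<^bsub>M\<^esub> \<zero>\<^bsub>M\<^esub>" using sub_carr[OF assms(1)] by simp
    ultimately show "x \<in> {x \<oplus>\<^bsub>M\<^esub> y | x y. x \<in> N \<and> y \<in> N'}"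
      using sub_zero[OF assms(2)] by blast
  next
    fix x assume "x \<in> N'"
    moreover from this have "x = \<zero>\<^bsub>M\<^esub> \<oplus>\<^bsub>M\<^esub> x" using sub_carr[OF assms(2)] by simp
    ultimately show "x \<in> {x \<oplus>\<^bsub>M\<^esub> y | x y. x \<in> N \<and> y \<in> N'}"
      using sub_zero[OF assms(1)] by blast
  qed
  moreover assume "z \<in> span R M (N \<union> N')"
  ultimately have "z \<in> {x \<oplus>\<^bsub>M\<^esub> y | x y. x \<in> N \<and> y \<in> N'}"
    using span_least[OF sub_sum[OF assms]] by blast
  then show "\<exists>x\<in>N. \<exists>y\<in>N'. z = x \<oplus>\<^bsub>M\<^esub> y" by blast
next
  assume "\<exists>x\<in>N. \<exists>y\<in>N'. z = x \<oplus>\<^bsub>M\<^esub> y"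
  moreover have "sub (span R M (N \<union> N'))" using assms sub_subset by (intro sub_span) blast
  ultimately show "z \<in> span R M (N \<union> N')" using sub_add span_base by blast
qed

lemma span_Un_span:
  assumes "X \<subseteq> carrier M" "Y \<subseteq> carrier M"
  shows "span R M (span R M X \<union> Y) = span R M (X \<union> Y)"
proof
  have "sub (span R M (X \<union> Y))" using assms by (intro sub_span) blast
  moreover have "span R M X \<subseteq> span R M (X \<union> Y)" "Y \<subseteq> span R M (X \<union> Y)"
    using span_mono[of X "X \<union> Y"] span_superset[of "X \<union> Y"] by blast+
  ultimately show "span R M (span R M X \<union> Y) \<subseteq> span R M (X \<union> Y)" by (intro span_least) blast+
  show "span R M (X \<union> Y) \<subseteq> span R M (span R M X \<union> Y)"
    using span_superset[of X] by (intro span_mono) blast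
qed

text \<open>The modular law: a strict inclusion stays strict after intersecting with \<open>Y\<close> or after adding \<open>Y\<close>.\<close>

lemma chain_split:
  assumes Y: "sub Y" and C: "\<And>i. i \<le> n \<Longrightarrow> sub (C i)" "\<And>i. i < n \<Longrightarrow> C i \<subset> C (Suc i)"
  shows "\<exists>a b. n \<le> a + b \<and> has_chain sub a (C 0 \<inter> Y) (C n \<inter> Y)
     \<and> has_chain sub b (span R M (C 0 \<union> Y)) (span R M (C n \<union> Y))"
  using C
proof (induction n)
  case 0
  have "sub (C 0)" using 0 by simp
  then have "sub (C 0 \<inter> Y)" "sub (span R M (C 0 \<union> Y))"
    using Y sub_subset by (auto intro!: sub_Int sub_span)
  then show ?case by (intro exI[of _ 0]) (auto intro: has_chain_0)
next
  case (Suc n)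
  then obtain a b where ab: "n \<le> a + b" "has_chain sub a (C 0 \<inter> Y) (C n \<inter> Y)"
     "has_chain sub b (span R M (C 0 \<union> Y)) (span R M (C n \<union> Y))" by auto
  have s: "sub (C n)" "sub (C (Suc n))" "C n \<subset> C (Suc n)" using Suc.prems by auto
  have si: "sub (C (Suc n) \<inter> Y)" using s Y by (intro sub_Int)
  have ss: "sub (span R M (C (Suc n) \<union> Y))" using s Y sub_subset by (intro sub_span) blast
  have subset: "C n \<inter> Y \<subseteq> C (Suc n) \<inter> Y" "span R M (C n \<union> Y) \<subseteq> span R M (C (Suc n) \<union> Y)"
    using s by (auto intro!: span_mono)
  show ?case
  proof (cases "C n \<inter> Y = C (Suc n) \<inter> Y")
    case False
    then have "has_chain sub (Suc a) (C 0 \<inter> Y) (C (Suc n) \<inter> Y)"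
      using subset by (intro has_chain_snoc[OF ab(2)] si) blast
    moreover have "has_chain sub b (span R M (C 0 \<union> Y)) (span R M (C (Suc n) \<union> Y))"
      by (rule has_chain_mono[OF ab(3) order_refl subset(2)])
    ultimately show ?thesis using ab(1) by (intro exI[of _ "Suc a"] exI[of _ b]) simp
  next
    case True
    \<comment> \<open>If neither operation separated the two members, an element of the larger one
      would be \<open>c + y\<close> with \<open>y\<close> in the common intersection with
      \<open>Y\<close>, hence would lie in the smaller one.\<close>
    have "span R M (C n \<union> Y) \<noteq> span R M (C (Suc n) \<union> Y)"
    proof
      assume eq: "span R M (C n \<union> Y) = span R M (C (Suc n) \<union> Y)"
      obtain z where z: "z \<in> C (Suc n)" "z \<notin> C n" using s by blast
      then have "z \<in> span R M (C n \<union> Y)" unfolding eq by (intro span_base) simp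
      then obtain c y where cy: "c \<in> C n" "y \<in> Y" "z = c \<oplus>\<^bsub>M\<^esub> y"
        unfolding span_Un_iff[OF s(1) Y] by blast
      have "y \<in> C (Suc n)"
        by (rule sub_add_cancel[OF s(2), of c]) (use cy z s sub_carr[OF Y] in auto)
      then have "y \<in> C n" using cy True by blast
      then show False using cy z sub_add[OF s(1)] by blast
    qed
    then have "has_chain sub (Suc b) (span R M (C 0 \<union> Y)) (span R M (C (Suc n) \<union> Y))"
      using subset by (intro has_chain_snoc[OF ab(3)] ss) blast
    moreover have "has_chain sub a (C 0 \<inter> Y) (C (Suc n) \<inter> Y)"
      by (rule has_chain_mono[OF ab(2) order_refl subset(1)])
    ultimately show ?thesis using ab(1) by (intro exI[of _ a] exI[of _ "Suc b"]) simp
  qed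
qed

lemma has_chain_concat:
  assumes "has_chain sub a X Y" "has_chain sub b Y Z"
  shows "has_chain sub (a + b) X Z"
proof -
  obtain C where C: "\<And>i. i \<le> b \<Longrightarrow> sub (C i) \<and> Y \<subseteq> C i \<and> C i \<subseteq> Z" "\<And>i. i < b \<Longrightarrow> C i \<subset> C (Suc i)"
    using assms(2) unfolding has_chain_def by blast
  have "has_chain sub (a + i) X (C i)" if "i \<le> b" for i
    using that
  proof (induction i)
    case 0
    then show ?case using has_chain_mono[OF assms(1)] C(1)[of 0] by simp
  next
    case (Suc i)
    then show ?case using has_chain_snoc[of sub "a + i" X "C i" "C (Suc i)"] C(1)[of "Suc i"] C(2)[of i] by simp
  qed
  from has_chain_mono[OF this[of b]] show ?thesis using C(1)[of b] by simp
qed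

text \<open>One inequality comes from \<open>chain_split\<close>, the other from concatenation.
  Arguing with chains makes additivity available before any length is known to be finite.\<close>

theorem len_add:
  assumes "sub X" "sub Y" "sub Z" "X \<subseteq> Y" "Y \<subseteq> Z"
  shows "len sub X Z = len sub X Y + len sub Y Z"
proof (rule enat_eqI)
  fix n
  have XZ: "X \<subseteq> Z" using assms by blast
  have "has_chain sub n X Z \<longleftrightarrow> (\<exists>a b. n \<le> a + b \<and> has_chain sub a X Y \<and> has_chain sub b Y Z)"
  proof
    assume "has_chain sub n X Z"
    then obtain C where C: "\<And>i. i \<le> n \<Longrightarrow> sub (C i) \<and> X \<subseteq> C i \<and> C i \<subseteq> Z" "\<And>i. i < n \<Longrightarrow> C i \<subset> C (Suc i)"
      unfolding has_chain_def by blast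
    obtain a b where ab: "n \<le> a + b" "has_chain sub a (C 0 \<inter> Y) (C n \<inter> Y)"
     "has_chain sub b (span R M (C 0 \<union> Y)) (span R M (C n \<union> Y))"
      using chain_split[OF assms(2), of n C] C by blast
    have "has_chain sub a X Y"
      by (rule has_chain_mono[OF ab(2)]) (use C(1)[of 0] assms in auto)
    moreover have "has_chain sub b Y Z"
    proof (rule has_chain_mono[OF ab(3)])
      show "Y \<subseteq> span R M (C 0 \<union> Y)" using span_superset by blast
      show "span R M (C n \<union> Y) \<subseteq> Z" using C(1)[of n] assms by (intro span_least) auto
    qed
    ultimately show "\<exists>a b. n \<le> a + b \<and> has_chain sub a X Y \<and> has_chain sub b Y Z"
      using ab(1) by blast
  next
    assume "\<exists>a b. n \<le> a + b \<and> has_chain sub a X Y \<and> has_chain sub b Y Z"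
    then show "has_chain sub n X Z" using has_chain_concat has_chain_shorter by blast
  qed
  then show "enat n \<le> len sub X Z \<longleftrightarrow> enat n \<le> len sub X Y + len sub Y Z"
    unfolding enat_le_add_iff len_ge_iff[of sub, OF assms(1) XZ]
      len_ge_iff[of sub, OF assms(1,4)] len_ge_iff[of sub, OF assms(2,5)] .
qed

section \<open>Length bounds for submodules generated by scalar multiples\<close>

lemma sub_smult_image:
  assumes Y: "ideal Y R" and e: "e \<in> carrier M"
  shows "sub ((\<lambda>c. c \<odot>\<^bsub>M\<^esub> e) ` Y)"
proof -
  interpret Y: ideal Y R by (rule Y)
  show ?thesis
  proof (rule submoduleI)
    show "(\<lambda>c. c \<odot>\<^bsub>M\<^esub> e) ` Y \<subseteq> carrier M" using e Y.Icarr by auto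
    have "\<zero> \<odot>\<^bsub>M\<^esub> e \<in> (\<lambda>c. c \<odot>\<^bsub>M\<^esub> e) ` Y" by (intro imageI) (rule Y.zero_closed)
    then show "\<zero>\<^bsub>M\<^esub> \<in> (\<lambda>c. c \<odot>\<^bsub>M\<^esub> e) ` Y" using e by simp
  next
    fix a assume "a \<in> (\<lambda>c. c \<odot>\<^bsub>M\<^esub> e) ` Y"
    then obtain c where c: "c \<in> Y" "a = c \<odot>\<^bsub>M\<^esub> e" by blast
    have "(\<ominus> c) \<odot>\<^bsub>M\<^esub> e \<in> (\<lambda>c. c \<odot>\<^bsub>M\<^esub> e) ` Y" by (intro imageI Y.a_inv_closed c)
    then show "\<ominus>\<^bsub>M\<^esub> a \<in> (\<lambda>c. c \<odot>\<^bsub>M\<^esub> e) ` Y" using c e Y.Icarr by (simp add: smult_l_minus)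
  next
    fix a b assume "a \<in> (\<lambda>c. c \<odot>\<^bsub>M\<^esub> e) ` Y" "b \<in> (\<lambda>c. c \<odot>\<^bsub>M\<^esub> e) ` Y"
    then obtain c d where c: "c \<in> Y" "a = c \<odot>\<^bsub>M\<^esub> e" "d \<in> Y" "b = d \<odot>\<^bsub>M\<^esub> e" by blast
    have "(c \<oplus> d) \<odot>\<^bsub>M\<^esub> e \<in> (\<lambda>c. c \<odot>\<^bsub>M\<^esub> e) ` Y" by (intro imageI Y.a_closed c)
    then show "a \<oplus>\<^bsub>M\<^esub> b \<in> (\<lambda>c. c \<odot>\<^bsub>M\<^esub> e) ` Y" using c e Y.Icarr by (simp add: smult_l_distr)
  next
    fix a b assume a: "a \<in> carrier R" and "b \<in> (\<lambda>c. c \<odot>\<^bsub>M\<^esub> e) ` Y"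
    then obtain d where c: "d \<in> Y" "b = d \<odot>\<^bsub>M\<^esub> e" by blast
    have "(a \<otimes> d) \<odot>\<^bsub>M\<^esub> e \<in> (\<lambda>c. c \<odot>\<^bsub>M\<^esub> e) ` Y" by (intro imageI Y.I_l_closed c a)
    then show "a \<odot>\<^bsub>M\<^esub> b \<in> (\<lambda>c. c \<odot>\<^bsub>M\<^esub> e) ` Y" using c a e Y.Icarr by (simp add: smult_assoc1)
  qed
qed

lemma ideal_colon:
  assumes Y: "ideal Y R" and Z: "sub Z" and e: "e \<in> carrier M"
  shows "ideal {c \<in> Y. c \<odot>\<^bsub>M\<^esub> e \<in> Z} R" (is "ideal ?H R")
proof -
  interpret Y: ideal Y R by (rule Y)
  have zero: "\<zero> \<in> ?H" using sub_zero[OF Z] e by (simp add: Y.zero_closed)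
  have l: "x \<otimes> a \<in> ?H" if "a \<in> ?H" "x \<in> carrier R" for a x
    using that e sub_smult[OF Z] Y.I_l_closed Y.Icarr by (simp add: smult_assoc1)
  show ?thesis
  proof (rule idealI)
    show "subgroup ?H (add_monoid R)"
    proof (rule R.add.subgroupI)
      show "?H \<subseteq> carrier R" using Y.Icarr by blast
      show "?H \<noteq> {}" using zero by blast
      show "\<ominus> a \<in> ?H" if "a \<in> ?H" for a
        using that e sub_neg[OF Z] Y.Icarr Y.a_inv_closed by (simp add: smult_l_minus)
      show "a \<oplus> b \<in> ?H" if "a \<in> ?H" "b \<in> ?H" for a b
        using that e sub_add[OF Z] Y.Icarr Y.a_closed by (simp add: smult_l_distr)
    qed
    show "a \<otimes> x \<in> ?H" if "a \<in> ?H" "x \<in> carrier R" for a x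
      using l[OF that] that Y.Icarr by (metis (no_types, lifting) R.m_comm mem_Collect_eq)
  qed (use l R.ring_axioms in auto)
qed

text \<open>Taking the coefficients \<open>c \<in> Y\<close> with \<open>c e \<in> Z\<close> maps
  the intermediate submodules \<open>Z\<close> to ideals between \<open>W\<close> and
  \<open>Y\<close>. The map is strictly monotone, because every element of the span is
  \<open>x + c e\<close> with \<open>x \<in> X\<close>, so that \<open>Z\<close> is determined by
  the coefficients it admits.\<close>

lemma len_span_smult_le:
  assumes X: "sub X" and e: "e \<in> carrier M" and Y: "ideal Y R" and W: "W \<subseteq> Y"
    and WX: "\<And>w. w \<in> W \<Longrightarrow> w \<odot>\<^bsub>M\<^esub> e \<in> X"
  shows "len sub X (span R M (X \<union> (\<lambda>c. c \<odot>\<^bsub>M\<^esub> e) ` Y)) \<le> len (\<lambda>I. ideal I R) W Y"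
proof (rule len_image_le[where F = "\<lambda>Z. {c \<in> Y. c \<odot>\<^bsub>M\<^esub> e \<in> Z}"])
  interpret Y: ideal Y R by (rule Y)
  have Ye: "sub ((\<lambda>c. c \<odot>\<^bsub>M\<^esub> e) ` Y)" by (rule sub_smult_image[OF Y e])
  {
    fix Z assume Z: "sub Z" "X \<subseteq> Z" "Z \<subseteq> span R M (X \<union> (\<lambda>c. c \<odot>\<^bsub>M\<^esub> e) ` Y)"
    have "ideal {c \<in> Y. c \<odot>\<^bsub>M\<^esub> e \<in> Z} R" by (rule ideal_colon[OF Y Z(1) e])
    then show "ideal {c \<in> Y. c \<odot>\<^bsub>M\<^esub> e \<in> Z} R \<and> W \<subseteq> {c \<in> Y. c \<odot>\<^bsub>M\<^esub> e \<in> Z} \<and> {c \<in> Y. c \<odot>\<^bsub>M\<^esub> e \<in> Z} \<subseteq> Y"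
      using W WX Z(2) by blast
  }
  fix Z Z' assume Z: "sub Z" "X \<subseteq> Z" "sub Z'" "Z' \<subseteq> span R M (X \<union> (\<lambda>c. c \<odot>\<^bsub>M\<^esub> e) ` Y)" "Z \<subset> Z'"
  obtain z where z: "z \<in> Z'" "z \<notin> Z" using Z(5) by blast
  then have "z \<in> span R M (X \<union> (\<lambda>c. c \<odot>\<^bsub>M\<^esub> e) ` Y)" using Z(4) by blast
  then obtain x c where xc: "x \<in> X" "c \<in> Y" "z = x \<oplus>\<^bsub>M\<^esub> c \<odot>\<^bsub>M\<^esub> e"
    unfolding span_Un_iff[OF X Ye] by blast
  have "c \<odot>\<^bsub>M\<^esub> e \<in> Z'"
    by (rule sub_add_cancel[OF Z(3), of x]) (use xc z Z e Y.Icarr in auto)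
  moreover have "c \<odot>\<^bsub>M\<^esub> e \<notin> Z" using z xc Z sub_add by blast
  ultimately show "{c \<in> Y. c \<odot>\<^bsub>M\<^esub> e \<in> Z} \<subset> {c \<in> Y. c \<odot>\<^bsub>M\<^esub> e \<in> Z'}" using Z(5) xc(2) by blast
qed

text \<open>Generators are added one at a time, and each contributes at most the length of the
  interval from \<open>W\<close> to \<open>Y\<close>.\<close>

lemma len_span_family_le:
  assumes "finite E" "E \<subseteq> carrier M" and X: "sub X" and Y: "ideal Y R" and W: "W \<subseteq> Y"
    and WX: "\<And>w e. w \<in> W \<Longrightarrow> e \<in> E \<Longrightarrow> w \<odot>\<^bsub>M\<^esub> e \<in> X"
  shows "len sub X (span R M (X \<union> {c \<odot>\<^bsub>M\<^esub> e | c e. c \<in> Y \<and> e \<in> E})) \<le> enat (card E) * len (\<lambda>I. ideal I R) W Y"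
  using assms(1,2) WX
proof (induction E)
  case empty
  then show ?case using X span_id[OF X] by (simp add: len_refl)
next
  case (insert e E)
  define T where "T = {c \<odot>\<^bsub>M\<^esub> e | c e. c \<in> Y \<and> e \<in> E}"
  have eT: "{c \<odot>\<^bsub>M\<^esub> e' | c e'. c \<in> Y \<and> e' \<in> insert e E} = T \<union> (\<lambda>c. c \<odot>\<^bsub>M\<^esub> e) ` Y"
    unfolding T_def by blast
  have Yc: "Y \<subseteq> carrier R" using ideal.Icarr[OF Y] by blast
  have Ec: "E \<subseteq> carrier M" using insert.prems by blast
  have Tc: "T \<subseteq> carrier M"
    unfolding T_def using Yc Ec smult_closed by (auto dest!: subsetD)
  have Xc: "X \<subseteq> carrier M" using X by (rule sub_subset)
  have ec: "e \<in> carrier M" "(\<lambda>c. c \<odot>\<^bsub>M\<^esub> e) ` Y \<subseteq> carrier M" using insert.prems Yc by auto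
  let ?X' = "span R M (X \<union> T)"
  have X': "sub ?X'" using Xc Tc by (intro sub_span) blast
  have XX': "X \<subseteq> ?X'" using span_superset by blast
  have eq: "span R M (X \<union> (T \<union> (\<lambda>c. c \<odot>\<^bsub>M\<^esub> e) ` Y)) = span R M (?X' \<union> (\<lambda>c. c \<odot>\<^bsub>M\<^esub> e) ` Y)"
    using span_Un_span[of "X \<union> T" "(\<lambda>c. c \<odot>\<^bsub>M\<^esub> e) ` Y"] Xc Tc ec by (simp add: Un_assoc)
  have "sub (span R M (?X' \<union> (\<lambda>c. c \<odot>\<^bsub>M\<^esub> e) ` Y))"
    using X' ec sub_subset by (intro sub_span) blast
  moreover have "?X' \<subseteq> span R M (?X' \<union> (\<lambda>c. c \<odot>\<^bsub>M\<^esub> e) ` Y)" using span_superset by blast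
  ultimately have "len sub X (span R M (?X' \<union> (\<lambda>c. c \<odot>\<^bsub>M\<^esub> e) ` Y))
      = len sub X ?X' + len sub ?X' (span R M (?X' \<union> (\<lambda>c. c \<odot>\<^bsub>M\<^esub> e) ` Y))"
    by (intro len_add X X' XX')
  also have "\<dots> \<le> enat (card E) * len (\<lambda>I. ideal I R) W Y + len (\<lambda>I. ideal I R) W Y"
  proof (rule add_mono)
    show "len sub X ?X' \<le> enat (card E) * len (\<lambda>I. ideal I R) W Y"
      unfolding T_def by (rule insert.IH) (use insert.prems in auto)
    show "len sub ?X' (span R M (?X' \<union> (\<lambda>c. c \<odot>\<^bsub>M\<^esub> e) ` Y)) \<le> len (\<lambda>I. ideal I R) W Y"
      by (rule len_span_smult_le[OF X' ec(1) Y W]) (use insert.prems XX' in blast)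
  qed
  also have "\<dots> = enat (card (insert e E)) * len (\<lambda>I. ideal I R) W Y"
    using insert.hyps by (simp add: eSuc_enat[symmetric] mult_eSuc add.commute)
  finally show ?case unfolding eT eq .
qed

text \<open>Modulo \<open>X\<close> the element \<open>w\<close> is killed by \<open>\<mm>\<close>,
  so it generates a quotient of the field \<open>R / \<mm>\<close>.\<close>

lemma len_simple_step:
  assumes mx: "maximalideal \<mm> R" and X: "sub X" and w: "w \<in> carrier M"
    and mw: "\<And>a. a \<in> \<mm> \<Longrightarrow> a \<odot>\<^bsub>M\<^esub> w \<in> X"
  shows "len sub X (span R M (insert w X)) = (if w \<in> X then 0 else 1)"
proof (cases "w \<in> X")
  case True
  then show ?thesis using X by (simp add: insert_absorb span_id len_refl)
next
  case False
  interpret m: maximalideal \<mm> R by (rule mx)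
  define Y where "Y = span R M (insert w X)"
  have wX: "insert w X \<subseteq> carrier M" using w sub_subset[OF X] by blast
  have sY: "sub Y" unfolding Y_def using wX by (rule sub_span)
  have XY: "X \<subset> Y" unfolding Y_def using span_superset[of "insert w X"] False by blast
  have simple: "Z = Y" if Z: "sub Z" "X \<subset> Z" "Z \<subseteq> Y" for Z
  proof -
    define Rw where "Rw = (\<lambda>c. c \<odot>\<^bsub>M\<^esub> w) ` carrier R"
    have Rw: "sub Rw" unfolding Rw_def by (rule sub_smult_image[OF R.oneideal w])
    have "w \<in> Rw" unfolding Rw_def using smult_one[OF w] R.one_closed by (metis imageI)
    then have "Y \<subseteq> span R M (X \<union> Rw)" unfolding Y_def by (intro span_mono) blast
    moreover obtain z where z: "z \<in> Z" "z \<notin> X" using Z by blast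
    ultimately have "z \<in> span R M (X \<union> Rw)" using Z by blast
    then have "\<exists>x\<in>X. \<exists>y\<in>Rw. z = x \<oplus>\<^bsub>M\<^esub> y" unfolding span_Un_iff[OF X Rw] .
    then obtain x r where xr: "x \<in> X" "r \<in> carrier R" "z = x \<oplus>\<^bsub>M\<^esub> r \<odot>\<^bsub>M\<^esub> w"
      unfolding Rw_def by blast
    have rwZ: "r \<odot>\<^bsub>M\<^esub> w \<in> Z"
      by (rule sub_add_cancel[OF Z(1), of x]) (use xr z Z w in auto)
    \<comment> \<open>A coefficient \<open>r\<close> outside \<open>\<mm>\<close> is invertible
      modulo \<open>\<mm>\<close>: writing \<open>\<one> = a \<oplus> s \<otimes> r\<close> with
      \<open>a \<in> \<mm>\<close> recovers \<open>w\<close> from \<open>a w\<close> in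
      \<open>X\<close> and \<open>r w\<close> in \<open>Z\<close>.\<close>
    have "r \<notin> \<mm>" using mw[of r] xr z sub_add[OF X] by blast
    have idl: "ideal (\<mm> <+>\<^bsub>R\<^esub> PIdl\<^bsub>R\<^esub> r) R"
      by (intro R.add_ideals m.is_ideal R.cgenideal_ideal xr)
    have mem: "r \<in> \<mm> <+>\<^bsub>R\<^esub> PIdl\<^bsub>R\<^esub> r" "\<mm> \<subseteq> \<mm> <+>\<^bsub>R\<^esub> PIdl\<^bsub>R\<^esub> r"
    proof -
      have "\<zero> \<oplus> r \<in> \<mm> <+>\<^bsub>R\<^esub> PIdl\<^bsub>R\<^esub> r" unfolding set_add_def'
        using m.zero_closed R.cgenideal_self[OF xr(2)] by blast
      then show "r \<in> \<mm> <+>\<^bsub>R\<^esub> PIdl\<^bsub>R\<^esub> r" using xr by simp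
      show "\<mm> \<subseteq> \<mm> <+>\<^bsub>R\<^esub> PIdl\<^bsub>R\<^esub> r"
      proof
        fix a assume a: "a \<in> \<mm>"
        have "\<zero> \<in> PIdl\<^bsub>R\<^esub> r"
          using additive_subgroup.zero_closed[OF ideal.axioms(1)[OF R.cgenideal_ideal[OF xr(2)]]] .
        then have "a \<oplus> \<zero> \<in> \<mm> <+>\<^bsub>R\<^esub> PIdl\<^bsub>R\<^esub> r" unfolding set_add_def' using a by blast
        then show "a \<in> \<mm> <+>\<^bsub>R\<^esub> PIdl\<^bsub>R\<^esub> r" using a m.Icarr by simp
      qed
    qed
    have "\<mm> <+>\<^bsub>R\<^esub> PIdl\<^bsub>R\<^esub> r \<subseteq> carrier R" using ideal.Icarr[OF idl] by blast
    from m.I_maximal[OF idl mem(2) this] have "\<mm> <+>\<^bsub>R\<^esub> PIdl\<^bsub>R\<^esub> r = carrier R"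
      using \<open>r \<notin> \<mm>\<close> mem(1) by metis
    then have "\<one> \<in> \<mm> <+>\<^bsub>R\<^esub> PIdl\<^bsub>R\<^esub> r" by simp
    then obtain a s where as: "a \<in> \<mm>" "s \<in> carrier R" "\<one> = a \<oplus> s \<otimes> r"
      unfolding set_add_def' cgenideal_def by blast
    have "w = (a \<oplus> s \<otimes> r) \<odot>\<^bsub>M\<^esub> w" using as(3)[symmetric] w by simp
    also have "\<dots> = a \<odot>\<^bsub>M\<^esub> w \<oplus>\<^bsub>M\<^esub> s \<odot>\<^bsub>M\<^esub> (r \<odot>\<^bsub>M\<^esub> w)"
      using as w xr m.Icarr by (simp add: smult_l_distr smult_assoc1)
    finally have weq: "w = a \<odot>\<^bsub>M\<^esub> w \<oplus>\<^bsub>M\<^esub> s \<odot>\<^bsub>M\<^esub> (r \<odot>\<^bsub>M\<^esub> w)" .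
    have "a \<odot>\<^bsub>M\<^esub> w \<in> Z" using mw as Z by blast
    then have "w \<in> Z" using sub_add[OF Z(1) _ sub_smult[OF Z(1) as(2) rwZ]] weq by metis
    then show "Z = Y" using Z unfolding Y_def by (intro antisym span_least) auto
  qed
  have h1: "has_chain sub 1 X Y"
    using has_chain_snoc[OF has_chain_0[of sub X X]] XY X sY by simp
  have h2: "\<not> has_chain sub (Suc (Suc 0)) X Y"
  proof
    assume "has_chain sub (Suc (Suc 0)) X Y"
    then obtain C where C: "\<And>i. i \<le> Suc (Suc 0) \<Longrightarrow> sub (C i) \<and> X \<subseteq> C i \<and> C i \<subseteq> Y" "\<And>i. i < Suc (Suc 0) \<Longrightarrow> C i \<subset> C (Suc i)"
      unfolding has_chain_def by blast
    have "X \<subset> C 1" using C(1)[of 0] C(2)[of 0] by auto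
    then have "C 1 = Y" using simple C(1)[of 1] by simp
    then show False using C(1)[of 2] C(2)[of 1] by (auto simp: numeral_2_eq_2)
  qed
  have XY': "X \<subseteq> Y" using XY by blast
  have "enat 1 \<le> len sub X Y" using h1 len_ge_iff[of sub, OF X XY'] by simp
  moreover have "\<not> enat 2 \<le> len sub X Y" using h2 len_ge_iff[of sub, OF X XY'] by (simp add: numeral_2_eq_2)
  ultimately have "len sub X Y = 1" by (cases "len sub X Y") (auto simp: one_enat_def)
  then show ?thesis using False unfolding Y_def by simp
qed

text \<open>Adjoining the \<open>v i\<close> in increasing order, each step has length 1 or 0
  according to whether \<open>v i\<close> is new modulo its predecessors. This is the dimension
  count of Groebner basis theory over the field \<open>R / \<mm>\<close>. The induction removes the
  largest index, which leaves the predecessors of all others unchanged.\<close>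

theorem len_span_finite_count:
  assumes mx: "maximalideal \<mm> R" and X: "sub X"
    and fin: "finite A"
    and irrefl: "\<And>i. \<not> lt i i" and trans: "\<And>i j k. lt i j \<Longrightarrow> lt j k \<Longrightarrow> lt i k"
    and total: "\<And>i j. i \<in> A \<Longrightarrow> j \<in> A \<Longrightarrow> lt i j \<or> i = j \<or> lt j i"
    and v: "\<And>i. i \<in> A \<Longrightarrow> v i \<in> carrier M"
    and mv: "\<And>a i. a \<in> \<mm> \<Longrightarrow> i \<in> A \<Longrightarrow> a \<odot>\<^bsub>M\<^esub> v i \<in> X"
  shows "len sub X (span R M (X \<union> v ` A)) =
    enat (card {i \<in> A. v i \<notin> span R M (X \<union> v ` {j \<in> A. lt j i})})"
  using fin total v mv
proof (induction "card A" arbitrary: A)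
  case 0
  then have "A = {}" by simp
  then show ?case using X by (simp add: span_id len_refl zero_enat_def)
next
  case (Suc n)
  have "\<exists>m\<in>A. \<forall>x\<in>A. x \<noteq> m \<longrightarrow> \<not> lt m x"
  proof (rule Finite_Set.bex_max_element)
    show "A \<noteq> {}" using Suc.hyps by auto
    show "transp_on A lt" by (rule transp_onI) (rule trans)
    show "asymp_on A lt"
    proof (rule asymp_onI, rule notI)
      fix x y assume "lt x y" "lt y x"
      then have "lt x x" by (rule trans)
      then show False using irrefl by simp
    qed
  qed (rule Suc.prems)
  then obtain m where m0: "m \<in> A" "\<forall>x\<in>A. x \<noteq> m \<longrightarrow> \<not> lt m x" by blast
  have m: "m \<in> A" "\<And>x. x \<in> A \<Longrightarrow> \<not> lt m x"
  proof -
    fix x assume "x \<in> A"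
    then show "\<not> lt m x" using m0(2) irrefl[of m] by (cases "x = m") auto
  qed (rule m0(1))
  define B where "B = A - {m}"
  have A: "A = insert m B" "m \<notin> B" "finite B" using m Suc.prems(1) unfolding B_def by auto
  have below: "{j \<in> A. lt j m} = B" using m Suc.prems(2) irrefl unfolding B_def by blast
  have below': "{j \<in> A. lt j i} = {j \<in> B. lt j i}" if "i \<in> B" for i
    using m(2)[of i] that unfolding B_def by blast
  let ?U = "span R M (X \<union> v ` B)"
  have c: "X \<subseteq> carrier M" "v ` B \<subseteq> carrier M" "v m \<in> carrier M"
    using sub_subset[OF X] Suc.prems(3) A(1) by auto
  have U: "sub ?U" using c by (intro sub_span) blast
  have IH: "len sub X ?U = enat (card {i \<in> B. v i \<notin> span R M (X \<union> v ` {j \<in> B. lt j i})})"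
  proof (rule Suc.hyps(1))
    show "n = card B" using Suc.hyps(2) A by simp
  qed (use Suc.prems A in auto)
  have eq: "span R M (X \<union> v ` A) = span R M (insert (v m) ?U)"
    using span_Un_span[of "X \<union> v ` B" "{v m}"] c unfolding A(1) by simp
  have XU: "X \<subseteq> ?U" using span_superset by blast
  have "len sub X (span R M (insert (v m) ?U)) = len sub X ?U + len sub ?U (span R M (insert (v m) ?U))"
  proof (rule len_add[OF X U _ XU])
    show "sub (span R M (insert (v m) ?U))" using sub_subset[OF U] c by (intro sub_span) blast
    show "?U \<subseteq> span R M (insert (v m) ?U)" using span_superset by blast
  qed
  also have "len sub ?U (span R M (insert (v m) ?U)) = (if v m \<in> ?U then 0 else 1)"
    by (rule len_simple_step[OF mx U c(3)]) (use Suc.prems(4) m XU in blast)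
  also have "len sub X ?U + (if v m \<in> ?U then 0 else 1) =
      enat (card {i \<in> A. v i \<notin> span R M (X \<union> v ` {j \<in> A. lt j i})})"
  proof -
    have "{i \<in> A. v i \<notin> span R M (X \<union> v ` {j \<in> A. lt j i})} =
       (if v m \<in> ?U then {} else {m}) \<union> {i \<in> B. v i \<notin> span R M (X \<union> v ` {j \<in> B. lt j i})}"
      using A(1) below below' by auto
    then show ?thesis unfolding IH using A by (auto simp: one_enat_def card_insert_if)
  qed
  finally show ?case unfolding eq .
qed

end

subsection \<open>The ring as a module over itself\<close>

text \<open>Turns ideals into submodules, by \<open>submodule_reg_module_iff\<close>, so that
  lengths, spans and the bigraded count apply to ideals without being repeated.\<close>

definition reg_module :: "('a, 'r) ring_scheme \<Rightarrow> ('a, 'a) module" where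
  "reg_module R = \<lparr>carrier = carrier R, monoid.mult = monoid.mult R, one = one R, zero = zero R,
     add = add R, module.smult = monoid.mult R\<rparr>"

lemma reg_module_simps [simp]:
  "carrier (reg_module R) = carrier R" "\<zero>\<^bsub>reg_module R\<^esub> = \<zero>\<^bsub>R\<^esub>"
  "x \<oplus>\<^bsub>reg_module R\<^esub> y = x \<oplus>\<^bsub>R\<^esub> y" "x \<odot>\<^bsub>reg_module R\<^esub> y = x \<otimes>\<^bsub>R\<^esub> y"
  by (simp_all add: reg_module_def)

lemma a_inv_reg_module [simp]: "\<ominus>\<^bsub>reg_module R\<^esub> x = \<ominus>\<^bsub>R\<^esub> x"
  by (simp add: a_inv_def m_inv_def)

lemma (in cring) reg_module_is_module: "module R (reg_module R)"
proof (rule moduleI)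
  show "abelian_group (reg_module R)"
  proof (rule abelian_groupI)
    fix x assume "x \<in> carrier (reg_module R)"
    then show "\<exists>y\<in>carrier (reg_module R). y \<oplus>\<^bsub>reg_module R\<^esub> x = \<zero>\<^bsub>reg_module R\<^esub>"
      by (intro bexI[of _ "\<ominus> x"]) (simp_all add: l_neg)
  qed (simp_all add: a_ac)
qed (auto simp: is_cring l_distr r_distr m_assoc)

lemma (in cring) submodule_reg_module_iff: "submodule I R (reg_module R) \<longleftrightarrow> ideal I R"
proof
  interpret reg: module R "reg_module R" by (rule reg_module_is_module)
  assume I: "submodule I R (reg_module R)"
  have Ic: "I \<subseteq> carrier R" using reg.sub_subset[OF I] by simp
  have sm: "x \<otimes> a \<in> I" if "a \<in> I" "x \<in> carrier R" for a x
    using reg.sub_smult[OF I that(2,1)] by simp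
  show "ideal I R"
  proof (rule idealI)
    show "subgroup I (add_monoid R)"
    proof (rule add.subgroupI)
      show "I \<noteq> {}" using reg.sub_zero[OF I] by blast
      show "\<ominus> a \<in> I" if "a \<in> I" for a using reg.sub_neg[OF I that] by simp
      show "a \<oplus> b \<in> I" if "a \<in> I" "b \<in> I" for a b using reg.sub_add[OF I that] by simp
    qed (rule Ic)
    show "a \<otimes> x \<in> I" if "a \<in> I" "x \<in> carrier R" for a x
      using sm[OF that] that Ic by (metis m_comm subsetD)
  qed (use sm ring_axioms in auto)
next
  assume I: "ideal I R"
  then interpret I: ideal I R .
  show "submodule I R (reg_module R)"
    by (rule module.submoduleI[OF reg_module_is_module])
       (use I.Icarr I.I_l_closed in auto)
qed

section \<open>Products of ideals and submodules\<close>

context module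
begin

lemma sub_preimage:
  assumes N: "sub N" and a: "a \<in> carrier R"
  shows "sub {x \<in> carrier M. a \<odot>\<^bsub>M\<^esub> x \<in> N}" (is "sub ?P")
proof (rule submoduleI)
  show "\<zero>\<^bsub>M\<^esub> \<in> ?P" using a sub_zero[OF N] by simp
  show "\<ominus>\<^bsub>M\<^esub> x \<in> ?P" if "x \<in> ?P" for x
    using that a sub_neg[OF N] by (simp add: smult_r_minus)
  show "x \<oplus>\<^bsub>M\<^esub> y \<in> ?P" if "x \<in> ?P" "y \<in> ?P" for x y
    using that a sub_add[OF N] by (simp add: smult_r_distr)
  show "b \<odot>\<^bsub>M\<^esub> x \<in> ?P" if "b \<in> carrier R" "x \<in> ?P" for b x
  proof -
    have "a \<odot>\<^bsub>M\<^esub> (b \<odot>\<^bsub>M\<^esub> x) = b \<odot>\<^bsub>M\<^esub> (a \<odot>\<^bsub>M\<^esub> x)"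
      using that a by (simp add: smult_assoc1[symmetric] R.m_comm)
    then show ?thesis using that sub_smult[OF N] by simp
  qed
qed blast

lemma smult_span_in:
  assumes N: "sub N" and a: "a \<in> carrier R" and X: "X \<subseteq> carrier M"
    and aX: "\<And>x. x \<in> X \<Longrightarrow> a \<odot>\<^bsub>M\<^esub> x \<in> N" and y: "y \<in> span R M X"
  shows "a \<odot>\<^bsub>M\<^esub> y \<in> N"
proof -
  have "span R M X \<subseteq> {x \<in> carrier M. a \<odot>\<^bsub>M\<^esub> x \<in> N}"
    by (rule span_least[OF sub_preimage[OF N a]]) (use X aX in blast)
  then show ?thesis using y by blast
qed

lemma genideal_smult_in:
  assumes N: "sub N" and y: "y \<in> carrier M" and Z: "Z \<subseteq> carrier R"
    and Zy: "\<And>z. z \<in> Z \<Longrightarrow> z \<odot>\<^bsub>M\<^esub> y \<in> N" and a: "a \<in> genideal R Z"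
  shows "a \<odot>\<^bsub>M\<^esub> y \<in> N"
proof -
  have "ideal {c \<in> carrier R. c \<odot>\<^bsub>M\<^esub> y \<in> N} R" by (rule ideal_colon[OF R.oneideal N y])
  then have "genideal R Z \<subseteq> {c \<in> carrier R. c \<odot>\<^bsub>M\<^esub> y \<in> N}"
    by (rule R.genideal_minimal) (use Z Zy in blast)
  then show ?thesis using a by blast
qed

lemma ideal_smult_subset:
  assumes "sub L" "\<And>a x. a \<in> I \<Longrightarrow> x \<in> N \<Longrightarrow> a \<odot>\<^bsub>M\<^esub> x \<in> L"
  shows "ideal_smult M I N \<subseteq> L"
proof
  fix x assume "x \<in> ideal_smult M I N"
  then show "x \<in> L" by induction (use assms sub_add[OF assms(1)] in auto)
qed

lemma sub_ideal_smult:
  assumes I: "ideal I R" and N: "sub N"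
  shows "sub (ideal_smult M I N)"
proof (rule submoduleI)
  have c: "a \<odot>\<^bsub>M\<^esub> x \<in> carrier M" if "a \<in> I" "x \<in> N" for a x
    using ideal.Icarr[OF I that(1)] sub_carr[OF N that(2)] by simp
  show sc: "ideal_smult M I N \<subseteq> carrier M"
    by (rule ideal_smult_subset[OF carrier_is_submodule c])
  have "\<zero> \<in> I" using I by (rule additive_subgroup.zero_closed[OF ideal.axioms(1)])
  from ideal_smult.smult[OF this sub_zero[OF N], where M = M]
  show "\<zero>\<^bsub>M\<^esub> \<in> ideal_smult M I N" by simp
  show sm: "b \<odot>\<^bsub>M\<^esub> x \<in> ideal_smult M I N" if b: "b \<in> carrier R" and x: "x \<in> ideal_smult M I N" for b x
    using x
  proof induction
    case (smult a x)
    have "b \<otimes> a \<in> I" using smult b ideal.I_l_closed[OF I] by blast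
    from ideal_smult.smult[OF this smult(2), where M = M] show ?case
      using b ideal.Icarr[OF I smult(1)] sub_carr[OF N smult(2)] by (simp add: smult_assoc1)
  next
    case (add x y)
    then show ?case using b sc by (simp add: smult_r_distr subset_iff ideal_smult.add)
  qed
  show "\<ominus>\<^bsub>M\<^esub> x \<in> ideal_smult M I N" if "x \<in> ideal_smult M I N" for x
    using sm[of "\<ominus> \<one>" x] that sc smult_l_minus[of \<one> x] by (simp add: subset_iff)
  show "x \<oplus>\<^bsub>M\<^esub> y \<in> ideal_smult M I N" if "x \<in> ideal_smult M I N" "y \<in> ideal_smult M I N" for x y
    using that by (rule ideal_smult.add)
qed

lemma ideal_smult_le: "ideal I R \<Longrightarrow> sub N \<Longrightarrow> ideal_smult M I N \<subseteq> N"
  by (rule ideal_smult_subset) (auto intro: sub_smult ideal.Icarr)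

lemma ideal_smult_mono:
  assumes "I \<subseteq> I'" "N \<subseteq> N'"
  shows "ideal_smult M I N \<subseteq> ideal_smult M I' N'"
proof
  fix x assume "x \<in> ideal_smult M I N"
  then show "x \<in> ideal_smult M I' N'"
    by induction (use assms in \<open>auto intro: ideal_smult.intros\<close>)
qed

lemma ideal_smult_carrier:
  assumes N: "sub N"
  shows "ideal_smult M (carrier R) N = N"
proof
  show "ideal_smult M (carrier R) N \<subseteq> N" by (rule ideal_smult_le[OF R.oneideal N])
  show "N \<subseteq> ideal_smult M (carrier R) N"
  proof
    fix x assume x: "x \<in> N"
    from ideal_smult.smult[OF R.one_closed x, where M = M]
    show "x \<in> ideal_smult M (carrier R) N" using sub_carr[OF N x] by simp
  qed
qed

lemma ideal_smult_assoc:
  assumes I: "ideal I R" and J: "ideal J R" and N: "sub N"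
  shows "ideal_smult M (ideal_prod R I J) N = ideal_smult M I (ideal_smult M J N)"
proof
  have s: "sub (ideal_smult M I (ideal_smult M J N))"
    by (intro sub_ideal_smult I J N)
  show "ideal_smult M (ideal_prod R I J) N \<subseteq> ideal_smult M I (ideal_smult M J N)"
  proof (rule ideal_smult_subset[OF s])
    fix a x assume a: "a \<in> ideal_prod R I J" and x: "x \<in> N"
    from a have "a \<in> carrier R \<and> a \<odot>\<^bsub>M\<^esub> x \<in> ideal_smult M I (ideal_smult M J N)"
    proof induction
      case (prod i j)
      have "i \<odot>\<^bsub>M\<^esub> (j \<odot>\<^bsub>M\<^esub> x) \<in> ideal_smult M I (ideal_smult M J N)"
        by (intro ideal_smult.smult prod x)
      then show ?case
        using ideal.Icarr[OF I prod(1)] ideal.Icarr[OF J prod(2)] sub_carr[OF N x]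
        by (simp add: smult_assoc1)
    next
      case (sum s1 s2)
      then show ?case using sub_carr[OF N x] sub_add[OF s] by (simp add: smult_l_distr)
    qed
    then show "a \<odot>\<^bsub>M\<^esub> x \<in> ideal_smult M I (ideal_smult M J N)" by simp
  qed
  have s': "sub (ideal_smult M (ideal_prod R I J) N)"
    by (intro sub_ideal_smult R.ideal_prod_is_ideal I J N)
  show "ideal_smult M I (ideal_smult M J N) \<subseteq> ideal_smult M (ideal_prod R I J) N"
  proof (rule ideal_smult_subset[OF s'])
    fix a x assume a: "a \<in> I" and x: "x \<in> ideal_smult M J N"
    have ac: "a \<in> carrier R" by (rule ideal.Icarr[OF I a])
    have "ideal_smult M J N \<subseteq> {x \<in> carrier M. a \<odot>\<^bsub>M\<^esub> x \<in> ideal_smult M (ideal_prod R I J) N}"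
    proof (rule ideal_smult_subset[OF sub_preimage[OF s' ac]])
      fix b y assume b: "b \<in> J" and y: "y \<in> N"
      have "(a \<otimes> b) \<odot>\<^bsub>M\<^esub> y \<in> ideal_smult M (ideal_prod R I J) N"
        by (intro ideal_smult.smult ideal_prod.prod a b y)
      then show "b \<odot>\<^bsub>M\<^esub> y \<in> {x \<in> carrier M. a \<odot>\<^bsub>M\<^esub> x \<in> ideal_smult M (ideal_prod R I J) N}"
        using ac ideal.Icarr[OF J b] sub_carr[OF N y] by (simp add: smult_assoc1)
    qed
    then show "a \<odot>\<^bsub>M\<^esub> x \<in> ideal_smult M (ideal_prod R I J) N" using x by blast
  qed
qed

end

lemma ideal_pow_0 [simp]: "ideal_pow R I 0 = carrier R"
  by (simp add: ideal_pow_def nat_pow_def ideals_set_def)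

lemma ideal_pow_Suc: "ideal_pow R I (Suc k) = ideal_prod R (ideal_pow R I k) I"
  by (simp add: ideal_pow_def nat_pow_def ideals_set_def)

context cring
begin

lemma ideal_pow_ideal: "ideal I R \<Longrightarrow> ideal (ideal_pow R I k) R"
  by (induction k) (simp_all add: oneideal ideal_pow_Suc ideal_prod_is_ideal)

lemma ideal_pow_Suc': "ideal I R \<Longrightarrow> ideal_pow R I (Suc k) = ideal_prod R I (ideal_pow R I k)"
  unfolding ideal_pow_Suc by (rule ideal_prod_commute[OF ideal_pow_ideal])

lemma ideal_pow_1: "ideal I R \<Longrightarrow> ideal_pow R I (Suc 0) = I"
  using ideal_pow_Suc'[of I 0] ideal_prod_one by simp

lemma ideal_pow_mult_in:
  assumes I: "ideal I R" and a: "a \<in> ideal_pow R I i" and b: "b \<in> ideal_pow R I j"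
  shows "a \<otimes> b \<in> ideal_pow R I (i + j)"
  using b
proof (induction j arbitrary: b)
  case 0
  then show ?case using a ideal.I_r_closed[OF ideal_pow_ideal[OF I]] by simp
next
  case (Suc j)
  have ac: "a \<in> carrier R" using ideal.Icarr[OF ideal_pow_ideal[OF I] a] .
  have "ideal_prod R (ideal_pow R I j) I \<subseteq> carrier R"
    by (rule ideal_prod_in_carrier[OF ideal_pow_ideal[OF I] I])
  moreover from Suc.prems have "b \<in> ideal_prod R (ideal_pow R I j) I" by (simp add: ideal_pow_Suc)
  ultimately show ?case
  proof (induction rule: ideal_prod.induct[consumes 1, OF \<open>b \<in> ideal_prod R (ideal_pow R I j) I\<close>])
    case (1 c d)
    have "(a \<otimes> c) \<otimes> d \<in> ideal_prod R (ideal_pow R I (i + j)) I"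
      by (intro ideal_prod.prod Suc.IH 1)
    then show ?case
      using ac ideal.Icarr[OF ideal_pow_ideal[OF I] 1(1)] ideal.Icarr[OF I 1(2)]
      by (simp add: ideal_pow_Suc m_assoc)
  next
    case (2 s t)
    have "a \<otimes> s \<in> ideal_pow R I (i + Suc j)" "a \<otimes> t \<in> ideal_pow R I (i + Suc j)"
      using 2 by auto
    moreover have "s \<in> carrier R" "t \<in> carrier R" using 2 by auto
    ultimately show ?case using ac
      additive_subgroup.a_closed[OF ideal.axioms(1)[OF ideal_pow_ideal[OF I]]] by (simp add: r_distr)
  qed
qed

lemma ideal_pow_antimono:
  assumes I: "ideal I R" and "i \<le> j"
  shows "ideal_pow R I j \<subseteq> ideal_pow R I i"
  using assms(2)
proof (induction j rule: dec_induct)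
  case (step n)
  have "ideal_pow R I (Suc n) \<subseteq> ideal_pow R I n"
    unfolding ideal_pow_Suc using ideal_prod_inter[OF ideal_pow_ideal[OF I] I] by blast
  then show ?case using step by blast
qed simp

end

section \<open>The bigraded Hilbert function\<close>

lemma exps_decompose:
  assumes "\<delta> \<in> exps V" "\<delta> i > 0" "i \<in> V"
  obtains \<epsilon> where "\<epsilon> \<in> exps V" "\<delta> = (\<lambda>l. \<epsilon> l + of_bool (l = i))"
proof (rule that[of "\<lambda>l. \<delta> l - of_bool (l = i)"])
  show "(\<lambda>l. \<delta> l - of_bool (l = i)) \<in> exps V" using assms(1) by (simp add: exps_def)
  show "\<delta> = (\<lambda>l. \<delta> l - of_bool (l = i) + of_bool (l = i))" using assms(2) by (auto simp: of_bool_def)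
qed

lemma unit_in_exps: "i \<in> V \<Longrightarrow> (\<lambda>l. of_bool (l = i)) \<in> exps V"
  by (auto simp: exps_def)

lemma tdeg_unit: "finite V \<Longrightarrow> tdeg V (\<lambda>l. of_bool (l = i)) = of_bool (i \<in> V)"
  by (auto simp: tdeg_def of_bool_def)

lemma tdeg_pos:
  assumes "tdeg V \<delta> = Suc n"
  obtains i where "i \<in> V" "\<delta> i > 0"
proof -
  have "\<exists>i\<in>V. \<delta> i \<noteq> 0"
  proof (rule ccontr)
    assume "\<not> (\<exists>i\<in>V. \<delta> i \<noteq> 0)"
    then have "tdeg V \<delta> = 0" unfolding tdeg_def by (intro sum.neutral) auto
    with assms show False by simp
  qed
  then show ?thesis using that by auto
qed

text \<open>Models the bigraded module with components \<open>F j k / F (Suc j) k\<close> over a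
  polynomial ring: the variables in \<open>V1\<close> act through generators of \<open>\<mm>\<close>
  and raise \<open>j\<close>, those in \<open>V2\<close> raise \<open>k\<close>. The submodules
  \<open>C k\<close> are divided out, and \<open>zC\<close> makes the action of \<open>V2\<close>
  well defined on the quotients.\<close>

locale bigraded = module R M
  for R :: "('a, 'r) ring_scheme" (structure) and M :: "('a, 'b, 's) module_scheme" (structure) +
  fixes \<mm> :: "'a set" and z :: "nat \<Rightarrow> 'a" and V1 V2 :: "nat set"
    and G :: "nat set" and e :: "nat \<Rightarrow> 'b" and C :: "nat \<Rightarrow> 'b set"
  assumes mx: "maximalideal \<mm> R"
    and fin: "finite V1" "finite V2" "finite G" and disj: "V1 \<inter> V2 = {}"
    and z: "i \<in> V1 \<union> V2 \<Longrightarrow> z i \<in> carrier R"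
    and gen: "\<mm> = genideal R (z ` V1)"
    and e: "\<gamma> \<in> G \<Longrightarrow> e \<gamma> \<in> carrier M"
    and C: "submodule (C k) R M"
    and zC: "i \<in> V2 \<Longrightarrow> x \<in> C k \<Longrightarrow> z i \<odot>\<^bsub>M\<^esub> x \<in> C (Suc k)"
begin

abbreviation V where "V \<equiv> V1 \<union> V2"

definition zpow :: "(nat \<Rightarrow> nat) \<Rightarrow> 'a" where
  "zpow \<delta> = (\<Otimes>\<^bsub>R\<^esub>i\<in>V. z i [^]\<^bsub>R\<^esub> \<delta> i)"

definition val :: "nat \<times> (nat \<Rightarrow> nat) \<Rightarrow> 'b" where
  "val p = zpow (snd p) \<odot>\<^bsub>M\<^esub> e (fst p)"

definition idx :: "nat \<Rightarrow> nat \<Rightarrow> (nat \<times> (nat \<Rightarrow> nat)) set" where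
  "idx j k = {(\<gamma>, \<delta>). \<gamma> \<in> G \<and> \<delta> \<in> exps V \<and> tdeg V1 \<delta> = j \<and> tdeg V2 \<delta> = k}"

text \<open>By \<open>F_eq\<close> this is \<open>C k + \<mm>^j (F 0 k)\<close>. The counting
  argument works with the description by monomials.\<close>

definition F :: "nat \<Rightarrow> nat \<Rightarrow> 'b set" where
  "F j k = span R M (C k \<union> val ` idx j k)"

definition below :: "nat \<times> (nat \<Rightarrow> nat) \<Rightarrow> 'b set" where
  "below p = val ` {q \<in> idx (tdeg V1 (snd p)) (tdeg V2 (snd p)). mless q p}"

text \<open>For each generator \<open>\<gamma>\<close>, the exponents of monomials that lead a
  relation modulo \<open>F (Suc j) k\<close> in their bidegree \<open>(j, k)\<close>. The exponents
  outside are the standard monomials.\<close>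

definition nonstd :: "nat \<Rightarrow> (nat \<Rightarrow> nat) set" where
  "nonstd \<gamma> = {\<delta>. val (\<gamma>, \<delta>) \<in>
      span R M (F (Suc (tdeg V1 \<delta>)) (tdeg V2 \<delta>) \<union> below (\<gamma>, \<delta>))}"

lemma finV: "finite V"
  using fin by simp

lemma zpow_closed [simp]: "zpow \<delta> \<in> carrier R"
  unfolding zpow_def by (rule R.finprod_closed) (use z in auto)

lemma zpow_add: "zpow (\<lambda>i. \<delta> i + \<epsilon> i) = zpow \<delta> \<otimes>\<^bsub>R\<^esub> zpow \<epsilon>"
proof -
  have "zpow (\<lambda>i. \<delta> i + \<epsilon> i) = (\<Otimes>\<^bsub>R\<^esub>i\<in>V. z i [^]\<^bsub>R\<^esub> \<delta> i \<otimes>\<^bsub>R\<^esub> z i [^]\<^bsub>R\<^esub> \<epsilon> i)"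
    unfolding zpow_def by (rule R.finprod_cong') (use z in \<open>auto simp: R.nat_pow_mult\<close>)
  also have "\<dots> = zpow \<delta> \<otimes>\<^bsub>R\<^esub> zpow \<epsilon>"
    unfolding zpow_def by (rule R.finprod_multf) (use z in auto)
  finally show ?thesis .
qed

lemma zpow_zero: "zpow (\<lambda>_. 0) = \<one>\<^bsub>R\<^esub>"
  unfolding zpow_def by simp

lemma zpow_unit:
  assumes "i \<in> V"
  shows "zpow (\<lambda>l. of_bool (l = i)) = z i"
proof -
  have "zpow (\<lambda>l. of_bool (l = i)) = (\<Otimes>\<^bsub>R\<^esub>l\<in>V. if i = l then z l else \<one>\<^bsub>R\<^esub>)"
    unfolding zpow_def by (rule R.finprod_cong') (use z in \<open>auto simp: of_bool_def\<close>)
  also have "\<dots> = z i"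
    by (rule R.finprod_singleton[OF assms finV]) (use z in auto)
  finally show ?thesis .
qed

lemma val_closed: "p \<in> idx j k \<Longrightarrow> val p \<in> carrier M"
  unfolding val_def idx_def using e by auto

lemma val_idx_carrier: "val ` idx j k \<subseteq> carrier M"
  using val_closed by blast

lemma below_carrier: "below p \<subseteq> carrier M"
  unfolding below_def using val_closed by blast

lemma C_carrier: "C k \<subseteq> carrier M"
  by (rule sub_subset[OF C])

lemma sub_F: "sub (F j k)"
  unfolding F_def using C_carrier val_idx_carrier by (intro sub_span) blast

lemma val_add:
  assumes "\<gamma> \<in> G"
  shows "val (\<gamma>, \<lambda>i. \<delta> i + \<epsilon> i) = zpow \<epsilon> \<odot>\<^bsub>M\<^esub> val (\<gamma>, \<delta>)"
  unfolding val_def using e[OF assms]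
  by (simp add: zpow_add smult_assoc1[symmetric] R.m_comm)

lemma idx_add:
  assumes "(\<gamma>, \<delta>) \<in> idx j k" "\<epsilon> \<in> exps V"
  shows "(\<gamma>, \<lambda>i. \<delta> i + \<epsilon> i) \<in> idx (j + tdeg V1 \<epsilon>) (k + tdeg V2 \<epsilon>)"
  using assms unfolding idx_def by (auto simp: tdeg_add intro: exps_add)

lemma idx_unit1: "(\<gamma>, \<delta>) \<in> idx j k \<Longrightarrow> i \<in> V1 \<Longrightarrow> (\<gamma>, \<lambda>l. \<delta> l + of_bool (l = i)) \<in> idx (Suc j) k"
  using idx_add[OF _ unit_in_exps[of i V], of \<gamma> \<delta> j k] fin disjoint_iff[of V1 V2] disj
  by (auto simp: tdeg_unit)

lemma idx_unit2: "(\<gamma>, \<delta>) \<in> idx j k \<Longrightarrow> i \<in> V2 \<Longrightarrow> (\<gamma>, \<lambda>l. \<delta> l + of_bool (l = i)) \<in> idx j (Suc k)"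
  using idx_add[OF _ unit_in_exps[of i V], of \<gamma> \<delta> j k] fin disjoint_iff[of V2 V1] disj
  by (auto simp: tdeg_unit Int_commute)

lemma val_unit:
  assumes "\<gamma> \<in> G" "i \<in> V"
  shows "val (\<gamma>, \<lambda>l. \<delta> l + of_bool (l = i)) = z i \<odot>\<^bsub>M\<^esub> val (\<gamma>, \<delta>)"
  using val_add[OF assms(1), of \<delta> "\<lambda>l. of_bool (l = i)"] zpow_unit[OF assms(2)] by simp

lemma idx_Suc1_cases:
  assumes "p \<in> idx (Suc j) k"
  obtains q i where "q \<in> idx j k" "i \<in> V1" "val p = z i \<odot>\<^bsub>M\<^esub> val q"
proof -
  obtain \<gamma> \<delta> where p: "p = (\<gamma>, \<delta>)" "\<gamma> \<in> G" "\<delta> \<in> exps V" "tdeg V1 \<delta> = Suc j" "tdeg V2 \<delta> = k"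
    using assms unfolding idx_def by blast
  obtain i where i: "i \<in> V1" "\<delta> i > 0" using tdeg_pos[OF p(4)] .
  obtain \<epsilon> where \<epsilon>: "\<epsilon> \<in> exps V" "\<delta> = (\<lambda>l. \<epsilon> l + of_bool (l = i))"
    using exps_decompose[OF p(3) i(2)] i(1) by blast
  have "tdeg V1 \<delta> = Suc (tdeg V1 \<epsilon>)" "tdeg V2 \<delta> = tdeg V2 \<epsilon>"
    unfolding \<epsilon>(2) tdeg_add using i fin disj by (auto simp: tdeg_unit)
  then have "(\<gamma>, \<epsilon>) \<in> idx j k" using p \<epsilon> unfolding idx_def by simp
  moreover have "val p = z i \<odot>\<^bsub>M\<^esub> val (\<gamma>, \<epsilon>)"
    unfolding p(1) \<epsilon>(2) by (rule val_unit) (use p i in auto)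
  ultimately show ?thesis using that i(1) by blast
qed

lemma idx_Suc2_cases:
  assumes "p \<in> idx j (Suc k)"
  obtains q i where "q \<in> idx j k" "i \<in> V2" "val p = z i \<odot>\<^bsub>M\<^esub> val q"
proof -
  obtain \<gamma> \<delta> where p: "p = (\<gamma>, \<delta>)" "\<gamma> \<in> G" "\<delta> \<in> exps V" "tdeg V1 \<delta> = j" "tdeg V2 \<delta> = Suc k"
    using assms unfolding idx_def by blast
  obtain i where i: "i \<in> V2" "\<delta> i > 0" using tdeg_pos[OF p(5)] .
  obtain \<epsilon> where \<epsilon>: "\<epsilon> \<in> exps V" "\<delta> = (\<lambda>l. \<epsilon> l + of_bool (l = i))"
    using exps_decompose[OF p(3) i(2)] i(1) by blast
  have "tdeg V1 \<delta> = tdeg V1 \<epsilon>" "tdeg V2 \<delta> = Suc (tdeg V2 \<epsilon>)"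
    unfolding \<epsilon>(2) tdeg_add using i fin disj by (auto simp: tdeg_unit)
  then have "(\<gamma>, \<epsilon>) \<in> idx j k" using p \<epsilon> unfolding idx_def by simp
  moreover have "val p = z i \<odot>\<^bsub>M\<^esub> val (\<gamma>, \<epsilon>)"
    unfolding p(1) \<epsilon>(2) by (rule val_unit) (use p i in auto)
  ultimately show ?thesis using that i(1) by blast
qed

lemma z_F1:
  assumes "i \<in> V1" "x \<in> F j k"
  shows "z i \<odot>\<^bsub>M\<^esub> x \<in> F (Suc j) k"
proof (rule smult_span_in[OF sub_F _ _ _ assms(2)[unfolded F_def]])
  show "z i \<in> carrier R" using z assms by simp
  show "C k \<union> val ` idx j k \<subseteq> carrier M" using C_carrier val_idx_carrier by blast
  fix x assume "x \<in> C k \<union> val ` idx j k"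
  then show "z i \<odot>\<^bsub>M\<^esub> x \<in> F (Suc j) k"
  proof
    assume "x \<in> C k"
    then have "z i \<odot>\<^bsub>M\<^esub> x \<in> C k" using sub_smult[OF C] z assms by simp
    then show ?thesis unfolding F_def by (intro span_base) simp
  next
    assume "x \<in> val ` idx j k"
    then obtain \<gamma> \<delta> where gd: "x = val (\<gamma>, \<delta>)" "(\<gamma>, \<delta>) \<in> idx j k" by auto
    then have "z i \<odot>\<^bsub>M\<^esub> x = val (\<gamma>, \<lambda>l. \<delta> l + of_bool (l = i))"
      using val_unit[of \<gamma> i \<delta>] assms by (simp add: idx_def)
    then show ?thesis unfolding F_def using idx_unit1[OF gd(2) assms(1)] by (intro span_base) auto
  qed
qed

lemma z_F2:
  assumes "i \<in> V2" "x \<in> F j k"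
  shows "z i \<odot>\<^bsub>M\<^esub> x \<in> F j (Suc k)"
proof (rule smult_span_in[OF sub_F _ _ _ assms(2)[unfolded F_def]])
  show "z i \<in> carrier R" using z assms by simp
  show "C k \<union> val ` idx j k \<subseteq> carrier M" using C_carrier val_idx_carrier by blast
  fix x assume "x \<in> C k \<union> val ` idx j k"
  then show "z i \<odot>\<^bsub>M\<^esub> x \<in> F j (Suc k)"
  proof
    assume "x \<in> C k"
    then have "z i \<odot>\<^bsub>M\<^esub> x \<in> C (Suc k)" using zC assms by simp
    then show ?thesis unfolding F_def by (intro span_base) simp
  next
    assume "x \<in> val ` idx j k"
    then obtain \<gamma> \<delta> where gd: "x = val (\<gamma>, \<delta>)" "(\<gamma>, \<delta>) \<in> idx j k" by auto
    then have "z i \<odot>\<^bsub>M\<^esub> x = val (\<gamma>, \<lambda>l. \<delta> l + of_bool (l = i))"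
      using val_unit[of \<gamma> i \<delta>] assms by (simp add: idx_def)
    then show ?thesis unfolding F_def using idx_unit2[OF gd(2) assms(1)] by (intro span_base) auto
  qed
qed

lemma C_F: "C k \<subseteq> F j k"
  unfolding F_def using span_superset by blast

lemma F_Suc1: "F (Suc j) k = span R M (C k \<union> {z i \<odot>\<^bsub>M\<^esub> x | i x. i \<in> V1 \<and> x \<in> F j k})" (is "_ = ?S")
proof
  have zc: "{z i \<odot>\<^bsub>M\<^esub> x | i x. i \<in> V1 \<and> x \<in> F j k} \<subseteq> carrier M"
    using z sub_carr[OF sub_F] by auto
  show "?S \<subseteq> F (Suc j) k"
    by (rule span_least[OF sub_F]) (use C_F z_F1 in blast)
  show "F (Suc j) k \<subseteq> ?S"
    unfolding F_def[of "Suc j"]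
  proof (rule span_mono, rule Un_mono[OF order_refl], rule image_subsetI)
    fix p assume "p \<in> idx (Suc j) k"
    then obtain q i where q: "q \<in> idx j k" "i \<in> V1" "val p = z i \<odot>\<^bsub>M\<^esub> val q" by (rule idx_Suc1_cases)
    have "val q \<in> F j k" unfolding F_def using q(1) by (intro span_base) simp
    then show "val p \<in> {z i \<odot>\<^bsub>M\<^esub> x | i x. i \<in> V1 \<and> x \<in> F j k}" using q by blast
  qed
qed

lemma F_Suc2: "F j (Suc k) = span R M (C (Suc k) \<union> {z i \<odot>\<^bsub>M\<^esub> x | i x. i \<in> V2 \<and> x \<in> F j k})" (is "_ = ?S")
proof
  have zc: "{z i \<odot>\<^bsub>M\<^esub> x | i x. i \<in> V2 \<and> x \<in> F j k} \<subseteq> carrier M"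
    using z sub_carr[OF sub_F] by auto
  show "?S \<subseteq> F j (Suc k)"
    by (rule span_least[OF sub_F]) (use C_F z_F2 in blast)
  show "F j (Suc k) \<subseteq> ?S"
    unfolding F_def[of j "Suc k"]
  proof (rule span_mono, rule Un_mono[OF order_refl], rule image_subsetI)
    fix p assume "p \<in> idx j (Suc k)"
    then obtain q i where q: "q \<in> idx j k" "i \<in> V2" "val p = z i \<odot>\<^bsub>M\<^esub> val q" by (rule idx_Suc2_cases)
    have "val q \<in> F j k" unfolding F_def using q(1) by (intro span_base) simp
    then show "val p \<in> {z i \<odot>\<^bsub>M\<^esub> x | i x. i \<in> V2 \<and> x \<in> F j k}" using q by blast
  qed
qed

lemma F_0_0: "F 0 0 = span R M (C 0 \<union> e ` G)"
proof -
  have "idx 0 0 = (\<lambda>\<gamma>. (\<gamma>, \<lambda>_. 0)) ` G"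
  proof
    show "idx 0 0 \<subseteq> (\<lambda>\<gamma>. (\<gamma>, \<lambda>_. 0)) ` G"
    proof
      fix p assume "p \<in> idx 0 0"
      then obtain \<gamma> \<delta> where p: "p = (\<gamma>, \<delta>)" "\<gamma> \<in> G" "\<delta> \<in> exps V" "tdeg V1 \<delta> = 0" "tdeg V2 \<delta> = 0"
        unfolding idx_def by blast
      have "\<delta> i = 0" for i
        using p(3-5) fin by (cases "i \<in> V") (auto simp: exps_def tdeg_def)
      then have "\<delta> = (\<lambda>_. 0)" by blast
      then show "p \<in> (\<lambda>\<gamma>. (\<gamma>, \<lambda>_. 0)) ` G" using p by simp
    qed
    show "(\<lambda>\<gamma>. (\<gamma>, \<lambda>_. 0)) ` G \<subseteq> idx 0 0" by (auto simp: idx_def exps_def tdeg_def)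
  qed
  then have "val ` idx 0 0 = e ` G"
    using e by (auto simp: val_def zpow_zero image_image intro!: image_cong)
  then show ?thesis unfolding F_def by simp
qed

lemma F_antimono: "F (Suc j) k \<subseteq> F j k"
  unfolding F_Suc1
proof (rule span_least[OF sub_F])
  show "C k \<union> {z i \<odot>\<^bsub>M\<^esub> x |i x. i \<in> V1 \<and> x \<in> F j k} \<subseteq> F j k"
    using C_F[of k j] sub_smult[OF sub_F[of j k]] z by blast
qed

lemma F_decreasing: "F (j + i) k \<subseteq> F j k"
proof (induction i)
  case (Suc i)
  then show ?case using F_antimono[of "j + i" k] by simp
qed simp

lemma m_F:
  assumes "a \<in> \<mm>" "x \<in> F j k"
  shows "a \<odot>\<^bsub>M\<^esub> x \<in> F (Suc j) k"
  by (rule genideal_smult_in[OF sub_F sub_carr[OF sub_F assms(2)], of "z ` V1"])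
     (use z z_F1 assms gen in auto)

text \<open>Only factors from \<open>V2\<close> advance the index of \<open>C\<close>; factors from
  \<open>V1\<close> act as plain scalars on each submodule.\<close>

lemma zpow_C:
  assumes "\<epsilon> \<in> exps V" "x \<in> C k"
  shows "zpow \<epsilon> \<odot>\<^bsub>M\<^esub> x \<in> C (k + tdeg V2 \<epsilon>)"
  using assms
proof (induction "tdeg V \<epsilon>" arbitrary: \<epsilon>)
  case 0
  then have "\<epsilon> i = 0" for i
    using finV by (cases "i \<in> V") (auto simp: exps_def tdeg_def)
  then have "\<epsilon> = (\<lambda>_. 0)" by blast
  then show ?case using 0 sub_carr[OF C] by (simp add: zpow_zero tdeg_def)
next
  case (Suc n)
  obtain i where i: "i \<in> V" "\<epsilon> i > 0" using tdeg_pos[OF Suc.hyps(2)[symmetric]] .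
  obtain \<zeta> where \<zeta>: "\<zeta> \<in> exps V" "\<epsilon> = (\<lambda>l. \<zeta> l + of_bool (l = i))"
    using exps_decompose[OF Suc.prems(1) i(2,1)] .
  have "tdeg V \<epsilon> = tdeg V \<zeta> + 1"
    unfolding \<zeta>(2) tdeg_add tdeg_unit[OF finV] using i by simp
  then have IH: "zpow \<zeta> \<odot>\<^bsub>M\<^esub> x \<in> C (k + tdeg V2 \<zeta>)"
    using Suc \<zeta>(1) by simp
  have zp: "zpow \<epsilon> \<odot>\<^bsub>M\<^esub> x = z i \<odot>\<^bsub>M\<^esub> (zpow \<zeta> \<odot>\<^bsub>M\<^esub> x)"
    unfolding \<zeta>(2) zpow_add zpow_unit[OF i(1)]
    using z[OF i(1)] sub_carr[OF C Suc.prems(2)] by (simp add: smult_assoc1[symmetric] R.m_comm)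
  have deg: "tdeg V2 \<epsilon> = tdeg V2 \<zeta> + of_bool (i \<in> V2)"
    unfolding \<zeta>(2) tdeg_add tdeg_unit[OF fin(2)] ..
  show ?case
  proof (cases "i \<in> V2")
    case True
    then show ?thesis unfolding zp deg using zC[OF True IH] by simp
  next
    case False
    then show ?thesis unfolding zp deg using sub_smult[OF C z[OF i(1)] IH] by simp
  qed
qed

lemma zpow_F:
  assumes "\<epsilon> \<in> exps V" "x \<in> F j k"
  shows "zpow \<epsilon> \<odot>\<^bsub>M\<^esub> x \<in> F (j + tdeg V1 \<epsilon>) (k + tdeg V2 \<epsilon>)"
proof (rule smult_span_in[OF sub_F _ _ _ assms(2)[unfolded F_def]])
  show "C k \<union> val ` idx j k \<subseteq> carrier M" using C_carrier val_idx_carrier by blast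
  fix x assume "x \<in> C k \<union> val ` idx j k"
  then show "zpow \<epsilon> \<odot>\<^bsub>M\<^esub> x \<in> F (j + tdeg V1 \<epsilon>) (k + tdeg V2 \<epsilon>)"
  proof
    assume "x \<in> C k"
    then show ?thesis using zpow_C[OF assms(1)] C_F by blast
  next
    assume "x \<in> val ` idx j k"
    then obtain \<gamma> \<delta> where gd: "x = val (\<gamma>, \<delta>)" "(\<gamma>, \<delta>) \<in> idx j k" by auto
    then have "zpow \<epsilon> \<odot>\<^bsub>M\<^esub> x = val (\<gamma>, \<lambda>l. \<delta> l + \<epsilon> l)"
      using val_add[of \<gamma> \<delta> \<epsilon>] by (simp add: idx_def)
    then show ?thesis unfolding F_def using idx_add[OF gd(2) assms(1)] by (intro span_base) auto
  qed
qed simp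

text \<open>A relation expressing a monomial by smaller ones and an element of
  \<open>F (Suc j) k\<close> stays such a relation after multiplication by
  \<open>zpow \<epsilon>\<close>: \<open>mless_add\<close> keeps the smaller monomials smaller, and
  \<open>zpow_F\<close> moves the rest into the corresponding filtration step of the new
  bidegree.\<close>

lemma monomial_ideal_nonstd:
  assumes "\<gamma> \<in> G"
  shows "monomial_ideal V (nonstd \<gamma>)"
  unfolding monomial_ideal_def
proof (intro ballI impI)
  fix \<delta> \<epsilon> assume \<delta>: "\<delta> \<in> exps V" and \<epsilon>: "\<epsilon> \<in> exps V" and ns: "\<delta> \<in> nonstd \<gamma>"
  let ?j = "tdeg V1 \<delta>" and ?k = "tdeg V2 \<delta>"
  let ?T = "F (Suc (tdeg V1 (\<lambda>i. \<delta> i + \<epsilon> i))) (tdeg V2 (\<lambda>i. \<delta> i + \<epsilon> i)) \<union> below (\<gamma>, \<lambda>i. \<delta> i + \<epsilon> i)"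
  have T: "sub (span R M ?T)" using sub_subset[OF sub_F] below_carrier by (intro sub_span) blast
  have "zpow \<epsilon> \<odot>\<^bsub>M\<^esub> val (\<gamma>, \<delta>) \<in> span R M ?T"
  proof (rule smult_span_in[OF T])
    show "val (\<gamma>, \<delta>) \<in> span R M (F (Suc ?j) ?k \<union> below (\<gamma>, \<delta>))"
      using ns unfolding nonstd_def by simp
    show "F (Suc ?j) ?k \<union> below (\<gamma>, \<delta>) \<subseteq> carrier M"
      using sub_subset[OF sub_F] below_carrier by blast
    fix x assume "x \<in> F (Suc ?j) ?k \<union> below (\<gamma>, \<delta>)"
    then show "zpow \<epsilon> \<odot>\<^bsub>M\<^esub> x \<in> span R M ?T"
    proof
      assume "x \<in> F (Suc ?j) ?k"
      from zpow_F[OF \<epsilon> this] show ?thesis by (intro span_base) (simp add: tdeg_add)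
    next
      assume "x \<in> below (\<gamma>, \<delta>)"
      then obtain \<eta> \<zeta> where q: "x = val (\<eta>, \<zeta>)" "(\<eta>, \<zeta>) \<in> idx ?j ?k" "mless (\<eta>, \<zeta>) (\<gamma>, \<delta>)"
        unfolding below_def by auto
      have "zpow \<epsilon> \<odot>\<^bsub>M\<^esub> x = val (\<eta>, \<lambda>i. \<zeta> i + \<epsilon> i)"
        using val_add[of \<eta> \<zeta> \<epsilon>] q by (simp add: idx_def)
      moreover have "val (\<eta>, \<lambda>i. \<zeta> i + \<epsilon> i) \<in> below (\<gamma>, \<lambda>i. \<delta> i + \<epsilon> i)"
        unfolding below_def using idx_add[OF q(2) \<epsilon>] mless_add[OF q(3)] by (auto simp: tdeg_add)
      ultimately show ?thesis by (intro span_base) simp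
    qed
  qed simp
  then show "(\<lambda>i. \<delta> i + \<epsilon> i) \<in> nonstd \<gamma>"
    unfolding nonstd_def by (simp add: val_add[OF assms])
qed

lemma finite_idx: "finite (idx j k)"
proof (rule finite_subset)
  have "V \<inter> V1 = V1" "V - V1 = V2" using disj by auto
  then show "finite (G \<times> {\<delta> \<in> exps V. tdeg V1 \<delta> = j \<and> tdeg V2 \<delta> = k})"
    using finite_exps_tdeg[OF finV, of V1 j k] fin by simp
  show "idx j k \<subseteq> G \<times> {\<delta> \<in> exps V. tdeg V1 \<delta> = j \<and> tdeg V2 \<delta> = k}"
    unfolding idx_def by blast
qed

text \<open>By \<open>m_F\<close> the ideal \<open>\<mm>\<close> maps \<open>F j k\<close> into
  \<open>F (Suc j) k\<close>, so \<open>len_span_finite_count\<close> applies to the monomials of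
  bidegree \<open>(j, k)\<close>; the ones it counts are the standard ones.\<close>

lemma len_F_step: "len sub (F (Suc j) k) (F j k) = enat (\<Sum>\<gamma>\<in>G. hcount V V1 (nonstd \<gamma>) j k)"
proof -
  have eq: "F j k = span R M (F (Suc j) k \<union> val ` idx j k)"
  proof
    show "F j k \<subseteq> span R M (F (Suc j) k \<union> val ` idx j k)"
      unfolding F_def[of j k] using C_F[of k "Suc j"] by (intro span_mono) blast
    show "span R M (F (Suc j) k \<union> val ` idx j k) \<subseteq> F j k"
      using F_antimono by (intro span_least[OF sub_F]) (auto simp: F_def intro: span_base)
  qed
  have "len sub (F (Suc j) k) (F j k) =
    enat (card {p \<in> idx j k. val p \<notin> span R M (F (Suc j) k \<union> val ` {q \<in> idx j k. mless q p})})"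
    unfolding eq
  proof (rule len_span_finite_count[OF mx sub_F finite_idx mless_irrefl])
    show "a \<odot>\<^bsub>M\<^esub> val p \<in> F (Suc j) k" if "a \<in> \<mm>" "p \<in> idx j k" for a p
    proof (rule m_F[OF that(1)])
      show "val p \<in> F j k" unfolding F_def using that by (intro span_base) simp
    qed
    show "mless p q \<or> p = q \<or> mless q p" if "p \<in> idx j k" "q \<in> idx j k" for p q
      using that by (intro mless_total[OF finV]) (auto simp: idx_def)
  qed (use mless_trans val_closed in blast)+
  also have "{p \<in> idx j k. val p \<notin> span R M (F (Suc j) k \<union> val ` {q \<in> idx j k. mless q p})}
      = (SIGMA \<gamma>:G. {\<delta> \<in> exps V. \<delta> \<notin> nonstd \<gamma> \<and> tdeg (V \<inter> V1) \<delta> = j \<and> tdeg (V - V1) \<delta> = k})"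
  proof -
    have "V \<inter> V1 = V1" "V - V1 = V2" using disj by auto
    then show ?thesis unfolding idx_def nonstd_def below_def by auto
  qed
  also have "card \<dots> = (\<Sum>\<gamma>\<in>G. hcount V V1 (nonstd \<gamma>) j k)"
    unfolding hcount_def
  proof (rule card_SigmaI[OF fin(3)], rule ballI)
    show "finite {\<delta> \<in> exps V. \<delta> \<notin> nonstd \<gamma> \<and> tdeg (V \<inter> V1) \<delta> = j \<and> tdeg (V - V1) \<delta> = k}" for \<gamma>
      by (rule finite_subset[OF _ finite_exps_tdeg[OF finV, of V1 j k]]) blast
  qed
  finally show ?thesis .
qed

text \<open>Summing up to and including \<open>n\<close> measures the quotient by step
  \<open>Suc n\<close>, matching the exponent \<open>n + 1\<close> of \<open>\<mm>\<close> in the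
  definition of Hilbert coefficients.\<close>

definition H :: "nat \<Rightarrow> nat \<Rightarrow> nat" where
  "H n k = (\<Sum>j\<le>n. \<Sum>\<gamma>\<in>G. hcount V V1 (nonstd \<gamma>) j k)"

lemma len_F: "len sub (F (Suc n) k) (F 0 k) = enat (H n k)"
proof (induction n)
  case 0
  then show ?case by (simp add: len_F_step H_def)
next
  case (Suc n)
  have "len sub (F (Suc (Suc n)) k) (F 0 k) =
      len sub (F (Suc (Suc n)) k) (F (Suc n) k) + len sub (F (Suc n) k) (F 0 k)"
    by (intro len_add sub_F F_antimono) (use F_decreasing[of 0 "Suc n" k] in simp)
  then show ?case by (simp add: Suc len_F_step H_def add.commute)
qed

lemma H_binumerical: "binumerical (\<lambda>n k. int (H n k))"
proof -
  have "binumerical (\<lambda>n k. \<Sum>j\<le>n. (\<Sum>\<gamma>\<in>G. int (hcount V V1 (nonstd \<gamma>) j k)))"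
    by (intro binumerical_partial_sum binumerical_sum hcount_binumerical[OF finV] monomial_ideal_nonstd)
  then show ?thesis unfolding H_def by simp
qed

end

section \<open>Filtration steps in terms of powers of the maximal ideal\<close>

context bigraded
begin

text \<open>Both sides obey the same recursion in \<open>j\<close>: multiplication by the generators
  \<open>z i\<close> with \<open>i \<in> V1\<close> on the left, by all of \<open>\<mm>\<close> on
  the right.\<close>

lemma F_eq: "F j k = span R M (C k \<union> ideal_smult M (ideal_pow R \<mm> j) (F 0 k))"
proof (induction j)
  case 0
  have "C k \<union> F 0 k = F 0 k" using C_F by blast
  then show ?case by (simp add: ideal_smult_carrier[OF sub_F] span_id[OF sub_F])
next
  case (Suc j)
  interpret m: maximalideal \<mm> R by (rule mx)
  define P where "P = ideal_smult M (ideal_pow R \<mm> j) (F 0 k)"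
  have mj: "ideal (ideal_pow R \<mm> j) R" by (rule R.ideal_pow_ideal[OF m.is_ideal])
  have sP: "sub P" unfolding P_def by (rule sub_ideal_smult[OF mj sub_F])
  have PF: "P \<subseteq> F j k" unfolding Suc P_def[symmetric] using span_superset by blast
  have eq: "ideal_smult M (ideal_pow R \<mm> (Suc j)) (F 0 k) = ideal_smult M \<mm> P"
    unfolding P_def R.ideal_pow_Suc'[OF m.is_ideal] by (rule ideal_smult_assoc[OF m.is_ideal mj sub_F])
  have sS: "sub (ideal_smult M \<mm> P)" by (rule sub_ideal_smult[OF m.is_ideal sP])
  have sT: "sub (span R M (C k \<union> ideal_smult M \<mm> P))"
    using C_carrier sub_subset[OF sS] by (intro sub_span) blast
  show ?case unfolding eq
  proof
    show "span R M (C k \<union> ideal_smult M \<mm> P) \<subseteq> F (Suc j) k"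
    proof (rule span_least[OF sub_F], rule Un_least[OF C_F])
      show "ideal_smult M \<mm> P \<subseteq> F (Suc j) k"
        by (rule ideal_smult_subset[OF sub_F]) (use m_F PF in blast)
    qed
    show "F (Suc j) k \<subseteq> span R M (C k \<union> ideal_smult M \<mm> P)"
      unfolding F_Suc1
    proof (rule span_least[OF sT], rule Un_least)
      show "C k \<subseteq> span R M (C k \<union> ideal_smult M \<mm> P)" using span_superset by blast
      show "{z i \<odot>\<^bsub>M\<^esub> x |i x. i \<in> V1 \<and> x \<in> F j k} \<subseteq> span R M (C k \<union> ideal_smult M \<mm> P)"
      proof clarify
        fix i x assume i: "i \<in> V1" and x: "x \<in> F j k"
        have zi: "z i \<in> carrier R" using z i by simp
        have zm: "z i \<in> \<mm>" unfolding gen using R.genideal_self[of "z ` V1"] z i by blast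
        show "z i \<odot>\<^bsub>M\<^esub> x \<in> span R M (C k \<union> ideal_smult M \<mm> P)"
        proof (rule smult_span_in[OF sT zi])
          show "x \<in> span R M (C k \<union> P)" using x unfolding Suc P_def[symmetric] .
          show "C k \<union> P \<subseteq> carrier M" using C_carrier sub_subset[OF sP] by blast
          fix y assume "y \<in> C k \<union> P"
          then show "z i \<odot>\<^bsub>M\<^esub> y \<in> span R M (C k \<union> ideal_smult M \<mm> P)"
          proof
            assume "y \<in> C k"
            then have "z i \<odot>\<^bsub>M\<^esub> y \<in> C k" by (rule sub_smult[OF C zi])
            then show ?thesis by (intro span_base) simp
          next
            assume "y \<in> P"
            then have "z i \<odot>\<^bsub>M\<^esub> y \<in> ideal_smult M \<mm> P" by (intro ideal_smult.smult zm)
            then show ?thesis by (intro span_base) simp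
          qed
        qed
      qed
    qed
  qed
qed

end

section \<open>Growth bounds by chains of primes\<close>

text \<open>Noetherian induction on \<open>Q\<close>: a non-prime \<open>Q\<close> is bounded by two larger elements, and passing
  from a prime to a larger element lowers both the growth order and the length of prime chains.\<close>

lemma growth_by_prime_chains:
  fixes h :: "'x::order \<Rightarrow> nat \<Rightarrow> nat"
  assumes wf: "wf {(Q', Q). Q \<in> X \<and> Q' \<in> X \<and> Q < Q'}"
    and nonprime_step: "\<And>Q. Q \<in> X \<Longrightarrow> \<not> is_prime Q \<Longrightarrow> (\<forall>\<^sub>F k in sequentially. h Q k = 0) \<or>
      (\<exists>Q1\<in>X. \<exists>Q2\<in>X. \<exists>i. Q < Q1 \<and> Q < Q2 \<and> (\<forall>\<^sub>F k in sequentially. h Q k \<le> h Q1 k + h Q2 (k - i)))"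
    and prime_step: "\<And>Q. Q \<in> X \<Longrightarrow> is_prime Q \<Longrightarrow>
      \<exists>Q1\<in>X. Q < Q1 \<and> (\<forall>\<^sub>F k in sequentially. 1 \<le> k \<and> h Q k \<le> h Q (k - 1) + h Q1 k)"
    and Q: "Q \<in> X"
    and D: "\<And>n P. (\<And>i. i < n \<Longrightarrow> P i \<in> X \<and> is_prime (P i) \<and> Q \<le> P i) \<Longrightarrow>
      (\<And>i. Suc i < n \<Longrightarrow> P i < P (Suc i)) \<Longrightarrow> n \<le> D"
  shows "growth D (h Q)"
  using wf Q D
proof (induction Q arbitrary: D rule: wf_induct_rule)
  case (less Q)
  show ?case
  proof (cases "is_prime Q")
    case False
    from nonprime_step[OF less.prems(1) False] show ?thesis
    proof
      assume "\<forall>\<^sub>F k in sequentially. h Q k = 0"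
      then have "growth 0 (h Q)" by simp
      then show ?thesis by (rule growth_mono) simp
    next
      assume "\<exists>Q1\<in>X. \<exists>Q2\<in>X. \<exists>i. Q < Q1 \<and> Q < Q2 \<and> (\<forall>\<^sub>F k in sequentially. h Q k \<le> h Q1 k + h Q2 (k - i))"
      then obtain Q1 Q2 i where Q12: "Q1 \<in> X" "Q2 \<in> X" "Q < Q1" "Q < Q2"
        and le: "\<forall>\<^sub>F k in sequentially. h Q k \<le> h Q1 k + h Q2 (k - i)" by blast
      have *: "growth D (h Q')" if "Q' \<in> X" "Q < Q'" for Q'
      proof (rule less.IH)
        show "(Q', Q) \<in> {(Q', Q). Q \<in> X \<and> Q' \<in> X \<and> Q < Q'}" using that less.prems(1) by simp
        fix n P assume P: "\<And>i. i < n \<Longrightarrow> P i \<in> X \<and> is_prime (P i) \<and> Q' \<le> P i" "\<And>i. Suc i < n \<Longrightarrow> P i < P (Suc i)"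
        show "n \<le> D"
          by (rule less.prems(2)) (use P that(2) order_trans[of Q Q'] in auto)
      qed (rule that)
      \<comment> \<open>The shift by \<open>i\<close> comes from multiplication by an element of
        degree \<open>i\<close>; by \<open>growth_shift\<close> it leaves the order
        unchanged.\<close>
      show ?thesis
        by (rule growth_le[OF growth_add le]) (intro * growth_shift Q12)+
    qed
  next
    case True
    obtain Q1 where Q1: "Q1 \<in> X" "Q < Q1"
      and le: "\<forall>\<^sub>F k in sequentially. 1 \<le> k \<and> h Q k \<le> h Q (k - 1) + h Q1 k"
      using prime_step[OF less.prems(1) True] by blast
    \<comment> \<open>\<open>D\<close> counts primes rather than inclusions: the chain consisting of
      \<open>Q\<close> alone already gives \<open>D \<ge> 1\<close>, so there is one order to give
      up.\<close>
    have "1 \<le> D"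
      by (rule less.prems(2)[of 1 "\<lambda>_. Q"]) (use less.prems(1) True in auto)
    then obtain D' where D': "D = Suc D'" by (cases D) auto
    have "growth D' (h Q1)"
    proof (rule less.IH)
      show "(Q1, Q) \<in> {(Q', Q). Q \<in> X \<and> Q' \<in> X \<and> Q < Q'}" using Q1 less.prems(1) by simp
      fix n P assume P: "\<And>i. i < n \<Longrightarrow> P i \<in> X \<and> is_prime (P i) \<and> Q1 \<le> P i" "\<And>i. Suc i < n \<Longrightarrow> P i < P (Suc i)"
      \<comment> \<open>A chain of primes above \<open>Q1\<close> is extended downwards by the prime
        \<open>Q\<close>.\<close>
      have "Suc n \<le> D"
      proof (rule less.prems(2)[of "Suc n" "case_nat Q P"])
        fix i assume i: "i < Suc n"
        show "case_nat Q P i \<in> X \<and> is_prime (case_nat Q P i) \<and> Q \<le> case_nat Q P i"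
        proof (cases i)
          case 0 then show ?thesis using less.prems(1) True by simp
        next
          case (Suc l)
          then show ?thesis using P(1)[of l] i Q1(2) order_trans[of Q Q1 "P l"] by simp
        qed
      next
        fix i assume i: "Suc i < Suc n"
        show "case_nat Q P i < case_nat Q P (Suc i)"
        proof (cases i)
          case 0
          then show ?thesis using P(1)[of 0] i Q1(2) order_less_le_trans[of Q Q1 "P 0"] by simp
        next
          case (Suc l) then show ?thesis using P(2)[of l] i by simp
        qed
      qed
      then show "n \<le> D'" using D' by simp
    qed (rule Q1)
    from growth_Suc_of_difference[OF this le] show ?thesis unfolding D' .
  qed
qed

subsection \<open>Ideals of a ring\<close>

lemma ideal_smult_reg_module: "ideal_smult (reg_module R) I N = ideal_prod R I N"
proof
  show "ideal_smult (reg_module R) I N \<subseteq> ideal_prod R I N"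
  proof
    fix x assume "x \<in> ideal_smult (reg_module R) I N"
    then show "x \<in> ideal_prod R I N"
      by induction (auto intro: ideal_prod.intros)
  qed
  show "ideal_prod R I N \<subseteq> ideal_smult (reg_module R) I N"
  proof
    fix x assume "x \<in> ideal_prod R I N"
    then show "x \<in> ideal_smult (reg_module R) I N"
    proof induction
      case (prod i j)
      then show ?case using ideal_smult.smult[of i I j N "reg_module R"] by simp
    next
      case (sum s t)
      then show ?case using ideal_smult.add[of s "reg_module R" I N t] by simp
    qed
  qed
qed

abbreviation ilen :: "('a, 'r) ring_scheme \<Rightarrow> 'a set \<Rightarrow> 'a set \<Rightarrow> enat" where
  "ilen R \<equiv> len (\<lambda>I. ideal I R)"

abbreviation ispan :: "('a, 'r) ring_scheme \<Rightarrow> 'a set \<Rightarrow> 'a set" where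
  "ispan R \<equiv> span R (reg_module R)"

context cring
begin

interpretation reg: module R "reg_module R"
  by (rule reg_module_is_module)

lemma reg_sub: "reg.sub = (\<lambda>I. ideal I R)"
  by (rule ext) (rule submodule_reg_module_iff)

lemma ideal_ispan: "X \<subseteq> carrier R \<Longrightarrow> ideal (ispan R X) R"
  using reg.sub_span[of X] unfolding submodule_reg_module_iff by simp

lemma ispan_least: "ideal N R \<Longrightarrow> X \<subseteq> N \<Longrightarrow> ispan R X \<subseteq> N"
  using reg.span_least[of N X] unfolding submodule_reg_module_iff .

lemma ispan_superset: "X \<subseteq> ispan R X"
  by (rule reg.span_superset)

lemma ispan_id: "ideal N R \<Longrightarrow> ispan R N = N"
  using reg.span_id[of N] unfolding submodule_reg_module_iff .

lemma ispan_mult_in: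
  assumes "ideal N R" "a \<in> carrier R" "X \<subseteq> carrier R" "\<And>x. x \<in> X \<Longrightarrow> a \<otimes> x \<in> N" "y \<in> ispan R X"
  shows "a \<otimes> y \<in> N"
  using reg.smult_span_in[of N a X y] assms unfolding submodule_reg_module_iff by simp

lemma ideal_carrier_subset: "ideal N R \<Longrightarrow> N \<subseteq> carrier R"
  by (rule subsetI) (rule ideal.Icarr)

lemma ilen_add:
  assumes "ideal X R" "ideal Y R" "ideal Z R" "X \<subseteq> Y" "Y \<subseteq> Z"
  shows "ilen R X Z = ilen R X Y + ilen R Y Z"
  using reg.len_add[of X Y Z] assms unfolding reg_sub by (simp add: submodule_reg_module_iff)

lemma ideal_colon_ideal:
  assumes "ideal Y R" "ideal Z R" "a \<in> carrier R"
  shows "ideal {c \<in> Y. c \<otimes> a \<in> Z} R"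
  using reg.ideal_colon[of Y Z a] assms unfolding submodule_reg_module_iff by simp

text \<open>The length form of the exact sequence
  \<open>Y / B -> L / U -> L / (U + Y a) -> 0\<close> given by multiplication by \<open>a\<close>.
  The estimates for adjoining an element, in the ring and in the fiber cone, are instances of
  it.\<close>

lemma ilen_split_mult:
  assumes U: "ideal U R" and L: "ideal L R" and Y: "ideal Y R" and a: "a \<in> carrier R"
    and UL: "U \<subseteq> L" and BY: "B \<subseteq> Y"
    and BU: "\<And>c. c \<in> B \<Longrightarrow> c \<otimes> a \<in> U" and YL: "\<And>c. c \<in> Y \<Longrightarrow> c \<otimes> a \<in> L"
  shows "ilen R U L \<le> ilen R B Y + ilen R (ispan R (U \<union> (\<lambda>c. c \<otimes> a) ` Y)) L"
proof -
  let ?S = "ispan R (U \<union> (\<lambda>c. c \<otimes> a) ` Y)"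
  have UYL: "U \<union> (\<lambda>c. c \<otimes> a) ` Y \<subseteq> L" using UL YL by blast
  have S: "ideal ?S R"
    by (rule ideal_ispan) (use UYL ideal_carrier_subset[OF L] in blast)
  have "ilen R U L = ilen R U ?S + ilen R ?S L"
    by (rule ilen_add[OF U S L]) (use ispan_superset[of "U \<union> (\<lambda>c. c \<otimes> a) ` Y"] ispan_least[OF L UYL] in auto)
  moreover have "ilen R U ?S \<le> ilen R B Y"
    using reg.len_span_smult_le[of U a Y B] U a Y BY BU unfolding reg_sub submodule_reg_module_iff by simp
  ultimately show ?thesis by (simp add: add_right_mono)
qed

end

lemma finite_set_as_image:
  assumes "finite A"
  obtains n and f :: "nat \<Rightarrow> 'a" where "f ` {..<n} = A"
proof -
  obtain f :: "nat \<Rightarrow> 'a" and n where "A = f ` {i. i < n}"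
    using finite_imp_nat_seg_image_inj_on[OF assms] by blast
  then show ?thesis using that[of f n] by (simp add: lessThan_def)
qed

context noetherian_ring
begin

lemma wf_ideals: "wf {(I', I). I \<in> {I. ideal I R} \<and> I' \<in> {I. ideal I R} \<and> I \<subset> I'}"
  unfolding wf_iff_no_infinite_down_chain
proof
  assume "\<exists>f. \<forall>i. (f (Suc i), f i) \<in> {(I', I). I \<in> {I. ideal I R} \<and> I' \<in> {I. ideal I R} \<and> I \<subset> I'}"
  then obtain f where "\<forall>i. (f (Suc i), f i) \<in> {(I', I). I \<in> {I. ideal I R} \<and> I' \<in> {I. ideal I R} \<and> I \<subset> I'}"
    by (rule exE)
  then have f: "\<And>i. ideal (f i) R" "\<And>i. f i \<subset> f (Suc i)" by simp_all
  have inc: "f i \<subseteq> f j" if "i \<le> j" for i j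
    using that by (induction j rule: dec_induct) (use f(2) in blast)+
  have "subset.chain {I. ideal I R} (range f)"
    unfolding subset_chain_def
  proof (intro conjI ballI)
    show "range f \<subseteq> {I. ideal I R}" using f(1) by blast
    fix X Y assume "X \<in> range f" "Y \<in> range f"
    then obtain i j where "X = f i" "Y = f j" by blast
    then show "X \<subseteq> Y \<or> Y \<subseteq> X" using inc[of i j] inc[of j i] nat_le_linear[of i j] by blast
  qed
  then have "\<Union>(range f) \<in> range f" by (intro ideal_chain_is_trivial) auto
  then obtain N where "\<Union>(range f) = f N" by auto
  then have "f (Suc N) \<subseteq> f N" by blast
  then show False using f(2)[of N] by blast
qed

lemma ideal_generators:
  assumes "ideal I R"
  obtains n and f :: "nat \<Rightarrow> 'a" where "I = genideal R (f ` {..<n})" "\<And>i. i < n \<Longrightarrow> f i \<in> carrier R"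
proof -
  obtain A where A: "A \<subseteq> carrier R" "finite A" "I = genideal R A" using finetely_gen[OF assms] by blast
  obtain n and f :: "nat \<Rightarrow> 'a" where f: "f ` {..<n} = A" using finite_set_as_image[OF A(2)] .
  have "f i \<in> carrier R" if "i < n" for i using f A(1) that by blast
  then show ?thesis using that[of f n] A(3) f by simp
qed

end

locale noetherian_cring_max = cring R + noetherian_ring R for R (structure) +
  fixes \<mm>
  assumes mx: "maximalideal \<mm> R"
begin

interpretation reg: module R "reg_module R"
  by (rule reg_module_is_module)

lemma m_ideal: "ideal \<mm> R"
  using mx by (rule maximalideal.axioms)

abbreviation mpow where "mpow n \<equiv> ideal_pow R \<mm> n"

text \<open>The ideal \<open>A + \<mm>^n\<close>; its colength, \<open>hloc A n\<close> below, is
  the Hilbert-Samuel function of \<open>R / A\<close>.\<close>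

definition loc :: "'a set \<Rightarrow> nat \<Rightarrow> 'a set" where
  "loc A n = ispan R (A \<union> mpow n)"

lemma mpow_ideal: "ideal (mpow n) R"
  by (rule ideal_pow_ideal[OF m_ideal])

lemma loc_ideal: "ideal A R \<Longrightarrow> ideal (loc A n) R"
  unfolding loc_def using ideal_carrier_subset ideal_carrier_subset[OF mpow_ideal] by (intro ideal_ispan) blast

lemma loc_superset: "A \<subseteq> loc A n" "mpow n \<subseteq> loc A n"
  unfolding loc_def using ispan_superset[of "A \<union> mpow n"] by blast+

text \<open>A degenerate case of the bigraded count: one generator \<open>\<one>\<close>, no
  variables of the second kind and the constant family \<open>A\<close>. Then \<open>F n 0\<close>
  is \<open>A + \<mm>^n\<close>, and its colength is a finite number of monomials. The case
  \<open>n = 0\<close> is separate because \<open>len_F\<close> speaks of steps from 1 on.\<close>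

lemma loc_finite:
  assumes A: "ideal A R"
  shows "ilen R (loc A n) (carrier R) \<noteq> \<infinity>"
proof (cases n)
  case 0
  have "loc A 0 = carrier R"
    using loc_superset(2)[of 0 A] ideal_carrier_subset[OF loc_ideal[OF A, of 0]] by simp
  then show ?thesis using len_refl[of "\<lambda>I. ideal I R", OF oneideal] 0 by simp
next
  case (Suc l)
  obtain p and z :: "nat \<Rightarrow> 'a" where z: "\<mm> = genideal R (z ` {..<p})" "\<And>i. i < p \<Longrightarrow> z i \<in> carrier R"
    using ideal_generators[OF m_ideal] by metis
  have "bigraded R (reg_module R) \<mm> z {..<p} {} {0} (\<lambda>_. \<one>) (\<lambda>_. A)"
    by (intro bigraded.intro bigraded_axioms.intro reg_module_is_module mx z(1))
       (simp_all add: z(2) submodule_reg_module_iff A)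
  then interpret B: bigraded R "reg_module R" \<mm> z "{..<p}" "{}" "{0}" "\<lambda>_. \<one>" "\<lambda>_. A" .
  have idF: "ideal (B.F 0 0) R" by (rule submodule_reg_module_iff[THEN iffD1, OF B.sub_F])
  have F0: "B.F 0 0 = carrier R"
  proof
    show "B.F 0 0 \<subseteq> carrier R" by (rule ideal_carrier_subset[OF idF])
    have "\<one> \<in> B.F 0 0" unfolding B.F_0_0 by (intro reg.span_base) simp
    then have "B.F 0 0 = carrier R" by (rule ideal.one_imp_carrier[OF idF])
    then show "carrier R \<subseteq> B.F 0 0" by simp
  qed
  have "B.F n 0 = loc A n"
    unfolding B.F_eq[of n 0] F0 ideal_smult_reg_module loc_def ideal_prod_one[OF mpow_ideal] ..
  then have "ilen R (loc A n) (carrier R) = enat (B.H l 0)"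
    using B.len_F[of l 0] F0 Suc unfolding reg_sub by simp
  then show ?thesis by simp
qed

definition hloc :: "'a set \<Rightarrow> nat \<Rightarrow> nat" where
  "hloc A n = the_enat (ilen R (loc A n) (carrier R))"

lemma hloc: "ideal A R \<Longrightarrow> ilen R (loc A n) (carrier R) = enat (hloc A n)"
  unfolding hloc_def using loc_finite[of A n] by (cases "ilen R (loc A n) (carrier R)") auto

text \<open>Multiplication by \<open>a\<close> maps \<open>R / (B + \<mm>^l)\<close> to
  \<open>R / (A + \<mm>^n)\<close> with cokernel \<open>R / (A + (a) + \<mm>^n)\<close>. The
  exponent \<open>l\<close> is kept free so that it can be \<open>n - 1\<close> when
  \<open>a \<in> \<mm>\<close>.\<close>

lemma hloc_add_gen:
  assumes A: "ideal A R" and B: "ideal B R" and a: "a \<in> carrier R"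
    and Ba: "\<And>c. c \<in> B \<Longrightarrow> c \<otimes> a \<in> loc A n" and ma: "\<And>c. c \<in> mpow l \<Longrightarrow> c \<otimes> a \<in> loc A n"
  shows "hloc A n \<le> hloc B l + hloc (ispan R (insert a A)) n"
proof -
  have Ac: "A \<subseteq> carrier R" by (rule ideal_carrier_subset[OF A])
  have A': "ideal (ispan R (insert a A)) R" using Ac a by (intro ideal_ispan) blast
  have "ideal {c \<in> carrier R. c \<otimes> a \<in> loc A n} R"
    by (rule ideal_colon_ideal[OF oneideal loc_ideal[OF A] a])
  then have "loc B l \<subseteq> {c \<in> carrier R. c \<otimes> a \<in> loc A n}"
    unfolding loc_def[of B]
    by (rule ispan_least) (use Ba ma ideal_carrier_subset[OF B] ideal_carrier_subset[OF mpow_ideal[of l]] in blast)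
  then have "ilen R (loc A n) (carrier R) \<le> ilen R (loc B l) (carrier R) +
      ilen R (ispan R (loc A n \<union> (\<lambda>c. c \<otimes> a) ` carrier R)) (carrier R)"
    using a ideal_carrier_subset[OF loc_ideal[OF A]] ideal_carrier_subset[OF loc_ideal[OF B]]
    by (intro ilen_split_mult loc_ideal A oneideal a) auto
  also have "ispan R (loc A n \<union> (\<lambda>c. c \<otimes> a) ` carrier R) = loc (ispan R (insert a A)) n"
  proof
    have aA': "insert a A \<subseteq> loc (ispan R (insert a A)) n"
      by (rule order_trans[OF ispan_superset loc_superset(1)])
    have I: "ideal (loc (ispan R (insert a A)) n) R" by (rule loc_ideal[OF A'])
    have "loc A n \<subseteq> loc (ispan R (insert a A)) n"
      unfolding loc_def[of A]
      by (rule ispan_least[OF I], rule Un_least) (use aA' in blast, rule loc_superset(2))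
    moreover have "(\<lambda>c. c \<otimes> a) ` carrier R \<subseteq> loc (ispan R (insert a A)) n"
      using ideal.I_l_closed[OF I] aA' by blast
    ultimately show "ispan R (loc A n \<union> (\<lambda>c. c \<otimes> a) ` carrier R) \<subseteq> loc (ispan R (insert a A)) n"
      by (intro ispan_least[OF I]) blast
    let ?T = "ispan R (loc A n \<union> (\<lambda>c. c \<otimes> a) ` carrier R)"
    have T: "ideal ?T R" using ideal_carrier_subset[OF loc_ideal[OF A]] a by (intro ideal_ispan) auto
    have sT: "loc A n \<subseteq> ?T" "(\<lambda>c. c \<otimes> a) ` carrier R \<subseteq> ?T"
      using ispan_superset[of "loc A n \<union> (\<lambda>c. c \<otimes> a) ` carrier R"] by blast+
    have "\<one> \<otimes> a \<in> ?T" using sT(2) by blast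
    then have "a \<in> ?T" using a by simp
    then have "insert a A \<subseteq> ?T" using sT(1) loc_superset(1)[of A n] by blast
    then have "ispan R (insert a A) \<subseteq> ?T" by (rule ispan_least[OF T])
    then show "loc (ispan R (insert a A)) n \<subseteq> ?T"
      unfolding loc_def[of "ispan R (insert a A)"]
      using order_trans[OF loc_superset(2) sT(1)] by (rule ispan_least[OF T Un_least])
  qed
  finally show ?thesis by (simp add: hloc A B A')
qed

text \<open>If \<open>a b \<in> Q\<close> with both factors outside \<open>Q\<close>, the two larger
  ideals are \<open>Q + (a)\<close> and \<open>(Q : a)\<close>, the latter containing
  \<open>b\<close>. If \<open>Q\<close> is prime, an element \<open>x \<in> \<mm>\<close> outside
  \<open>Q\<close> yields the difference inequality, since
  \<open>x \<mm>^(k-1) \<subseteq> \<mm>^k\<close>; for \<open>Q = \<mm>\<close> the function is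
  eventually constant.\<close>

theorem hloc_growth:
  assumes A: "ideal A R"
    and D: "\<And>n P. (\<And>i. i < n \<Longrightarrow> primeideal (P i) R \<and> A \<subseteq> P i) \<Longrightarrow>
      (\<And>i. Suc i < n \<Longrightarrow> P i \<subset> P (Suc i)) \<Longrightarrow> n \<le> D"
  shows "growth D (hloc A)"
proof (rule growth_by_prime_chains[where X = "{I. ideal I R}" and is_prime = "\<lambda>P. primeideal P R"])
  show "wf {(I', I). I \<in> {I. ideal I R} \<and> I' \<in> {I. ideal I R} \<and> I < I'}" by (rule wf_ideals)
  show "A \<in> {I. ideal I R}" using A by simp
  show "n \<le> D" if "\<And>i. i < n \<Longrightarrow> P i \<in> {I. ideal I R} \<and> primeideal (P i) R \<and> A \<le> P i"
    "\<And>i. Suc i < n \<Longrightarrow> P i < P (Suc i)" for n and P :: "nat \<Rightarrow> 'a set"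
    by (rule D[of n P]) (use that in auto)
next
  fix Q assume "Q \<in> {I. ideal I R}" and np: "\<not> primeideal Q R"
  then have Q: "ideal Q R" by simp
  consider "carrier R = Q" | a b where "a \<in> carrier R" "b \<in> carrier R" "a \<otimes> b \<in> Q" "a \<notin> Q" "b \<notin> Q"
    using ideal.primeidealCD[OF Q is_cring np] by blast
  then show "(\<forall>\<^sub>F k in sequentially. hloc Q k = 0) \<or>
      (\<exists>Q1\<in>{I. ideal I R}. \<exists>Q2\<in>{I. ideal I R}. \<exists>i. Q < Q1 \<and> Q < Q2 \<and>
        (\<forall>\<^sub>F k in sequentially. hloc Q k \<le> hloc Q1 k + hloc Q2 (k - i)))"
  proof cases
    case 1
    have "loc Q k = carrier R" for k
      using loc_superset(1)[of Q k] ideal_carrier_subset[OF loc_ideal[OF Q, of k]] 1 by simp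
    then have "hloc Q k = 0" for k
      unfolding hloc_def using len_refl[of "\<lambda>I. ideal I R", OF oneideal] by (simp add: zero_enat_def)
    then show ?thesis by simp
  next
    case 2
    define Q1 where "Q1 = ispan R (insert a Q)"
    define Q2 where "Q2 = {c \<in> carrier R. c \<otimes> a \<in> Q}"
    have Q1: "ideal Q1 R" unfolding Q1_def using 2 ideal_carrier_subset[OF Q] by (intro ideal_ispan) blast
    have Q2: "ideal Q2 R" unfolding Q2_def using 2 Q by (intro ideal_colon_ideal oneideal)
    have "Q < Q1" unfolding Q1_def using ispan_superset[of "insert a Q"] 2(4) by blast
    moreover have "Q < Q2"
    proof -
      have "Q \<subseteq> Q2" unfolding Q2_def using ideal.I_r_closed[OF Q _ 2(1)] ideal_carrier_subset[OF Q] by blast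
      moreover have "b \<in> Q2" unfolding Q2_def using 2 m_comm[of a b] by simp
      ultimately show ?thesis using 2(5) by blast
    qed
    moreover have "hloc Q k \<le> hloc Q1 k + hloc Q2 (k - 0)" for k
    proof -
      have "hloc Q k \<le> hloc Q2 k + hloc Q1 k"
        unfolding Q1_def
      proof (rule hloc_add_gen[OF Q Q2 2(1)])
        show "c \<otimes> a \<in> loc Q k" if "c \<in> Q2" for c using that loc_superset(1)[of Q k] unfolding Q2_def by blast
        show "c \<otimes> a \<in> loc Q k" if "c \<in> mpow k" for c
          using ideal.I_r_closed[OF mpow_ideal that 2(1)] loc_superset(2)[of k Q] by blast
      qed
      then show ?thesis by simp
    qed
    ultimately show ?thesis using Q1 Q2
      by (intro disjI2 bexI[of _ Q1] bexI[of _ Q2] exI[of _ 0] conjI always_eventually allI) simp_all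
  qed
next
  fix Q assume "Q \<in> {I. ideal I R}" and pr: "primeideal Q R"
  then have Q: "ideal Q R" by simp
  show "\<exists>Q1\<in>{I. ideal I R}. Q < Q1 \<and> (\<forall>\<^sub>F k in sequentially. 1 \<le> k \<and> hloc Q k \<le> hloc Q (k - 1) + hloc Q1 k)"
  proof (cases "\<mm> \<subseteq> Q")
    case True
    have "Q = \<mm>"
      using maximalideal.I_maximal[OF mx Q True ideal_carrier_subset[OF Q]] primeideal.I_notcarr[OF pr] by simp
    have loc: "loc \<mm> n = \<mm>" if "1 \<le> n" for n
    proof -
      have "mpow n \<subseteq> \<mm>" using ideal_pow_antimono[OF m_ideal that] ideal_pow_1[OF m_ideal] by simp
      then show ?thesis unfolding loc_def using ispan_id[OF m_ideal] by (simp add: Un_absorb2)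
    qed
    \<comment> \<open>At \<open>k = 1\<close> the inequality fails, because
      \<open>loc \<mm> 0\<close> is the whole ring and has colength 0; the colength is constant from
      exponent 1 on.\<close>
    have "hloc Q k \<le> hloc Q (k - 1) + hloc (carrier R) k" if "2 \<le> k" for k
      unfolding hloc_def \<open>Q = \<mm>\<close> using loc[of k] loc[of "k - 1"] that by simp
    then have "\<forall>\<^sub>F k in sequentially. 1 \<le> k \<and> hloc Q k \<le> hloc Q (k - 1) + hloc (carrier R) k"
      unfolding eventually_sequentially by (intro exI[of _ 2]) simp
    moreover have "Q < carrier R"
      using ideal_carrier_subset[OF Q] primeideal.I_notcarr[OF pr] by blast
    ultimately show ?thesis using oneideal by (intro bexI[of _ "carrier R"]) auto
  next
    case False
    then obtain x where x: "x \<in> \<mm>" "x \<notin> Q" by blast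
    have xc: "x \<in> carrier R" using ideal.Icarr[OF m_ideal x(1)] .
    define Q1 where "Q1 = ispan R (insert x Q)"
    have Q1: "ideal Q1 R" unfolding Q1_def using xc ideal_carrier_subset[OF Q] by (intro ideal_ispan) blast
    have "Q < Q1" unfolding Q1_def using ispan_superset[of "insert x Q"] x(2) by blast
    moreover have "hloc Q k \<le> hloc Q (k - 1) + hloc Q1 k" if "1 \<le> k" for k
      unfolding Q1_def
    proof (rule hloc_add_gen[OF Q Q xc])
      show "c \<otimes> x \<in> loc Q k" if "c \<in> Q" for c
        using ideal.I_r_closed[OF Q that xc] loc_superset(1)[of Q k] by blast
      show "c \<otimes> x \<in> loc Q k" if "c \<in> mpow (k - 1)" for c
      proof -
        have "c \<otimes> x \<in> mpow (Suc (k - 1))" unfolding ideal_pow_Suc by (intro ideal_prod.prod that x)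
        then show ?thesis using \<open>1 \<le> k\<close> loc_superset(2)[of k Q] by auto
      qed
    qed
    then have "\<forall>\<^sub>F k in sequentially. 1 \<le> k \<and> hloc Q k \<le> hloc Q (k - 1) + hloc Q1 k"
      unfolding eventually_sequentially by (intro exI[of _ 1]) simp
    ultimately show ?thesis using Q1 by blast
  qed
qed

end

subsection \<open>Homogeneous ideals of the fiber cone\<close>

text \<open>A homogeneous ideal of the fiber cone of \<open>J\<close> is a family \<open>Q\<close> of ideals with
  \<open>\<mm> J\<^sup>k \<subseteq> Q k \<subseteq> J\<^sup>k\<close> and \<open>J Q k \<subseteq> Q (k + 1)\<close>.\<close>

locale fiber = noetherian_cring_max +
  fixes J assumes J: "ideal J R"
begin

interpretation reg: module R "reg_module R"
  by (rule reg_module_is_module)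

abbreviation jp where "jp k \<equiv> ideal_pow R J k"

definition fam :: "(nat \<Rightarrow> 'a set) set" where
  "fam = {Q. (\<forall>k. ideal (Q k) R \<and> ideal_prod R \<mm> (jp k) \<subseteq> Q k \<and> Q k \<subseteq> jp k) \<and>
     (\<forall>k. \<forall>a\<in>J. \<forall>x\<in>Q k. a \<otimes> x \<in> Q (Suc k))}"

text \<open>Primality tested on homogeneous elements; \<open>cone_ideal_prime\<close> shows that it
  already gives a prime ideal of the fiber cone. The condition in degree 0 expresses
  properness.\<close>

definition hprime :: "(nat \<Rightarrow> 'a set) \<Rightarrow> bool" where
  "hprime Q \<longleftrightarrow> \<one> \<notin> Q 0 \<and>
     (\<forall>i j a b. a \<in> jp i \<longrightarrow> b \<in> jp j \<longrightarrow> a \<otimes> b \<in> Q (i + j) \<longrightarrow> a \<in> Q i \<or> b \<in> Q j)"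

lemma jp_ideal: "ideal (jp k) R"
  by (rule ideal_pow_ideal[OF J])

lemma jp_carr: "x \<in> jp k \<Longrightarrow> x \<in> carrier R"
  by (rule ideal.Icarr[OF jp_ideal])

lemma famI:
  assumes "\<And>k. ideal (Q k) R" "\<And>k. ideal_prod R \<mm> (jp k) \<subseteq> Q k" "\<And>k. Q k \<subseteq> jp k"
    and "\<And>k a x. a \<in> J \<Longrightarrow> x \<in> Q k \<Longrightarrow> a \<otimes> x \<in> Q (Suc k)"
  shows "Q \<in> fam"
  unfolding fam_def using assms by simp

lemma famD:
  assumes "Q \<in> fam"
  shows "ideal (Q k) R" "ideal_prod R \<mm> (jp k) \<subseteq> Q k" "Q k \<subseteq> jp k"
    and "a \<in> J \<Longrightarrow> x \<in> Q k \<Longrightarrow> a \<otimes> x \<in> Q (Suc k)"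
  using assms unfolding fam_def by simp_all

lemma fam_mult:
  assumes Q: "Q \<in> fam" and a: "a \<in> jp i" and x: "x \<in> Q k"
  shows "a \<otimes> x \<in> Q (i + k)"
  using a
proof (induction i arbitrary: a)
  case 0
  then show ?case using ideal.I_l_closed[OF famD(1)[OF Q] x] by simp
next
  case (Suc i)
  have xc: "x \<in> carrier R" by (rule ideal.Icarr[OF famD(1)[OF Q] x])
  have T: "ideal {c \<in> carrier R. c \<otimes> x \<in> Q (Suc i + k)} R"
    by (rule ideal_colon_ideal[OF oneideal famD(1)[OF Q] xc])
  have "ideal_prod R J (jp i) \<subseteq> {c \<in> carrier R. c \<otimes> x \<in> Q (Suc i + k)}"
  proof
    fix a assume "a \<in> ideal_prod R J (jp i)"
    then show "a \<in> {c \<in> carrier R. c \<otimes> x \<in> Q (Suc i + k)}"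
    proof induction
      case (prod b c)
      have bc: "b \<in> carrier R" "c \<in> carrier R" using ideal.Icarr[OF J prod(1)] jp_carr[OF prod(2)] .
      have "b \<otimes> (c \<otimes> x) \<in> Q (Suc (i + k))" by (rule famD(4)[OF Q prod(1) Suc.IH[OF prod(2)]])
      then show ?case using bc xc by (simp add: m_assoc)
    next
      case (sum s t)
      then show ?case by (intro additive_subgroup.a_closed[OF ideal.axioms(1)[OF T]])
    qed
  qed
  then show ?case using Suc.prems unfolding ideal_pow_Suc'[OF J] by blast
qed

lemma fam_mult':
  assumes Q: "Q \<in> fam" and a: "a \<in> jp i" and x: "x \<in> Q k"
  shows "x \<otimes> a \<in> Q (k + i)"
  using fam_mult[OF assms] m_comm[OF jp_carr[OF a] ideal.Icarr[OF famD(1)[OF Q] x]]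
  by (simp add: add.commute)

text \<open>The family of the zero ideal of the fiber cone, hence the least member of
  \<open>fam\<close>. Its function \<open>hQ bottom\<close> is the Hilbert function of the fiber
  cone.\<close>

definition bottom :: "nat \<Rightarrow> 'a set" where
  "bottom k = ideal_prod R \<mm> (jp k)"

lemma bottom_ideal: "ideal (bottom k) R"
  unfolding bottom_def by (rule ideal_prod_is_ideal[OF m_ideal jp_ideal])

lemma bottom_mult:
  assumes a: "a \<in> jp i" and x: "x \<in> bottom k"
  shows "x \<otimes> a \<in> bottom (k + i)"
proof -
  have ac: "a \<in> carrier R" by (rule jp_carr[OF a])
  have T: "ideal {c \<in> carrier R. c \<otimes> a \<in> bottom (k + i)} R"
    by (rule ideal_colon_ideal[OF oneideal bottom_ideal ac])
  from x[unfolded bottom_def] have "x \<in> {c \<in> carrier R. c \<otimes> a \<in> bottom (k + i)}"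
  proof induction
    case (prod b c)
    have bc: "b \<in> carrier R" "c \<in> carrier R" using ideal.Icarr[OF m_ideal prod(1)] jp_carr[OF prod(2)] .
    have "b \<otimes> (c \<otimes> a) \<in> bottom (k + i)"
      unfolding bottom_def by (intro ideal_prod.prod prod ideal_pow_mult_in[OF J] a)
    then show ?case using bc ac by (simp add: m_assoc)
  next
    case (sum s t)
    then show ?case by (intro additive_subgroup.a_closed[OF ideal.axioms(1)[OF T]])
  qed
  then show ?thesis by blast
qed

lemma bottom_fam: "bottom \<in> fam"
proof (rule famI[OF bottom_ideal])
  show "ideal_prod R \<mm> (jp k) \<subseteq> bottom k" for k unfolding bottom_def ..
  show "bottom k \<subseteq> jp k" for k unfolding bottom_def using ideal_prod_inter[OF m_ideal jp_ideal] by blast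
  show "a \<otimes> x \<in> bottom (Suc k)" if "a \<in> J" "x \<in> bottom k" for k a x
    using bottom_mult[of a "Suc 0" x k] that ideal_pow_1[OF J] m_comm[of a x]
      ideal.Icarr[OF J that(1)] ideal.Icarr[OF bottom_ideal that(2)] by simp
qed

lemma ideal_prod_subset:
  assumes "ideal L R" "\<And>a x. a \<in> I \<Longrightarrow> x \<in> N \<Longrightarrow> a \<otimes> x \<in> L"
  shows "ideal_prod R I N \<subseteq> L"
  using reg.ideal_smult_subset[of L I N] assms
  by (simp add: ideal_smult_reg_module submodule_reg_module_iff)

text \<open>The ring, generated by \<open>\<one>\<close>, with the family \<open>Q\<close> divided
  out: row 0 of the filtration is \<open>J^k\<close>, and row 1 is \<open>Q k\<close> because
  \<open>\<mm> J^k \<subseteq> Q k\<close>. Hence the length of \<open>J^k / Q k\<close> counts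
  standard monomials of first degree 0.\<close>

lemma fam_bigraded:
  assumes Q: "Q \<in> fam"
    and z1: "\<mm> = genideal R (z ` {..<p})" and zc: "\<And>i. i < q \<Longrightarrow> z i \<in> carrier R" and pq: "p \<le> q"
    and z2: "J = genideal R (z ` {p..<q})"
  shows "bigraded R (reg_module R) \<mm> z {..<p} {p..<q} {0} (\<lambda>_. \<one>) Q"
    and "bigraded.F R (reg_module R) z {..<p} {p..<q} {0} (\<lambda>_. \<one>) Q 0 k = jp k"
    and "bigraded.F R (reg_module R) z {..<p} {p..<q} {0} (\<lambda>_. \<one>) Q 1 k = Q k"
proof -
  have zJ: "z i \<in> J" if "i \<in> {p..<q}" for i
  proof -
    have "z ` {p..<q} \<subseteq> genideal R (z ` {p..<q})" by (rule genideal_self) (use zc in auto)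
    then show ?thesis using that z2 by blast
  qed
  have zQ: "z i \<otimes> x \<in> Q (Suc k)" if i: "i \<in> {p..<q}" and x: "x \<in> Q k" for i x k
    by (rule famD(4)[OF Q zJ[OF i] x])
  show *: "bigraded R (reg_module R) \<mm> z {..<p} {p..<q} {0} (\<lambda>_. \<one>) Q"
  proof (intro bigraded.intro bigraded_axioms.intro reg_module_is_module mx z1)
    show "z i \<in> carrier R" if "i \<in> {..<p} \<union> {p..<q}" for i using that zc pq by auto
    show "submodule (Q k) R (reg_module R)" for k
      by (rule submodule_reg_module_iff[THEN iffD2, OF famD(1)[OF Q]])
    show "z i \<odot>\<^bsub>reg_module R\<^esub> x \<in> Q (Suc k)" if "i \<in> {p..<q}" "x \<in> Q k" for i x k
      using zQ[OF that] by simp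
  qed auto
  then interpret B: bigraded R "reg_module R" \<mm> z "{..<p}" "{p..<q}" "{0}" "\<lambda>_. \<one>" Q .
  have idF: "ideal (B.F j k) R" for j k by (rule submodule_reg_module_iff[THEN iffD1, OF B.sub_F])
  have F0: "B.F 0 k = jp k" for k
  proof (induction k)
    case 0
    have "\<one> \<in> B.F 0 0" unfolding B.F_0_0 by (intro reg.span_base) simp
    then show ?case using ideal.one_imp_carrier[OF idF] by simp
  next
    case (Suc k)
    show ?case
    proof
      show "B.F 0 (Suc k) \<subseteq> jp (Suc k)"
        unfolding B.F_Suc2 Suc
      proof (rule ispan_least[OF jp_ideal], rule Un_least[OF famD(3)[OF Q]], clarify)
        fix i x assume "i \<in> {p..<q}" "x \<in> jp k"
        then show "z i \<odot>\<^bsub>reg_module R\<^esub> x \<in> jp (Suc k)"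
          unfolding ideal_pow_Suc'[OF J] reg_module_simps by (intro ideal_prod.prod zJ)
      qed
      show "jp (Suc k) \<subseteq> B.F 0 (Suc k)"
        unfolding ideal_pow_Suc'[OF J]
      proof (rule ideal_prod_subset[OF idF])
        fix a x assume a: "a \<in> J" and x: "x \<in> jp k"
        have "a \<odot>\<^bsub>reg_module R\<^esub> x \<in> B.F 0 (Suc k)"
        proof (rule reg.genideal_smult_in[OF B.sub_F])
          show "a \<in> genideal R (z ` {p..<q})" using a z2 by simp
          show "x \<in> carrier (reg_module R)" using jp_carr[OF x] by simp
          show "z ` {p..<q} \<subseteq> carrier R" using zc by auto
          show "w \<odot>\<^bsub>reg_module R\<^esub> x \<in> B.F 0 (Suc k)" if "w \<in> z ` {p..<q}" for w
            using that B.z_F2[of _ x 0 k] x Suc by auto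
        qed
        then show "a \<otimes> x \<in> B.F 0 (Suc k)" by simp
      qed
    qed
  qed
  show "B.F 0 k = jp k" by (rule F0)
  have "Q k \<union> ideal_prod R \<mm> (jp k) = Q k" using famD(2)[OF Q, of k] by blast
  then show "B.F 1 k = Q k"
    unfolding B.F_eq[of 1 k] F0 ideal_smult_reg_module
    using ideal_pow_1[OF m_ideal] ispan_id[OF famD(1)[OF Q]] by simp
qed

lemma fam_generators:
  "\<exists>(z :: nat \<Rightarrow> 'a) p q. \<mm> = genideal R (z ` {..<p}) \<and> p \<le> q \<and>
    J = genideal R (z ` {p..<q}) \<and> (\<forall>i<q. z i \<in> carrier R)"
proof -
  obtain p and x :: "nat \<Rightarrow> 'a" where x: "\<mm> = genideal R (x ` {..<p})" "\<And>i. i < p \<Longrightarrow> x i \<in> carrier R"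
    using ideal_generators[OF m_ideal] by metis
  obtain l and y :: "nat \<Rightarrow> 'a" where y: "J = genideal R (y ` {..<l})" "\<And>i. i < l \<Longrightarrow> y i \<in> carrier R"
    using ideal_generators[OF J] by metis
  define z where "z i = (if i < p then x i else y (i - p))" for i
  have "z ` {..<p} = x ` {..<p}" unfolding z_def by auto
  moreover have "z ` {p..<p + l} = y ` {..<l}"
  proof
    show "z ` {p..<p + l} \<subseteq> y ` {..<l}" unfolding z_def by auto
    show "y ` {..<l} \<subseteq> z ` {p..<p + l}"
    proof
      fix w assume "w \<in> y ` {..<l}"
      then obtain i where "i < l" "w = y i" by blast
      then have "p + i \<in> {p..<p + l}" "w = z (p + i)" unfolding z_def by auto
      then show "w \<in> z ` {p..<p + l}" by blast
    qed
  qed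
  moreover have "z i \<in> carrier R" if "i < p + l" for i
    using that x(2) y(2) unfolding z_def by simp
  ultimately show ?thesis
    using x(1) y(1) by (intro exI[of _ z] exI[of _ p] exI[of _ "p + l"]) simp
qed

lemma fam_finite:
  assumes Q: "Q \<in> fam"
  shows "ilen R (Q k) (jp k) \<noteq> \<infinity>"
proof -
  obtain z :: "nat \<Rightarrow> 'a" and p q where z: "\<mm> = genideal R (z ` {..<p})" "p \<le> q"
    "J = genideal R (z ` {p..<q})" "\<And>i. i < q \<Longrightarrow> z i \<in> carrier R" using fam_generators by blast
  note b = fam_bigraded[OF Q z(1,4,2,3)]
  interpret B: bigraded R "reg_module R" \<mm> z "{..<p}" "{p..<q}" "{0}" "\<lambda>_. \<one>" Q by (rule b(1))
  show ?thesis using B.len_F[of 0 k] b(2,3) unfolding reg_sub by simp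
qed

definition hQ :: "(nat \<Rightarrow> 'a set) \<Rightarrow> nat \<Rightarrow> nat" where
  "hQ Q k = the_enat (ilen R (Q k) (jp k))"

lemma hQ: "Q \<in> fam \<Longrightarrow> ilen R (Q k) (jp k) = enat (hQ Q k)"
  unfolding hQ_def using fam_finite[of Q k] by (cases "ilen R (Q k) (jp k)") auto

lemma hQ_eq_imp_eq:
  assumes Q: "Q \<in> fam" "Q' \<in> fam" and le: "Q k \<subseteq> Q' k" and eq: "hQ Q k = hQ Q' k"
  shows "Q k = Q' k"
proof -
  have "ilen R (Q k) (jp k) = ilen R (Q k) (Q' k) + ilen R (Q' k) (jp k)"
    by (rule ilen_add[OF famD(1)[OF Q(1)] famD(1)[OF Q(2)] jp_ideal le famD(3)[OF Q(2)]])
  then have "ilen R (Q k) (Q' k) = 0"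
    unfolding hQ[OF Q(1)] hQ[OF Q(2)] eq by (cases "ilen R (Q k) (Q' k)") (auto simp: zero_enat_def)
  then show ?thesis
    using len_zero_imp_eq[of "\<lambda>I. ideal I R" "Q k" "Q' k"] famD(1)[OF Q(1)] famD(1)[OF Q(2)] le by simp
qed

text \<open>The sets of nonstandard monomials grow strictly along strictly increasing families, so the
  ascending chain condition for homogeneous ideals reduces to Dickson's lemma.\<close>

lemma wf_fam: "wf {(Q', Q). Q \<in> fam \<and> Q' \<in> fam \<and> Q < Q'}"
proof -
  obtain z :: "nat \<Rightarrow> 'a" and p q where z: "\<mm> = genideal R (z ` {..<p})" "p \<le> q"
    "J = genideal R (z ` {p..<q})" "\<And>i. i < q \<Longrightarrow> z i \<in> carrier R" using fam_generators by blast
  let ?V = "{..<p} \<union> {p..<q}"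
  \<comment> \<open>Taken with respect to one fixed system of generators \<open>z\<close>, so that
    the sets for different families are comparable.\<close>
  define N where "N Q = bigraded.nonstd R (reg_module R) z {..<p} {p..<q} {0} (\<lambda>_. \<one>) Q 0" for Q
  have h: "hQ Q k = hcount ?V {..<p} (N Q) 0 k" if Q: "Q \<in> fam" for Q k
  proof -
    note b = fam_bigraded[OF Q z(1,4,2,3)]
    interpret B: bigraded R "reg_module R" \<mm> z "{..<p}" "{p..<q}" "{0}" "\<lambda>_. \<one>" Q by (rule b(1))
    have "enat (hQ Q k) = enat (B.H 0 k)"
      using B.len_F[of 0 k] b(2,3) unfolding reg_sub hQ[OF Q, symmetric] by simp
    then show ?thesis unfolding B.H_def N_def by simp
  qed
  have mono: "N Q \<subseteq> N Q'" if Q: "Q \<in> fam" "Q' \<in> fam" and le: "Q \<le> Q'" for Q Q'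
  proof -
    interpret B: bigraded R "reg_module R" \<mm> z "{..<p}" "{p..<q}" "{0}" "\<lambda>_. \<one>" Q
      by (rule fam_bigraded(1)[OF Q(1) z(1,4,2,3)])
    interpret B': bigraded R "reg_module R" \<mm> z "{..<p}" "{p..<q}" "{0}" "\<lambda>_. \<one>" Q'
      by (rule fam_bigraded(1)[OF Q(2) z(1,4,2,3)])
    \<comment> \<open>The monomials and their order depend only on the generators; the family enters
      through \<open>C\<close> alone, and enlarging it enlarges every \<open>F j k\<close>.\<close>
    have "B.F j k \<subseteq> B'.F j k" for j k
      unfolding B.F_def B'.F_def using le_funD[OF le, of k] by (intro reg.span_mono) blast
    then have "ispan R (B.F j k \<union> B.below x) \<subseteq> ispan R (B'.F j k \<union> B.below x)" for j k x
      by (intro reg.span_mono) blast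
    then show ?thesis unfolding N_def B.nonstd_def B'.nonstd_def by blast
  qed
  have mon: "monomial_ideal ?V (N Q)" if Q: "Q \<in> fam" for Q
  proof -
    interpret B: bigraded R "reg_module R" \<mm> z "{..<p}" "{p..<q}" "{0}" "\<lambda>_. \<one>" Q
      by (rule fam_bigraded(1)[OF Q z(1,4,2,3)])
    show ?thesis unfolding N_def by (rule B.monomial_ideal_nonstd) simp
  qed
  have wfV: "wf {(U', U). monomial_ideal ?V U \<and> U \<inter> exps ?V \<subset> U' \<inter> exps ?V}"
    by (rule wf_monomial_ideals) simp
  show ?thesis
  proof (rule wf_subset[OF wf_inv_image[OF wfV, of N]])
    show "{(Q', Q). Q \<in> fam \<and> Q' \<in> fam \<and> Q < Q'} \<subseteq>
        inv_image {(U', U). monomial_ideal ?V U \<and> U \<inter> exps ?V \<subset> U' \<inter> exps ?V} N"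
    proof clarify
      fix Q' Q assume Q: "Q \<in> fam" "Q' \<in> fam" and lt: "Q < Q'"
      have sub: "N Q \<subseteq> N Q'" using mono[OF Q] lt by (simp add: less_imp_le)
      have "N Q \<inter> exps ?V \<noteq> N Q' \<inter> exps ?V"
      proof
        assume "N Q \<inter> exps ?V = N Q' \<inter> exps ?V"
        then have "hQ Q k = hQ Q' k" for k unfolding h[OF Q(1)] h[OF Q(2)] by (rule hcount_cong)
        then have "Q k = Q' k" for k
          using hQ_eq_imp_eq[OF Q] le_funD[OF less_imp_le[OF lt]] by blast
        then have "Q = Q'" by blast
        then show False using lt by simp
      qed
      then have "N Q \<inter> exps ?V \<subset> N Q' \<inter> exps ?V" using sub by blast
      then show "(Q', Q) \<in> inv_image {(U', U). monomial_ideal ?V U \<and> U \<inter> exps ?V \<subset> U' \<inter> exps ?V} N"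
        using mon[OF Q(1)] by (simp add: inv_image_def)
    qed
  qed
qed

text \<open>For a homogeneous element \<open>a\<close> of degree \<open>i\<close>,
  \<open>fam_add\<close> is the ideal \<open>Q + (a)\<close> of the fiber cone and
  \<open>fam_colon\<close> the ideal \<open>(Q : a)\<close>, written out degree by degree.\<close>

definition fam_add :: "(nat \<Rightarrow> 'a set) \<Rightarrow> nat \<Rightarrow> 'a \<Rightarrow> nat \<Rightarrow> 'a set" where
  "fam_add Q i a k = (if k < i then Q k else ispan R (Q k \<union> (\<lambda>c. c \<otimes> a) ` jp (k - i)))"

definition fam_colon :: "(nat \<Rightarrow> 'a set) \<Rightarrow> nat \<Rightarrow> 'a \<Rightarrow> nat \<Rightarrow> 'a set" where
  "fam_colon Q i a k = {c \<in> jp k. c \<otimes> a \<in> Q (k + i)}"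

lemma jp_smult_subset:
  assumes a: "a \<in> jp i" and "i \<le> k"
  shows "(\<lambda>c. c \<otimes> a) ` jp (k - i) \<subseteq> jp k"
  using ideal_pow_mult_in[OF J _ a, of _ "k - i"] assms(2) by auto

lemma fam_add_superset: "Q \<le> fam_add Q i a"
  unfolding fam_add_def le_fun_def
proof
  fix k
  show "Q k \<subseteq> (if k < i then Q k else ispan R (Q k \<union> (\<lambda>c. c \<otimes> a) ` jp (k - i)))"
    using ispan_superset[of "Q k \<union> (\<lambda>c. c \<otimes> a) ` jp (k - i)"] by simp
qed

lemma fam_add_fam:
  assumes Q: "Q \<in> fam" and a: "a \<in> jp i"
  shows "fam_add Q i a \<in> fam"
proof (rule famI)
  have sub: "Q k \<union> (\<lambda>c. c \<otimes> a) ` jp (k - i) \<subseteq> jp k" if "i \<le> k" for k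
    by (rule Un_least[OF famD(3)[OF Q] jp_smult_subset[OF a that]])
  have id: "ideal (ispan R (Q k \<union> (\<lambda>c. c \<otimes> a) ` jp (k - i))) R" if "i \<le> k" for k
    by (rule ideal_ispan[OF order_trans[OF sub[OF that] ideal_carrier_subset[OF jp_ideal]]])
  show "ideal (fam_add Q i a k) R" for k
    unfolding fam_add_def using id[of k] famD(1)[OF Q] by simp
  show "ideal_prod R \<mm> (jp k) \<subseteq> fam_add Q i a k" for k
    using famD(2)[OF Q, of k] le_funD[OF fam_add_superset[of Q i a], of k] by blast
  show "fam_add Q i a k \<subseteq> jp k" for k
    unfolding fam_add_def using ispan_least[OF jp_ideal sub[of k]] famD(3)[OF Q] by simp
  fix k b x assume b: "b \<in> J" and x: "x \<in> fam_add Q i a k"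
  have bc: "b \<in> carrier R" by (rule ideal.Icarr[OF J b])
  show "b \<otimes> x \<in> fam_add Q i a (Suc k)"
  proof (cases "k < i")
    case True
    then have "x \<in> Q k" using x by (simp add: fam_add_def)
    then have "b \<otimes> x \<in> Q (Suc k)" by (rule famD(4)[OF Q b])
    then show ?thesis using le_funD[OF fam_add_superset[of Q i a], of "Suc k"] by blast
  next
    case False
    then have ik: "i \<le> k" by simp
    have eq: "fam_add Q i a (Suc k) = ispan R (Q (Suc k) \<union> (\<lambda>c. c \<otimes> a) ` jp (Suc k - i))"
      using ik by (simp add: fam_add_def)
    show ?thesis unfolding eq
    proof (rule ispan_mult_in[OF id bc])
      show "x \<in> ispan R (Q k \<union> (\<lambda>c. c \<otimes> a) ` jp (k - i))" using x ik by (simp add: fam_add_def)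
      show "Q k \<union> (\<lambda>c. c \<otimes> a) ` jp (k - i) \<subseteq> carrier R"
        by (rule order_trans[OF sub[OF ik] ideal_carrier_subset[OF jp_ideal]])
      fix y assume "y \<in> Q k \<union> (\<lambda>c. c \<otimes> a) ` jp (k - i)"
      then show "b \<otimes> y \<in> ispan R (Q (Suc k) \<union> (\<lambda>c. c \<otimes> a) ` jp (Suc k - i))"
      proof
        assume "y \<in> Q k"
        then have "b \<otimes> y \<in> Q (Suc k)" by (rule famD(4)[OF Q b])
        then show ?thesis by (intro reg.span_base) simp
      next
        assume "y \<in> (\<lambda>c. c \<otimes> a) ` jp (k - i)"
        then obtain c where c: "c \<in> jp (k - i)" "y = c \<otimes> a" by blast
        have "b \<otimes> c \<in> jp (Suc (k - i))" unfolding ideal_pow_Suc'[OF J] by (intro ideal_prod.prod b c)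
        then have "b \<otimes> c \<in> jp (Suc k - i)" using ik by (simp add: Suc_diff_le)
        moreover have "b \<otimes> y = (b \<otimes> c) \<otimes> a"
          unfolding c(2) using bc jp_carr[OF c(1)] jp_carr[OF a] by (simp add: m_assoc)
        ultimately show ?thesis by (intro reg.span_base) simp
      qed
    qed (use ik in simp)
  qed
qed

lemma fam_colon_fam:
  assumes Q: "Q \<in> fam" and a: "a \<in> jp i"
  shows "fam_colon Q i a \<in> fam"
proof (rule famI)
  have ac: "a \<in> carrier R" by (rule jp_carr[OF a])
  show "ideal (fam_colon Q i a k) R" for k
    unfolding fam_colon_def by (rule ideal_colon_ideal[OF jp_ideal famD(1)[OF Q] ac])
  show "ideal_prod R \<mm> (jp k) \<subseteq> fam_colon Q i a k" for k
  proof
    fix x assume "x \<in> ideal_prod R \<mm> (jp k)"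
    then have "x \<in> bottom k" unfolding bottom_def .
    from bottom_mult[OF a this] have "x \<otimes> a \<in> Q (k + i)"
      using famD(2)[OF Q] unfolding bottom_def by blast
    moreover have "x \<in> jp k" using famD(3)[OF bottom_fam] \<open>x \<in> bottom k\<close> by blast
    ultimately show "x \<in> fam_colon Q i a k" unfolding fam_colon_def by simp
  qed
  show "fam_colon Q i a k \<subseteq> jp k" for k unfolding fam_colon_def by blast
  fix k b x assume b: "b \<in> J" and x: "x \<in> fam_colon Q i a k"
  then have x: "x \<in> jp k" "x \<otimes> a \<in> Q (k + i)" unfolding fam_colon_def by simp_all
  have "b \<otimes> (x \<otimes> a) \<in> Q (Suc (k + i))" by (rule famD(4)[OF Q b x(2)])
  then have "(b \<otimes> x) \<otimes> a \<in> Q (Suc k + i)"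
    using ideal.Icarr[OF J b] jp_carr[OF x(1)] ac by (simp add: m_assoc)
  moreover have "b \<otimes> x \<in> jp (Suc k)" unfolding ideal_pow_Suc'[OF J] by (intro ideal_prod.prod b x)
  ultimately show "b \<otimes> x \<in> fam_colon Q i a (Suc k)" unfolding fam_colon_def by simp
qed

lemma fam_colon_superset:
  assumes Q: "Q \<in> fam" and a: "a \<in> jp i"
  shows "Q \<le> fam_colon Q i a"
  unfolding fam_colon_def le_fun_def using fam_mult'[OF Q a] famD(3)[OF Q] by blast

text \<open>The homogeneous analogue of \<open>hloc_add_gen\<close>: multiplication by
  \<open>a\<close> sends \<open>J^(k-i)\<close> into \<open>J^k\<close>, so the degree
  \<open>i\<close> of \<open>a\<close> appears as a shift.\<close>

lemma hQ_add:
  assumes Q: "Q \<in> fam" and B: "B \<in> fam" and a: "a \<in> jp i" and ik: "i \<le> k"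
    and BQ: "\<And>c. c \<in> B (k - i) \<Longrightarrow> c \<otimes> a \<in> Q k"
  shows "hQ Q k \<le> hQ B (k - i) + hQ (fam_add Q i a) k"
proof -
  have "ilen R (Q k) (jp k) \<le> ilen R (B (k - i)) (jp (k - i)) +
      ilen R (ispan R (Q k \<union> (\<lambda>c. c \<otimes> a) ` jp (k - i))) (jp k)"
    by (rule ilen_split_mult[OF famD(1)[OF Q] jp_ideal jp_ideal jp_carr[OF a] famD(3)[OF Q] famD(3)[OF B] BQ])
       (use jp_smult_subset[OF a ik] in auto)
  also have "ispan R (Q k \<union> (\<lambda>c. c \<otimes> a) ` jp (k - i)) = fam_add Q i a k"
    using ik by (simp add: fam_add_def)
  finally show ?thesis by (simp add: hQ Q B fam_add_fam[OF Q a])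
qed

lemma fam_eq_jp_if_one:
  assumes Q: "Q \<in> fam" and "\<one> \<in> Q 0"
  shows "Q k = jp k"
proof
  show "jp k \<subseteq> Q k"
  proof
    fix x assume x: "x \<in> jp k"
    from fam_mult[OF Q x assms(2)] show "x \<in> Q k" using jp_carr[OF x] by simp
  qed
qed (rule famD(3)[OF Q])

text \<open>\<open>J\<close> generates all positive degrees of the fiber cone, so a family that
  contains \<open>J\<close> in degree 1 is everything from there on.\<close>

lemma fam_eq_jp_if_J:
  assumes Q: "Q \<in> fam" and "Q (Suc 0) = J"
  shows "Q (Suc k) = jp (Suc k)"
proof
  show "jp (Suc k) \<subseteq> Q (Suc k)"
    unfolding ideal_pow_Suc
  proof (rule ideal_prod_subset[OF famD(1)[OF Q]])
    fix a x assume a: "a \<in> jp k" and x: "x \<in> J"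
    show "a \<otimes> x \<in> Q (Suc k)" using fam_mult[OF Q a, of x "Suc 0"] x assms(2) by simp
  qed
qed (rule famD(3)[OF Q])

lemma hQ_eq_0: "Q k = jp k \<Longrightarrow> hQ Q k = 0"
  unfolding hQ_def using len_refl[of "\<lambda>I. ideal I R", OF jp_ideal[of k]] by (simp add: zero_enat_def)

text \<open>Families with \<open>Q (Suc 0) = J\<close> are sorted with the nonprime ones: their
  Hilbert function vanishes in positive degrees. The only prime lost in this way is the maximal
  homogeneous one, and leaving it out is what brings the order down from the dimension plus one to
  the dimension.\<close>

theorem hQ_growth:
  assumes Q: "Q \<in> fam"
    and D: "\<And>n P. (\<And>i. i < n \<Longrightarrow> P i \<in> fam \<and> hprime (P i) \<and> P i (Suc 0) \<noteq> J \<and> Q \<le> P i) \<Longrightarrow>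
      (\<And>i. Suc i < n \<Longrightarrow> P i < P (Suc i)) \<Longrightarrow> n \<le> D"
  shows "growth D (hQ Q)"
proof (rule growth_by_prime_chains[where X = fam and is_prime = "\<lambda>P. hprime P \<and> P (Suc 0) \<noteq> J", OF wf_fam])
  show "n \<le> D" if "\<And>i. i < n \<Longrightarrow> P i \<in> fam \<and> (hprime (P i) \<and> P i (Suc 0) \<noteq> J) \<and> Q \<le> P i"
    "\<And>i. Suc i < n \<Longrightarrow> P i < P (Suc i)" for n P
    by (rule D[of n P]) (use that in auto)
next
  fix Q assume Q: "Q \<in> fam" and np: "\<not> (hprime Q \<and> Q (Suc 0) \<noteq> J)"
  consider "\<one> \<in> Q 0" | "Q (Suc 0) = J"
    | i j a b where "a \<in> jp i" "b \<in> jp j" "a \<otimes> b \<in> Q (i + j)" "a \<notin> Q i" "b \<notin> Q j"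
    using np unfolding hprime_def by blast
  then show "(\<forall>\<^sub>F k in sequentially. hQ Q k = 0) \<or>
      (\<exists>Q1\<in>fam. \<exists>Q2\<in>fam. \<exists>i. Q < Q1 \<and> Q < Q2 \<and> (\<forall>\<^sub>F k in sequentially. hQ Q k \<le> hQ Q1 k + hQ Q2 (k - i)))"
  proof cases
    case 1
    then have "hQ Q k = 0" for k by (intro hQ_eq_0 fam_eq_jp_if_one[OF Q])
    then show ?thesis by simp
  next
    case 2
    have "hQ Q k = 0" if "1 \<le> k" for k
      using fam_eq_jp_if_J[OF Q 2, of "k - 1"] that by (intro hQ_eq_0) simp
    then show ?thesis unfolding eventually_sequentially by blast
  next
    case (3 i j a b)
    have ac: "a \<in> carrier R" "b \<in> carrier R" using jp_carr 3 by blast+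
    \<comment> \<open>The witness of strictness is \<open>a\<close> in degree \<open>i\<close> for
      \<open>fam_add\<close>, and \<open>b\<close> in degree \<open>j\<close> for
      \<open>fam_colon\<close>.\<close>
    have "a \<in> fam_add Q i a i"
    proof -
      have "\<one> \<otimes> a \<in> (\<lambda>c. c \<otimes> a) ` jp (i - i)" by simp
      then have "\<one> \<otimes> a \<in> fam_add Q i a i" unfolding fam_add_def by (simp add: reg.span_base)
      then show ?thesis using ac by simp
    qed
    then have ne1: "fam_add Q i a \<noteq> Q" using 3(4) by metis
    have "b \<in> fam_colon Q i a j" unfolding fam_colon_def using 3 m_comm[OF ac] by (simp add: add.commute)
    then have ne2: "fam_colon Q i a \<noteq> Q" using 3(5) by metis
    have lt: "Q < fam_add Q i a" "Q < fam_colon Q i a"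
      using ne1 ne2 fam_add_superset[of Q i a] fam_colon_superset[OF Q 3(1)] by (metis order_less_le)+
    have "hQ Q k \<le> hQ (fam_add Q i a) k + hQ (fam_colon Q i a) (k - i)" if "i \<le> k" for k
    proof -
      have "hQ Q k \<le> hQ (fam_colon Q i a) (k - i) + hQ (fam_add Q i a) k"
        by (rule hQ_add[OF Q fam_colon_fam[OF Q 3(1)] 3(1) that]) (use that in \<open>auto simp: fam_colon_def\<close>)
      then show ?thesis by simp
    qed
    then have "\<forall>\<^sub>F k in sequentially. hQ Q k \<le> hQ (fam_add Q i a) k + hQ (fam_colon Q i a) (k - i)"
      unfolding eventually_sequentially by blast
    then show ?thesis using lt fam_add_fam[OF Q 3(1)] fam_colon_fam[OF Q 3(1)] by blast
  qed
next
  fix Q assume Q: "Q \<in> fam" and pr: "hprime Q \<and> Q (Suc 0) \<noteq> J"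
  have "Q (Suc 0) \<subseteq> J" using famD(3)[OF Q, of "Suc 0"] ideal_pow_1[OF J] by simp
  \<comment> \<open>The element has degree one, so the difference inequality compares
    \<open>k\<close> with exactly \<open>k - 1\<close>.\<close>
  then obtain x where x: "x \<in> J" "x \<notin> Q (Suc 0)" using pr by blast
  have xj: "x \<in> jp (Suc 0)" using x ideal_pow_1[OF J] by simp
  have "x \<in> fam_add Q (Suc 0) x (Suc 0)"
  proof -
    have "\<one> \<otimes> x \<in> (\<lambda>c. c \<otimes> x) ` jp (Suc 0 - Suc 0)" by simp
    then have "\<one> \<otimes> x \<in> fam_add Q (Suc 0) x (Suc 0)" unfolding fam_add_def by (simp add: reg.span_base)
    then show ?thesis using jp_carr[OF xj] by simp
  qed
  then have "fam_add Q (Suc 0) x \<noteq> Q" using x(2) by metis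
  then have lt: "Q < fam_add Q (Suc 0) x" using fam_add_superset[of Q "Suc 0" x] by (metis order_less_le)
  have "1 \<le> k \<and> hQ Q k \<le> hQ Q (k - 1) + hQ (fam_add Q (Suc 0) x) k" if "1 \<le> k" for k
    using hQ_add[OF Q Q xj, of k] fam_mult'[OF Q xj, of _ "k - 1"] that by simp
  then have "\<forall>\<^sub>F k in sequentially. 1 \<le> k \<and> hQ Q k \<le> hQ Q (k - 1) + hQ (fam_add Q (Suc 0) x) k"
    unfolding eventually_sequentially by blast
  then show "\<exists>Q1\<in>fam. Q < Q1 \<and> (\<forall>\<^sub>F k in sequentially. 1 \<le> k \<and> hQ Q k \<le> hQ Q (k - 1) + hQ Q1 k)"
    using lt fam_add_fam[OF Q xj] by blast
qed (rule Q)

end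

section \<open>The fiber cone\<close>

text \<open>Ring axioms pass along surjective homomorphisms. The fiber cone inherits them in this
  way from the Rees algebra, instead of their being verified on sequences of cosets.\<close>

lemma cring_surj_image:
  assumes R: "cring R" and h: "h \<in> ring_hom R S" and surj: "h ` carrier R = carrier S"
    and zero: "h \<zero>\<^bsub>R\<^esub> = \<zero>\<^bsub>S\<^esub>"
  shows "cring S"
proof -
  interpret R: cring R by (rule R)
  have "ring (S \<lparr> carrier := h ` (carrier R), zero := h \<zero>\<^bsub>R\<^esub> \<rparr>)" by (rule R.ring_hom_imp_img_ring[OF h])
  then have S: "ring S" unfolding surj zero by simp
  show ?thesis
  proof (rule cring.intro[OF S], rule monoid.monoid_comm_monoidI)
    show "monoid S" using S by (rule ring.axioms(2))
    fix x y assume "x \<in> carrier S" "y \<in> carrier S"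
    then obtain a b where "a \<in> carrier R" "b \<in> carrier R" "x = h a" "y = h b"
      unfolding surj[symmetric] by blast
    then show "x \<otimes>\<^bsub>S\<^esub> y = y \<otimes>\<^bsub>S\<^esub> x"
      using ring_hom_mult[OF h, of a b] ring_hom_mult[OF h, of b a] R.m_comm[of a b] by simp
  qed
qed

lemma (in ring) ideal_finsum_closed:
  assumes I: "ideal I R" and "\<And>i. i \<in> A \<Longrightarrow> f i \<in> I"
  shows "finsum R f A \<in> I"
  using assms(2)
proof (induction A rule: infinite_finite_induct)
  case (insert x A)
  have "f \<in> A \<rightarrow> carrier R" "f x \<in> carrier R" using insert.prems ideal.Icarr[OF I] by auto
  then show ?case
    using insert additive_subgroup.a_closed[OF ideal.axioms(1)[OF I]] by simp
qed (simp_all add: additive_subgroup.zero_closed[OF ideal.axioms(1)[OF I]])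

lemma (in ring) coset_eq_iff:
  assumes "ideal I R" "a \<in> carrier R" "b \<in> carrier R"
  shows "I +> a = I +> b \<longleftrightarrow> a \<ominus> b \<in> I"
  using quotient_eq_iff_same_a_r_cos[OF assms] by simp

lemma (in ring) coset_subset_iff:
  assumes I: "ideal I R" and L: "ideal L R" and IL: "I \<subseteq> L" and a: "a \<in> carrier R"
  shows "I +> a \<subseteq> L \<longleftrightarrow> a \<in> L"
proof
  assume "I +> a \<subseteq> L"
  moreover have "\<zero> \<oplus> a \<in> I +> a"
    unfolding a_r_coset_def' using additive_subgroup.zero_closed[OF ideal.axioms(1)[OF I]] by blast
  ultimately show "a \<in> L" using a by auto
next
  assume "a \<in> L"
  then show "I +> a \<subseteq> L"
    unfolding a_r_coset_def' using IL additive_subgroup.a_closed[OF ideal.axioms(1)[OF L]] by blast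
qed

section \<open>The fiber cone as a quotient of the Rees algebra\<close>

context fiber
begin

abbreviation FC where "FC \<equiv> fiber_cone R \<mm> J"

lemma FC_simps:
  "carrier FC = {f. (\<forall>k. \<exists>x \<in> jp k. f k = bottom k +> x) \<and> finite {k. f k \<noteq> bottom k}}"
  "f \<otimes>\<^bsub>FC\<^esub> g = (\<lambda>k. \<Oplus>\<^bsub>R Quot bottom k\<^esub>i\<in>{..k}. rcoset_mult R (bottom k) (f i) (g (k - i)))"
  "\<one>\<^bsub>FC\<^esub> = (\<lambda>k. if k = 0 then bottom 0 +> \<one> else bottom k)"
  "\<zero>\<^bsub>FC\<^esub> = bottom"
  "f \<oplus>\<^bsub>FC\<^esub> g = (\<lambda>k. f k <+> g k)"
  unfolding fiber_cone_def Let_def bottom_def by (auto simp: fun_eq_iff)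

text \<open>The Rees algebra \<open>R[Jt]\<close> inside the polynomial ring \<open>R[t]\<close>;
  \<open>phi\<close> below reduces it in each degree modulo \<open>\<mm> J^k\<close>.\<close>

definition rees :: "(nat \<Rightarrow> 'a) set" where
  "rees = {p \<in> up R. \<forall>k. p k \<in> jp k}"

abbreviation RS where "RS \<equiv> (UP R)\<lparr>carrier := rees\<rparr>"

definition phi :: "(nat \<Rightarrow> 'a) \<Rightarrow> nat \<Rightarrow> 'a set" where
  "phi p = (\<lambda>k. bottom k +> p k)"

lemma reesD: "p \<in> rees \<Longrightarrow> p k \<in> jp k" "p \<in> rees \<Longrightarrow> p \<in> up R" "p \<in> rees \<Longrightarrow> p k \<in> carrier R"
  unfolding rees_def using jp_carr by auto

lemma rees_mult:
  assumes "p \<in> rees" "q \<in> rees"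
  shows "p \<otimes>\<^bsub>UP R\<^esub> q = (\<lambda>k. \<Oplus>i\<in>{..k}. p i \<otimes> q (k - i))"
  using reesD(2)[OF assms(1)] reesD(2)[OF assms(2)] by (simp add: UP_def)

lemma rees_add:
  assumes "p \<in> rees" "q \<in> rees"
  shows "p \<oplus>\<^bsub>UP R\<^esub> q = (\<lambda>k. p k \<oplus> q k)"
  using reesD(2)[OF assms(1)] reesD(2)[OF assms(2)] by (simp add: UP_def)

lemma rees_cring: "cring RS"
proof -
  interpret UP: UP_cring R "UP R" by (rule UP_cring.intro[OF is_cring])
  have cu: "carrier (UP R) = up R" by (simp add: UP_def)
  have up_coeff: "up_ring.coeff (UP R) p = p" if "p \<in> up R" for p using that by (simp add: UP_def)
  have "subring rees (UP R)"
  proof (rule UP.P.subringI)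
    show "rees \<subseteq> carrier (UP R)" unfolding rees_def cu by blast
    show "\<one>\<^bsub>UP R\<^esub> \<in> rees"
      unfolding rees_def using UP.P.one_closed[unfolded cu]
        additive_subgroup.zero_closed[OF ideal.axioms(1)[OF jp_ideal]] by (simp add: UP_def)
  next
    fix p assume p: "p \<in> rees"
    have inv: "\<ominus>\<^bsub>UP R\<^esub> p \<in> up R" using UP.P.a_inv_closed[of p] reesD(2)[OF p] cu by simp
    have "(\<ominus>\<^bsub>UP R\<^esub> p) k = \<ominus> (p k)" for k
      using UP.coeff_a_inv[of p k] reesD(2)[OF p] cu up_coeff[OF inv] up_coeff[OF reesD(2)[OF p]] by simp
    then show "\<ominus>\<^bsub>UP R\<^esub> p \<in> rees"
      unfolding rees_def using inv reesD(1)[OF p]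
        additive_subgroup.a_inv_closed[OF ideal.axioms(1)[OF jp_ideal]] ring_axioms
      by (simp add: abelian_group.a_inv_closed)
  next
    fix p q assume p: "p \<in> rees" and q: "q \<in> rees"
    have "p \<otimes>\<^bsub>UP R\<^esub> q \<in> up R"
      using UP.P.m_closed[of p q] reesD(2)[OF p] reesD(2)[OF q] cu by simp
    moreover have "(\<Oplus>i\<in>{..k}. p i \<otimes> q (k - i)) \<in> jp k" for k
    proof (rule ideal_finsum_closed[OF jp_ideal])
      show "p i \<otimes> q (k - i) \<in> jp k" if "i \<in> {..k}" for i
        using ideal_pow_mult_in[OF J reesD(1)[OF p] reesD(1)[OF q], of i "k - i"] that by simp
    qed
    ultimately show "p \<otimes>\<^bsub>UP R\<^esub> q \<in> rees"
      unfolding rees_def using rees_mult[OF p q] by simp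
    have "p \<oplus>\<^bsub>UP R\<^esub> q \<in> up R"
      using UP.P.a_closed[of p q] reesD(2)[OF p] reesD(2)[OF q] cu by simp
    then show "p \<oplus>\<^bsub>UP R\<^esub> q \<in> rees"
      unfolding rees_def using rees_add[OF p q] reesD(1)[OF p] reesD(1)[OF q]
        additive_subgroup.a_closed[OF ideal.axioms(1)[OF jp_ideal]] by simp
  qed
  then have "subcring rees (UP R)" by (rule UP.P.subcringI')
  then show ?thesis using UP.P.subcring_iff[of rees] subcringE(1) by blast
qed

lemma bottom_subset: "bottom k \<subseteq> jp k"
  by (rule famD(3)[OF bottom_fam])

lemma coset_bottom_eq: "x \<in> bottom k \<Longrightarrow> bottom k +> x = bottom k"
  by (rule a_rcos_zero[OF bottom_ideal])

text \<open>The two factors are cosets of different ideals, and the product is a union of cosets of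
  a third one over all representatives. By \<open>bottom_mult\<close> changing a representative
  alters the product only by an element of \<open>bottom k\<close>, so the union is a single
  coset.\<close>

lemma rcoset_mult_bottom:
  assumes a: "a \<in> jp i" and b: "b \<in> jp j" and k: "k = i + j"
  shows "rcoset_mult R (bottom k) (bottom i +> a) (bottom j +> b) = bottom k +> (a \<otimes> b)"
proof -
  have c: "a \<in> carrier R" "b \<in> carrier R" using jp_carr a b by auto
  have bc: "x \<in> carrier R" if "x \<in> bottom l" for x l using ideal.Icarr[OF bottom_ideal that] .
  have eq: "bottom k +> (x \<otimes> y) = bottom k +> (a \<otimes> b)"
    if x: "x \<in> bottom i +> a" and y: "y \<in> bottom j +> b" for x y
  proof -
    obtain u v where u: "u \<in> bottom i" "x = u \<oplus> a" and v: "v \<in> bottom j" "y = v \<oplus> b"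
      using x y unfolding a_r_coset_def' by blast
    have uc: "u \<in> carrier R" "v \<in> carrier R" using bc u v by auto
    have "u \<otimes> (v \<oplus> b) \<in> bottom k"
    proof -
      have "v \<oplus> b \<in> jp j"
        using bottom_subset v(1) b additive_subgroup.a_closed[OF ideal.axioms(1)[OF jp_ideal]] by blast
      then show ?thesis unfolding k by (rule bottom_mult[OF _ u(1)])
    qed
    moreover have "v \<otimes> a \<in> bottom k" using bottom_mult[OF a v(1)] unfolding k by (simp add: add.commute)
    ultimately have s: "u \<otimes> (v \<oplus> b) \<oplus> v \<otimes> a \<in> bottom k"
      by (rule additive_subgroup.a_closed[OF ideal.axioms(1)[OF bottom_ideal]])
    have "x \<otimes> y \<ominus> a \<otimes> b = u \<otimes> (v \<oplus> b) \<oplus> v \<otimes> a"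
    proof -
      have "x \<otimes> y = (u \<otimes> (v \<oplus> b) \<oplus> v \<otimes> a) \<oplus> a \<otimes> b"
        unfolding u(2) v(2) using c uc by (simp add: l_distr r_distr m_comm a_ac)
      then show ?thesis using c uc by (simp add: a_minus_def a_assoc r_neg)
    qed
    then show ?thesis
      using s c uc u v by (subst coset_eq_iff[OF bottom_ideal]) auto
  qed
  have "a \<in> bottom i +> a" "b \<in> bottom j +> b"
    using abelian_subgroup.a_rcos_self[OF abelian_subgroupI3[OF ideal.axioms(1)[OF bottom_ideal] is_abelian_group]] c
    by auto
  then show ?thesis unfolding rcoset_mult_def using eq by blast
qed

lemma phi_carrier: "p \<in> rees \<Longrightarrow> phi p \<in> carrier FC"
proof -
  assume p: "p \<in> rees"
  obtain n where n: "bound \<zero> n p" using reesD(2)[OF p] unfolding up_def by blast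
  have "{k. phi p k \<noteq> bottom k} \<subseteq> {..n}"
  proof
    fix k assume k: "k \<in> {k. phi p k \<noteq> bottom k}"
    show "k \<in> {..n}"
    proof (rule ccontr)
      assume "k \<notin> {..n}"
      then have "p k = \<zero>" using n by (simp add: bound.bound)
      then show False using k unfolding phi_def
        using coset_bottom_eq[OF additive_subgroup.zero_closed[OF ideal.axioms(1)[OF bottom_ideal]]] by simp
    qed
  qed
  then have "finite {k. phi p k \<noteq> bottom k}" by (rule finite_subset) simp
  then show ?thesis unfolding FC_simps using reesD(1)[OF p] unfolding phi_def by blast
qed

lemma phi_surj: "phi ` rees = carrier FC"
proof
  show "phi ` rees \<subseteq> carrier FC" using phi_carrier by blast
  show "carrier FC \<subseteq> phi ` rees"
  proof
    fix f assume "f \<in> carrier FC"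
    then have "\<forall>k. \<exists>x \<in> jp k. f k = bottom k +> x" and fin: "finite {k. f k \<noteq> bottom k}"
      unfolding FC_simps by auto
    then obtain x where x: "\<And>k. x k \<in> jp k" "\<And>k. f k = bottom k +> x k" by metis
    \<comment> \<open>Where the coset is trivial the representative is chosen to be zero; this makes
      \<open>p\<close> finitely supported.\<close>
    define p where "p k = (if f k = bottom k then \<zero> else x k)" for k
    have z: "\<zero> \<in> bottom k" for k by (rule additive_subgroup.zero_closed[OF ideal.axioms(1)[OF bottom_ideal]])
    have pj: "p k \<in> jp k" for k unfolding p_def using x(1) z[of k] bottom_subset[of k] by auto
    obtain n where n: "\<forall>k\<in>{k. f k \<noteq> bottom k}. k \<le> n" using fin finite_nat_set_iff_bounded_le by blast
    have "bound \<zero> n p" by (rule bound.intro) (use n in \<open>force simp: p_def\<close>)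
    then have "p \<in> rees" unfolding rees_def up_def using pj jp_carr by auto
    moreover have "f = phi p"
      unfolding phi_def p_def using x(2) coset_bottom_eq[OF z] by (auto simp: fun_eq_iff)
    ultimately show "f \<in> phi ` rees" by blast
  qed
qed

lemma phi_hom: "phi \<in> ring_hom RS FC"
proof (rule ring_hom_memI)
  show "phi x \<in> carrier FC" if "x \<in> carrier RS" for x using that phi_carrier by simp
  fix p q assume "p \<in> carrier RS" "q \<in> carrier RS"
  then have p: "p \<in> rees" and q: "q \<in> rees" by simp_all
  show "phi (p \<otimes>\<^bsub>RS\<^esub> q) = phi p \<otimes>\<^bsub>FC\<^esub> phi q"
  proof
    fix k
    interpret hom: ring_hom_cring R "R Quot bottom k" "\<lambda>x. bottom k +> x"
      by (rule ideal.rcos_ring_hom_cring[OF bottom_ideal is_cring])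
    have "(phi p \<otimes>\<^bsub>FC\<^esub> phi q) k =
        (\<Oplus>\<^bsub>R Quot bottom k\<^esub>i\<in>{..k}. bottom k +> (p i \<otimes> q (k - i)))"
      unfolding FC_simps
    proof (rule hom.S.finsum_cong')
      show "rcoset_mult R (bottom k) (phi p i) (phi q (k - i)) = bottom k +> (p i \<otimes> q (k - i))"
        if "i \<in> {..k}" for i
        unfolding phi_def
        by (rule rcoset_mult_bottom[OF reesD(1)[OF p] reesD(1)[OF q]]) (use that in simp)
    qed (use reesD(3)[OF p] reesD(3)[OF q] in auto)
    also have "\<dots> = bottom k +> (\<Oplus>i\<in>{..k}. p i \<otimes> q (k - i))"
      using reesD(3)[OF p] reesD(3)[OF q] hom.hom_finsum[of "\<lambda>i. p i \<otimes> q (k - i)" "{..k}"]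
      by (simp add: o_def Pi_def)
    finally show "phi (p \<otimes>\<^bsub>RS\<^esub> q) k = (phi p \<otimes>\<^bsub>FC\<^esub> phi q) k"
      using rees_mult[OF p q] by (simp add: phi_def)
  qed
  show "phi (p \<oplus>\<^bsub>RS\<^esub> q) = phi p \<oplus>\<^bsub>FC\<^esub> phi q"
    unfolding FC_simps using rees_add[OF p q] ideal.a_rcos_sum[OF bottom_ideal] reesD(3)[OF p] reesD(3)[OF q]
    by (simp add: phi_def)
next
  show "phi \<one>\<^bsub>RS\<^esub> = \<one>\<^bsub>FC\<^esub>"
    unfolding FC_simps phi_def
    using coset_bottom_eq[OF additive_subgroup.zero_closed[OF ideal.axioms(1)[OF bottom_ideal]]]
    by (auto simp: UP_def fun_eq_iff)
qed

lemma phi_zero: "phi \<zero>\<^bsub>RS\<^esub> = \<zero>\<^bsub>FC\<^esub>"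
  unfolding FC_simps phi_def
  using coset_bottom_eq[OF additive_subgroup.zero_closed[OF ideal.axioms(1)[OF bottom_ideal]]]
  by (simp add: UP_def)

lemma FC_cring: "cring FC"
  by (rule cring_surj_image[OF rees_cring phi_hom]) (use phi_surj phi_zero in simp_all)

section \<open>Homogeneous families as prime ideals of the fiber cone\<close>

definition cone_ideal :: "(nat \<Rightarrow> 'a set) \<Rightarrow> (nat \<Rightarrow> 'a set) set" where
  "cone_ideal Q = {f \<in> carrier FC. \<forall>k. f k \<subseteq> Q k}"

lemma phi_cone_ideal_iff:
  assumes Q: "Q \<in> fam" and p: "p \<in> rees"
  shows "phi p \<in> cone_ideal Q \<longleftrightarrow> (\<forall>k. p k \<in> Q k)"
proof -
  have "bottom k \<subseteq> Q k" for k unfolding bottom_def by (rule famD(2)[OF Q])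
  then have "phi p k \<subseteq> Q k \<longleftrightarrow> p k \<in> Q k" for k
    unfolding phi_def by (intro coset_subset_iff bottom_ideal famD(1)[OF Q] reesD(3)[OF p])
  then show ?thesis unfolding cone_ideal_def using phi_carrier[OF p] by simp
qed

text \<open>Primality on homogeneous elements suffices: if neither of two elements lies in the
  ideal, the product of their lowest components outside \<open>Q\<close> is a component of the
  product up to terms in \<open>Q\<close>.\<close>

theorem cone_ideal_prime:
  assumes Q: "Q \<in> fam" and pr: "hprime Q"
  shows "primeideal (cone_ideal Q) FC"
proof -
  interpret FC: cring FC by (rule FC_cring)
  interpret RS: cring RS by (rule rees_cring)
  interpret hom: ring_hom_ring RS FC phi
    by (rule ring_hom_ringI2[OF RS.ring_axioms FC.ring_axioms phi_hom])
  have rep: "\<exists>p\<in>rees. f = phi p" if "f \<in> carrier FC" for f using that phi_surj by blast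
  have Qz: "\<zero> \<in> Q k" for k by (rule additive_subgroup.zero_closed[OF ideal.axioms(1)[OF famD(1)[OF Q]]])
  have Qa: "x \<oplus> y \<in> Q k" if "x \<in> Q k" "y \<in> Q k" for x y k
    by (rule additive_subgroup.a_closed[OF ideal.axioms(1)[OF famD(1)[OF Q]] that])
  have sub: "cone_ideal Q \<subseteq> carrier FC" unfolding cone_ideal_def by blast
  have l: "g \<otimes>\<^bsub>FC\<^esub> f \<in> cone_ideal Q" if f: "f \<in> cone_ideal Q" and g: "g \<in> carrier FC" for f g
  proof -
    obtain p q where p: "p \<in> rees" "f = phi p" and q: "q \<in> rees" "g = phi q"
      using rep f g sub by (meson subsetD)
    have pQ: "p k \<in> Q k" for k using f phi_cone_ideal_iff[OF Q p(1)] p(2) by simp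
    have m: "q \<otimes>\<^bsub>RS\<^esub> p \<in> rees" using RS.m_closed[of q p] p q by simp
    have "(q \<otimes>\<^bsub>RS\<^esub> p) k \<in> Q k" for k
    proof -
      have "(\<Oplus>i\<in>{..k}. q i \<otimes> p (k - i)) \<in> Q k"
      proof (rule ideal_finsum_closed[OF famD(1)[OF Q]])
        show "q i \<otimes> p (k - i) \<in> Q k" if "i \<in> {..k}" for i
          using fam_mult[OF Q reesD(1)[OF q(1)] pQ, of i "k - i"] that by simp
      qed
      then show ?thesis using rees_mult[OF q(1) p(1)] by simp
    qed
    then have "phi (q \<otimes>\<^bsub>RS\<^esub> p) \<in> cone_ideal Q" using phi_cone_ideal_iff[OF Q m] by simp
    then show ?thesis using hom.hom_mult[of q p] p q by simp
  qed
  have id: "ideal (cone_ideal Q) FC"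
  proof (rule idealI[OF FC.ring_axioms])
    show "subgroup (cone_ideal Q) (add_monoid FC)"
    proof (rule FC.add.subgroupI[OF sub])
      have "\<zero>\<^bsub>RS\<^esub> \<in> rees" using RS.zero_closed by simp
      moreover have "\<zero>\<^bsub>RS\<^esub> k \<in> Q k" for k using Qz by (simp add: UP_def)
      ultimately have "phi \<zero>\<^bsub>RS\<^esub> \<in> cone_ideal Q" using phi_cone_ideal_iff[OF Q] by blast
      then show "cone_ideal Q \<noteq> {}" by blast
    next
      fix f assume f: "f \<in> cone_ideal Q"
      have "\<ominus>\<^bsub>FC\<^esub> f = (\<ominus>\<^bsub>FC\<^esub> \<one>\<^bsub>FC\<^esub>) \<otimes>\<^bsub>FC\<^esub> f" using f sub FC.l_minus[OF FC.one_closed, of f] by auto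
      then show "\<ominus>\<^bsub>FC\<^esub> f \<in> cone_ideal Q" using l[OF f] by simp
    next
      fix f g assume f: "f \<in> cone_ideal Q" and g: "g \<in> cone_ideal Q"
      obtain p q where p: "p \<in> rees" "f = phi p" and q: "q \<in> rees" "g = phi q"
        using rep f g sub by (meson subsetD)
      have pQ: "p k \<in> Q k" for k using f phi_cone_ideal_iff[OF Q p(1)] p(2) by simp
      have qQ: "q k \<in> Q k" for k using g phi_cone_ideal_iff[OF Q q(1)] q(2) by simp
      have a: "p \<oplus>\<^bsub>RS\<^esub> q \<in> rees" using RS.a_closed[of p q] p q by simp
      have "(p \<oplus>\<^bsub>RS\<^esub> q) k \<in> Q k" for k using rees_add[OF p(1) q(1)] Qa[OF pQ qQ] by simp
      then have "phi (p \<oplus>\<^bsub>RS\<^esub> q) \<in> cone_ideal Q" using phi_cone_ideal_iff[OF Q a] by simp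
      then show "f \<oplus>\<^bsub>FC\<^esub> g \<in> cone_ideal Q" using hom.hom_add[of p q] p q by simp
    qed
    show "g \<otimes>\<^bsub>FC\<^esub> f \<in> cone_ideal Q" if "f \<in> cone_ideal Q" "g \<in> carrier FC" for f g by (rule l[OF that])
    show "f \<otimes>\<^bsub>FC\<^esub> g \<in> cone_ideal Q" if "f \<in> cone_ideal Q" "g \<in> carrier FC" for f g
      using l[OF that] FC.m_comm[of f g] that sub by auto
  qed
  show ?thesis
  proof (rule primeidealI[OF id FC_cring])
    show "carrier FC \<noteq> cone_ideal Q"
    proof
      assume eq: "carrier FC = cone_ideal Q"
      have "phi \<one>\<^bsub>RS\<^esub> \<in> cone_ideal Q" using phi_carrier RS.one_closed eq by simp
      then have "\<one>\<^bsub>RS\<^esub> 0 \<in> Q 0" using phi_cone_ideal_iff[OF Q] RS.one_closed by simp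
      then show False using pr unfolding hprime_def by (simp add: UP_def)
    qed
    fix f g assume f: "f \<in> carrier FC" and g: "g \<in> carrier FC" and fg: "f \<otimes>\<^bsub>FC\<^esub> g \<in> cone_ideal Q"
    obtain p q where p: "p \<in> rees" "f = phi p" and q: "q \<in> rees" "g = phi q"
      using rep f g by blast
    have m: "p \<otimes>\<^bsub>RS\<^esub> q \<in> rees" using RS.m_closed[of p q] p q by simp
    have "phi (p \<otimes>\<^bsub>RS\<^esub> q) \<in> cone_ideal Q" using hom.hom_mult[of p q] p q fg by simp
    then have pq: "(\<Oplus>l\<in>{..k}. p l \<otimes> q (k - l)) \<in> Q k" for k
      using phi_cone_ideal_iff[OF Q m] rees_mult[OF p(1) q(1)] by simp
    show "f \<in> cone_ideal Q \<or> g \<in> cone_ideal Q"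
    proof (rule ccontr)
      assume "\<not> (f \<in> cone_ideal Q \<or> g \<in> cone_ideal Q)"
      then have ex: "\<exists>k. p k \<notin> Q k" "\<exists>k. q k \<notin> Q k"
        using phi_cone_ideal_iff[OF Q p(1)] phi_cone_ideal_iff[OF Q q(1)] p(2) q(2) by auto
      \<comment> \<open>By minimality of \<open>i\<close> and \<open>j\<close>, every summand of the
        product in degree \<open>i + j\<close> other than \<open>p i \<otimes> q j\<close> has a
        factor in \<open>Q\<close>.\<close>
      define i where "i = (LEAST k. p k \<notin> Q k)"
      define j where "j = (LEAST k. q k \<notin> Q k)"
      have i: "p i \<notin> Q i" "\<And>l. l < i \<Longrightarrow> p l \<in> Q l"
        unfolding i_def using LeastI_ex[OF ex(1)] not_less_Least by blast+
      have j: "q j \<notin> Q j" "\<And>l. l < j \<Longrightarrow> q l \<in> Q l"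
        unfolding j_def using LeastI_ex[OF ex(2)] not_less_Least by blast+
      have summand: "p l \<otimes> q (i + j - l) \<in> Q (i + j)" if "l \<in> {..i + j} - {i}" for l
      proof (cases "l < i")
        case True
        from fam_mult'[OF Q reesD(1)[OF q(1)] i(2)[OF True], of "i + j - l"] True show ?thesis by simp
      next
        case False
        then have "i + j - l < j" using that by auto
        from fam_mult[OF Q reesD(1)[OF p(1)] j(2)[OF this], of l] that show ?thesis by auto
      qed
      have rest: "(\<Oplus>l\<in>{..i + j} - {i}. p l \<otimes> q (i + j - l)) \<in> Q (i + j)"
        by (rule ideal_finsum_closed[OF famD(1)[OF Q] summand])
      have "insert i ({..i + j} - {i}) = {..i + j}" by auto
      then have "(\<Oplus>l\<in>{..i + j}. p l \<otimes> q (i + j - l)) =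
          p i \<otimes> q (i + j - i) \<oplus> (\<Oplus>l\<in>{..i + j} - {i}. p l \<otimes> q (i + j - l))"
        using finsum_insert[of "{..i + j} - {i}" i "\<lambda>l. p l \<otimes> q (i + j - l)"]
          reesD(3)[OF p(1)] reesD(3)[OF q(1)] by (auto simp: Pi_def)
      then have total: "p i \<otimes> q j \<oplus> (\<Oplus>l\<in>{..i + j} - {i}. p l \<otimes> q (i + j - l)) \<in> Q (i + j)"
        using pq[of "i + j"] by simp
      have c: "p i \<otimes> q j \<in> carrier R" "(\<Oplus>l\<in>{..i + j} - {i}. p l \<otimes> q (i + j - l)) \<in> carrier R"
        using reesD(3)[OF p(1)] reesD(3)[OF q(1)] ideal.Icarr[OF famD(1)[OF Q] rest] by auto
      have "(p i \<otimes> q j \<oplus> (\<Oplus>l\<in>{..i + j} - {i}. p l \<otimes> q (i + j - l))) \<ominus>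
          (\<Oplus>l\<in>{..i + j} - {i}. p l \<otimes> q (i + j - l)) \<in> Q (i + j)"
        unfolding a_minus_def
        by (rule Qa[OF total additive_subgroup.a_inv_closed[OF ideal.axioms(1)[OF famD(1)[OF Q]] rest]])
      then have "p i \<otimes> q j \<in> Q (i + j)" using c by (simp add: a_minus_def a_assoc r_neg)
      then show False
        using pr i(1) j(1) reesD(1)[OF p(1), of i] reesD(1)[OF q(1), of j] unfolding hprime_def by blast
    qed
  qed
qed

text \<open>A homogeneous element \<open>x\<close> of degree \<open>k\<close> separating
  \<open>Q'\<close> from \<open>Q\<close> also separates the two ideals, as the monomial with
  coefficient \<open>x\<close> in degree \<open>k\<close>.\<close>

lemma cone_ideal_strict_mono:
  assumes Q: "Q \<in> fam" "Q' \<in> fam" and lt: "Q < Q'"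
  shows "cone_ideal Q \<subset> cone_ideal Q'"
proof -
  have le: "Q k \<subseteq> Q' k" for k using le_funD[OF less_imp_le[OF lt]] .
  have "\<exists>k. \<not> Q' k \<subseteq> Q k"
  proof (rule ccontr)
    assume "\<not> ?thesis"
    then have "Q' \<le> Q" unfolding le_fun_def by blast
    then show False using lt by simp
  qed
  then obtain k x where x: "x \<in> Q' k" "x \<notin> Q k" by blast
  define p where "p l = (if l = k then x else \<zero>)" for l
  have xj: "x \<in> jp k" using famD(3)[OF Q(2)] x(1) by blast
  have "bound \<zero> k p" unfolding p_def by (rule bound.intro) simp
  then have p: "p \<in> rees"
    unfolding rees_def up_def p_def
    using xj jp_carr[OF xj] additive_subgroup.zero_closed[OF ideal.axioms(1)[OF jp_ideal]] by auto
  have "\<zero> \<in> Q' l" for l by (rule additive_subgroup.zero_closed[OF ideal.axioms(1)[OF famD(1)[OF Q(2)]]])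
  then have "p l \<in> Q' l" for l using x(1) by (simp add: p_def)
  then have "phi p \<in> cone_ideal Q'" using phi_cone_ideal_iff[OF Q(2) p] by simp
  moreover have "p k \<notin> Q k" using x(2) by (simp add: p_def)
  then have "phi p \<notin> cone_ideal Q" using phi_cone_ideal_iff[OF Q(1) p] by blast
  moreover have "cone_ideal Q \<subseteq> cone_ideal Q'" unfolding cone_ideal_def using le by blast
  ultimately show ?thesis by blast
qed

text \<open>The maximal homogeneous ideal of the fiber cone. It is the prime excluded from the count
  in \<open>hQ_growth\<close>, and it returns on top of the chains that bound the Krull
  dimension.\<close>

definition irrelevant :: "nat \<Rightarrow> 'a set" where
  "irrelevant k = (if k = 0 then \<mm> else jp k)"

lemma irrelevant_fam: "irrelevant \<in> fam"
proof (rule famI)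
  show "ideal (irrelevant k) R" for k unfolding irrelevant_def using m_ideal jp_ideal by simp
  show "ideal_prod R \<mm> (jp k) \<subseteq> irrelevant k" for k
    unfolding irrelevant_def using ideal_prod_inter[OF m_ideal jp_ideal, of k] by auto
  show "irrelevant k \<subseteq> jp k" for k
    unfolding irrelevant_def using ideal_carrier_subset[OF m_ideal] by simp
  fix k a x assume a: "a \<in> J" and x: "x \<in> irrelevant k"
  have "x \<in> jp k" using x ideal_carrier_subset[OF m_ideal] unfolding irrelevant_def by (auto split: if_splits)
  then show "a \<otimes> x \<in> irrelevant (Suc k)"
    unfolding irrelevant_def using a by (simp add: ideal_pow_Suc'[OF J] ideal_prod.prod)
qed

lemma one_notin_m: "\<one> \<notin> \<mm>"
  using ideal.one_imp_carrier[OF m_ideal] maximalideal.I_notcarr[OF mx] by blast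

lemma irrelevant_hprime: "hprime irrelevant"
  unfolding hprime_def
proof (intro conjI allI impI)
  show "\<one> \<notin> irrelevant 0" using one_notin_m by (simp add: irrelevant_def)
  fix i j a b assume *: "a \<in> jp i" "b \<in> jp j" "a \<otimes> b \<in> irrelevant (i + j)"
  show "a \<in> irrelevant i \<or> b \<in> irrelevant j"
  proof (cases "i = 0 \<and> j = 0")
    case True
    then show ?thesis
      using * primeideal.I_prime[OF maximalideal_prime[OF mx], of a b] by (simp add: irrelevant_def)
  next
    case False
    then show ?thesis using * by (auto simp: irrelevant_def)
  qed
qed

text \<open>In degree 0 the family contains \<open>\<mm>\<close> and is proper, hence equals
  \<open>\<mm>\<close>; strictness is visible in degree 1.\<close>

lemma fam_less_irrelevant:
  assumes Q: "Q \<in> fam" and pr: "hprime Q" and J1: "Q (Suc 0) \<noteq> J"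
  shows "Q < irrelevant"
proof -
  have "\<mm> \<subseteq> Q 0" using famD(2)[OF Q, of 0] ideal_prod_one[OF m_ideal] by simp
  moreover have "Q 0 \<noteq> carrier R" using pr unfolding hprime_def by auto
  ultimately have "Q 0 = \<mm>"
    using maximalideal.I_maximal[OF mx famD(1)[OF Q]] ideal_carrier_subset[OF famD(1)[OF Q]] by blast
  then have "Q \<le> irrelevant" unfolding irrelevant_def le_fun_def using famD(3)[OF Q] by simp
  moreover have "Q \<noteq> irrelevant"
  proof
    assume "Q = irrelevant"
    then have "Q (Suc 0) = jp (Suc 0)" by (simp add: irrelevant_def)
    then show False using J1 ideal_pow_1[OF J] by simp
  qed
  ultimately show ?thesis by (simp add: order_less_le)
qed

text \<open>With \<open>irrelevant\<close> on top, \<open>n\<close> primes make \<open>n\<close>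
  strict inclusions, which is how Krull dimension counts. This lower bound by homogeneous chains is
  all that the argument asks of the analytic spread.\<close>

lemma krull_dim_FC_ge:
  assumes P: "\<And>i. i < n \<Longrightarrow> P i \<in> fam \<and> hprime (P i) \<and> P i (Suc 0) \<noteq> J"
    and lt: "\<And>i. Suc i < n \<Longrightarrow> P i < P (Suc i)"
  shows "ereal (real n) \<le> krull_dim FC"
proof -
  define C where "C i = cone_ideal (if i < n then P i else irrelevant)" for i
  have "primeideal (C i) FC" for i
    unfolding C_def using P cone_ideal_prime irrelevant_fam irrelevant_hprime by simp
  moreover have "C i \<subset> C (Suc i)" if "i < n" for i
  proof (cases "Suc i < n")
    case True
    then show ?thesis unfolding C_def using P[of i] P[of "Suc i"] lt[of i] cone_ideal_strict_mono by simp
  next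
    case False
    then show ?thesis
      unfolding C_def using P[of i] that fam_less_irrelevant irrelevant_fam cone_ideal_strict_mono by simp
  qed
  ultimately show ?thesis
    unfolding krull_dim_def by (intro Sup_upper CollectI exI[of _ n] conjI refl exI[of _ C]) auto
qed

lemma fiber_growth:
  assumes "analytic_spread R \<mm> J = ereal (real s)"
  shows "growth s (hQ bottom)"
proof (rule hQ_growth[OF bottom_fam])
  fix n P
  assume "\<And>i. i < n \<Longrightarrow> P i \<in> fam \<and> hprime (P i) \<and> P i (Suc 0) \<noteq> J \<and> bottom \<le> P i"
    "\<And>i. Suc i < n \<Longrightarrow> P i < P (Suc i)"
  then have "ereal (real n) \<le> krull_dim FC" by (intro krull_dim_FC_ge) auto
  then show "n \<le> s" using assms unfolding analytic_spread_def by simp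
qed

lemma analytic_spread_nonneg: "0 \<le> analytic_spread R \<mm> J"
  using krull_dim_FC_ge[of 0] unfolding analytic_spread_def by (simp add: zero_ereal_def)

end

section \<open>Quotient modules\<close>

lemma module_length_eq_len:
  fixes N :: "('a, 'b, 's) module_scheme"
  assumes "module R N"
  shows "module_length R N = len (\<lambda>L. submodule L R N) {\<zero>\<^bsub>N\<^esub>} (carrier N)"
proof -
  interpret N: module R N by (rule assms)
  have "(\<exists>C :: nat \<Rightarrow> 'b set. (\<forall>i\<le>n. submodule (C i) R N) \<and> (\<forall>i<n. C i \<subset> C (Suc i))) \<longleftrightarrow>
      has_chain (\<lambda>L. submodule L R N) n {\<zero>\<^bsub>N\<^esub>} (carrier N)" for n
  proof -
    have "submodule L R N \<and> {\<zero>\<^bsub>N\<^esub>} \<subseteq> L \<and> L \<subseteq> carrier N \<longleftrightarrow> submodule L R N" for L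
      using N.sub_zero[of L] N.sub_subset[of L] by blast
    then show ?thesis unfolding has_chain_def by (simp only:)
  qed
  then show ?thesis unfolding module_length_def len_def by simp
qed

context module
begin

lemma minus_eq_smult: "x \<in> carrier M \<Longrightarrow> \<ominus>\<^bsub>M\<^esub> x = (\<ominus>\<^bsub>R\<^esub> \<one>\<^bsub>R\<^esub>) \<odot>\<^bsub>M\<^esub> x"
  by (simp add: smult_l_minus)

context
  fixes C assumes C: "sub C"
begin

interpretation C: abelian_subgroup C M
  by (rule abelian_subgroupI3)
     (use submodule.axioms(1)[OF C] in \<open>auto intro: additive_subgroup.intro M.abelian_group_axioms\<close>)

abbreviation proj where "proj x \<equiv> C +>\<^bsub>M\<^esub> x"

abbreviation Q where "Q \<equiv> quot_module M C"

lemma quot_module_simps: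
  "carrier Q = proj ` carrier M" "\<zero>\<^bsub>Q\<^esub> = C" "X \<oplus>\<^bsub>Q\<^esub> Y = X <+>\<^bsub>M\<^esub> Y"
  "a \<odot>\<^bsub>Q\<^esub> X = (\<Union>x\<in>X. proj (a \<odot>\<^bsub>M\<^esub> x))"
  unfolding quot_module_def A_RCOSETS_def' by auto

lemma proj_eq_iff:
  assumes "x \<in> carrier M" "y \<in> carrier M"
  shows "proj x = proj y \<longleftrightarrow> x \<ominus>\<^bsub>M\<^esub> y \<in> C"
proof
  assume "proj x = proj y"
  then have "x \<in> proj y" using C.a_rcos_self[OF assms(1)] by simp
  then show "x \<ominus>\<^bsub>M\<^esub> y \<in> C" using C.a_rcos_module[OF assms(2,1)] by (simp add: a_minus_def)
next
  assume "x \<ominus>\<^bsub>M\<^esub> y \<in> C"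
  then have "x \<in> proj y" using C.a_rcos_module[OF assms(2,1)] by (simp add: a_minus_def)
  then show "proj x = proj y" using M.a_repr_independence[OF _ assms(2) C.a_subgroup] by blast
qed

lemma proj_zero: "proj \<zero>\<^bsub>M\<^esub> = C"
  by (rule M.a_coset_add_zero[OF sub_subset[OF C]])

lemma proj_eq_C_iff:
  assumes "x \<in> carrier M"
  shows "proj x = C \<longleftrightarrow> x \<in> C"
proof -
  have "\<ominus>\<^bsub>M\<^esub> \<zero>\<^bsub>M\<^esub> = \<zero>\<^bsub>M\<^esub>" by (rule M.minus_equality) simp_all
  then have "x \<ominus>\<^bsub>M\<^esub> \<zero>\<^bsub>M\<^esub> = x" using assms by (simp only: a_minus_def M.r_zero)
  then show ?thesis using proj_eq_iff[OF assms M.zero_closed] unfolding proj_zero by simp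
qed

lemma proj_add: "x \<in> carrier M \<Longrightarrow> y \<in> carrier M \<Longrightarrow> proj x \<oplus>\<^bsub>Q\<^esub> proj y = proj (x \<oplus>\<^bsub>M\<^esub> y)"
  unfolding quot_module_simps by (rule C.a_rcos_sum)

lemma proj_smult:
  assumes a: "a \<in> carrier R" and x: "x \<in> carrier M"
  shows "a \<odot>\<^bsub>Q\<^esub> proj x = proj (a \<odot>\<^bsub>M\<^esub> x)"
proof -
  have "proj (a \<odot>\<^bsub>M\<^esub> y) = proj (a \<odot>\<^bsub>M\<^esub> x)" if y: "y \<in> proj x" for y
  proof -
    have yc: "y \<in> carrier M" using y M.a_r_coset_subset_G[OF sub_subset[OF C] x] by blast
    have "y \<ominus>\<^bsub>M\<^esub> x \<in> C" using y C.a_rcos_module[OF x yc] by (simp add: a_minus_def)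
    then have "a \<odot>\<^bsub>M\<^esub> (y \<ominus>\<^bsub>M\<^esub> x) \<in> C" by (rule sub_smult[OF C a])
    moreover have "a \<odot>\<^bsub>M\<^esub> (y \<ominus>\<^bsub>M\<^esub> x) = a \<odot>\<^bsub>M\<^esub> y \<ominus>\<^bsub>M\<^esub> a \<odot>\<^bsub>M\<^esub> x"
      using a x yc by (simp add: a_minus_def smult_r_distr smult_r_minus)
    ultimately show ?thesis using a x yc by (subst proj_eq_iff) auto
  qed
  moreover have "x \<in> proj x" by (rule C.a_rcos_self[OF x])
  ultimately show ?thesis unfolding quot_module_simps by blast
qed

lemma proj_carrier: "x \<in> carrier M \<Longrightarrow> proj x \<in> carrier Q"
  unfolding quot_module_simps by blast

lemma carrier_Q_cases: "X \<in> carrier Q \<Longrightarrow> (\<And>x. x \<in> carrier M \<Longrightarrow> X = proj x \<Longrightarrow> thesis) \<Longrightarrow> thesis"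
  unfolding quot_module_simps by blast

lemma module_quot_module: "module R Q"
proof (rule moduleI)
  show "cring R" by (rule R.is_cring)
  show "abelian_group Q"
  proof (rule abelian_groupI)
    show "\<zero>\<^bsub>Q\<^esub> \<in> carrier Q" using proj_carrier[OF M.zero_closed] proj_zero by (simp add: quot_module_simps(2))
  next
    fix X Y assume "X \<in> carrier Q" "Y \<in> carrier Q"
    then obtain x y where *: "x \<in> carrier M" "X = proj x" "y \<in> carrier M" "Y = proj y"
      using carrier_Q_cases by metis
    then show "X \<oplus>\<^bsub>Q\<^esub> Y \<in> carrier Q" by (simp add: proj_add proj_carrier)
    show "X \<oplus>\<^bsub>Q\<^esub> Y = Y \<oplus>\<^bsub>Q\<^esub> X" using * by (simp add: proj_add M.a_comm)
  next
    fix X Y Z assume "X \<in> carrier Q" "Y \<in> carrier Q" "Z \<in> carrier Q"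
    then obtain x y z where *: "x \<in> carrier M" "X = proj x" "y \<in> carrier M" "Y = proj y" "z \<in> carrier M" "Z = proj z"
      using carrier_Q_cases by metis
    then show "X \<oplus>\<^bsub>Q\<^esub> Y \<oplus>\<^bsub>Q\<^esub> Z = X \<oplus>\<^bsub>Q\<^esub> (Y \<oplus>\<^bsub>Q\<^esub> Z)" by (simp add: proj_add M.a_assoc)
  next
    fix X assume "X \<in> carrier Q"
    then obtain x where *: "x \<in> carrier M" "X = proj x" using carrier_Q_cases by metis
    then show "\<zero>\<^bsub>Q\<^esub> \<oplus>\<^bsub>Q\<^esub> X = X"
      using proj_add[OF M.zero_closed *(1)] proj_zero by (simp add: quot_module_simps(2))
    have "proj (\<ominus>\<^bsub>M\<^esub> x) \<oplus>\<^bsub>Q\<^esub> X = \<zero>\<^bsub>Q\<^esub>"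
      using * proj_add[of "\<ominus>\<^bsub>M\<^esub> x" x] proj_zero by (simp add: M.l_neg quot_module_simps(2))
    then show "\<exists>Y\<in>carrier Q. Y \<oplus>\<^bsub>Q\<^esub> X = \<zero>\<^bsub>Q\<^esub>" using * proj_carrier[of "\<ominus>\<^bsub>M\<^esub> x"] by blast
  qed
next
  fix a X assume a: "a \<in> carrier R" and "X \<in> carrier Q"
  then obtain x where *: "x \<in> carrier M" "X = proj x" using carrier_Q_cases by metis
  then show "a \<odot>\<^bsub>Q\<^esub> X \<in> carrier Q" using a by (simp add: proj_smult proj_carrier)
  {
    fix b assume b: "b \<in> carrier R"
    show "(a \<oplus>\<^bsub>R\<^esub> b) \<odot>\<^bsub>Q\<^esub> X = a \<odot>\<^bsub>Q\<^esub> X \<oplus>\<^bsub>Q\<^esub> b \<odot>\<^bsub>Q\<^esub> X"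
      using a b * by (simp add: proj_smult proj_add smult_l_distr)
    show "(a \<otimes>\<^bsub>R\<^esub> b) \<odot>\<^bsub>Q\<^esub> X = a \<odot>\<^bsub>Q\<^esub> (b \<odot>\<^bsub>Q\<^esub> X)"
      using a b * by (simp add: proj_smult smult_assoc1)
  }
  fix Y assume "Y \<in> carrier Q"
  then obtain y where "y \<in> carrier M" "Y = proj y" using carrier_Q_cases by metis
  then show "a \<odot>\<^bsub>Q\<^esub> (X \<oplus>\<^bsub>Q\<^esub> Y) = a \<odot>\<^bsub>Q\<^esub> X \<oplus>\<^bsub>Q\<^esub> a \<odot>\<^bsub>Q\<^esub> Y"
    using a * by (simp add: proj_smult proj_add smult_r_distr)
next
  fix X assume "X \<in> carrier Q"
  then obtain x where *: "x \<in> carrier M" "X = proj x" using carrier_Q_cases by metis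
  then show "\<one>\<^bsub>R\<^esub> \<odot>\<^bsub>Q\<^esub> X = X" by (simp add: proj_smult)
qed

lemma submodule_proj_image:
  assumes N: "sub N"
  shows "submodule (proj ` N) R Q"
proof -
  interpret Q: module R Q by (rule module_quot_module)
  have Nc: "x \<in> carrier M" if "x \<in> N" for x using sub_carr[OF N that] .
  have sm: "a \<odot>\<^bsub>Q\<^esub> X \<in> proj ` N" if a: "a \<in> carrier R" and X: "X \<in> proj ` N" for a X
    using X a Nc sub_smult[OF N a] by (auto simp: proj_smult)
  show ?thesis
  proof (rule Q.submoduleI)
    show c: "proj ` N \<subseteq> carrier Q" using Nc proj_carrier by blast
    show "\<zero>\<^bsub>Q\<^esub> \<in> proj ` N" using sub_zero[OF N] proj_zero by (simp add: quot_module_simps(2) rev_image_eqI)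
    show "X \<oplus>\<^bsub>Q\<^esub> Y \<in> proj ` N" if "X \<in> proj ` N" "Y \<in> proj ` N" for X Y
      using that Nc sub_add[OF N] by (auto simp: proj_add)
    show "a \<odot>\<^bsub>Q\<^esub> X \<in> proj ` N" if "a \<in> carrier R" "X \<in> proj ` N" for a X by (rule sm[OF that])
    show "\<ominus>\<^bsub>Q\<^esub> X \<in> proj ` N" if "X \<in> proj ` N" for X
      using sm[of "\<ominus>\<^bsub>R\<^esub> \<one>\<^bsub>R\<^esub>" X] that Q.minus_eq_smult[OF subsetD[OF c that]] by simp
  qed
qed

lemma sub_proj_vimage:
  assumes L: "submodule L R Q"
  shows "sub {x \<in> carrier M. proj x \<in> L}"
proof -
  interpret Q: module R Q by (rule module_quot_module)
  have sm: "a \<odot>\<^bsub>M\<^esub> x \<in> {x \<in> carrier M. proj x \<in> L}"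
    if "a \<in> carrier R" "x \<in> {x \<in> carrier M. proj x \<in> L}" for a x
    using that Q.sub_smult[OF L that(1), of "proj x"] by (simp add: proj_smult)
  show ?thesis
  proof (rule submoduleI)
    show "\<zero>\<^bsub>M\<^esub> \<in> {x \<in> carrier M. proj x \<in> L}"
      using Q.sub_zero[OF L] proj_zero by (simp add: quot_module_simps(2))
    show "x \<oplus>\<^bsub>M\<^esub> y \<in> {x \<in> carrier M. proj x \<in> L}"
      if "x \<in> {x \<in> carrier M. proj x \<in> L}" "y \<in> {x \<in> carrier M. proj x \<in> L}" for x y
      using that Q.sub_add[OF L, of "proj x" "proj y"] by (simp add: proj_add)
    show "a \<odot>\<^bsub>M\<^esub> x \<in> {x \<in> carrier M. proj x \<in> L}"
      if "a \<in> carrier R" "x \<in> {x \<in> carrier M. proj x \<in> L}" for a x by (rule sm[OF that])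
    show "\<ominus>\<^bsub>M\<^esub> x \<in> {x \<in> carrier M. proj x \<in> L}" if "x \<in> {x \<in> carrier M. proj x \<in> L}" for x
      using sm[of "\<ominus>\<^bsub>R\<^esub> \<one>\<^bsub>R\<^esub>" x] that minus_eq_smult[of x] by simp
  qed blast
qed

lemma proj_image_mem_iff:
  assumes N: "sub N" and CN: "C \<subseteq> N" and x: "x \<in> carrier M"
  shows "proj x \<in> proj ` N \<longleftrightarrow> x \<in> N"
proof
  assume "proj x \<in> proj ` N"
  then obtain y where y: "y \<in> N" "proj x = proj y" by blast
  have yc: "y \<in> carrier M" using sub_carr[OF N y(1)] .
  then have "x \<ominus>\<^bsub>M\<^esub> y \<in> N" using proj_eq_iff[OF x yc] y(2) CN by blast
  then have "y \<oplus>\<^bsub>M\<^esub> (x \<ominus>\<^bsub>M\<^esub> y) \<in> N" by (rule sub_add[OF N y(1)])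
  moreover have "y \<oplus>\<^bsub>M\<^esub> (x \<ominus>\<^bsub>M\<^esub> y) = x"
    using x yc by (simp add: a_minus_def M.a_lcomm M.r_neg)
  ultimately show "x \<in> N" by simp
qed blast

text \<open>The correspondence theorem for lengths: images and preimages under \<open>proj\<close>
  preserve strict inclusions between submodules above \<open>C\<close>, which gives the two
  inequalities.\<close>

lemma len_quot_module:
  assumes X: "sub X" and Y: "sub Y" and CX: "C \<subseteq> X" and XY: "X \<subseteq> Y"
  shows "len (\<lambda>L. submodule L R Q) (proj ` X) (proj ` Y) = len sub X Y"
proof (rule antisym)
  interpret Q: module R Q by (rule module_quot_module)
  show "len sub X Y \<le> len (\<lambda>L. submodule L R Q) (proj ` X) (proj ` Y)"
  proof (rule len_image_le[where F = "\<lambda>N. proj ` N"])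
    show "submodule (proj ` Z) R Q \<and> proj ` X \<subseteq> proj ` Z \<and> proj ` Z \<subseteq> proj ` Y"
      if "sub Z" "X \<subseteq> Z" "Z \<subseteq> Y" for Z
      using that submodule_proj_image by blast
    fix Z Z' assume Z: "sub Z" "X \<subseteq> Z" "sub Z'" "Z' \<subseteq> Y" "Z \<subset> Z'"
    then obtain z where z: "z \<in> Z'" "z \<notin> Z" by blast
    have "proj z \<notin> proj ` Z"
      using proj_image_mem_iff[OF Z(1) _ sub_carr[OF Z(3) z(1)]] CX Z(2) z(2) by blast
    then show "proj ` Z \<subset> proj ` Z'" using Z(5) z(1) by blast
  qed
  show "len (\<lambda>L. submodule L R Q) (proj ` X) (proj ` Y) \<le> len sub X Y"
  proof (rule len_image_le[where F = "\<lambda>L. {x \<in> carrier M. proj x \<in> L}"])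
    fix L assume L: "submodule L R Q" "proj ` X \<subseteq> L" "L \<subseteq> proj ` Y"
    have "X \<subseteq> {x \<in> carrier M. proj x \<in> L}" using L(2) sub_subset[OF X] by blast
    moreover have "{x \<in> carrier M. proj x \<in> L} \<subseteq> Y"
      using L(3) proj_image_mem_iff[OF Y order_trans[OF CX XY]] by blast
    ultimately show "sub {x \<in> carrier M. proj x \<in> L} \<and> X \<subseteq> {x \<in> carrier M. proj x \<in> L} \<and>
        {x \<in> carrier M. proj x \<in> L} \<subseteq> Y" using sub_proj_vimage[OF L(1)] by blast
  next
    fix L L' assume L: "submodule L R Q" "submodule L' R Q" "L \<subset> L'"
    then obtain Z where Z: "Z \<in> L'" "Z \<notin> L" by blast
    obtain z where "z \<in> carrier M" "Z = proj z"
      using carrier_Q_cases[OF Q.sub_carr[OF L(2) Z(1)]] by blast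
    then show "{x \<in> carrier M. proj x \<in> L} \<subset> {x \<in> carrier M. proj x \<in> L'}" using Z L(3) by blast
  qed
qed

lemma module_length_quot_module: "module_length R Q = len sub C (carrier M)"
proof -
  have "proj x = C" if "x \<in> C" for x using proj_eq_C_iff[OF sub_carr[OF C that]] that by simp
  then have "proj ` C = (\<lambda>_. C) ` C" by (intro image_cong refl)
  then have "proj ` C = {C}" using sub_zero[OF C] image_constant[of "\<zero>\<^bsub>M\<^esub>" C C] by simp
  then show ?thesis
    using module_length_eq_len[OF module_quot_module]
      len_quot_module[OF C carrier_is_submodule order_refl sub_subset[OF C]]
    by (simp add: quot_module_simps(1,2))
qed

lemma ideal_smult_quot_module:
  assumes I: "I \<subseteq> carrier R" and N: "N \<subseteq> carrier M"
  shows "ideal_smult Q I (proj ` N) = proj ` ideal_smult M I N"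
proof
  have c: "x \<in> carrier M" if "x \<in> ideal_smult M I N" for x
    using that by induction (use I N in auto)
  show "ideal_smult Q I (proj ` N) \<subseteq> proj ` ideal_smult M I N"
  proof
    fix X assume "X \<in> ideal_smult Q I (proj ` N)"
    then show "X \<in> proj ` ideal_smult M I N"
    proof induction
      case (smult a X)
      then obtain x where x: "x \<in> N" "X = proj x" by blast
      then have "a \<odot>\<^bsub>Q\<^esub> X = proj (a \<odot>\<^bsub>M\<^esub> x)" using smult I N proj_smult by blast
      then show ?case using ideal_smult.smult[of a I x N M] smult x by blast
    next
      case (add X Y)
      then obtain x y where xy: "x \<in> ideal_smult M I N" "X = proj x" "y \<in> ideal_smult M I N" "Y = proj y" by blast
      then have "X \<oplus>\<^bsub>Q\<^esub> Y = proj (x \<oplus>\<^bsub>M\<^esub> y)" using proj_add c by simp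
      then show ?case using ideal_smult.add[OF xy(1,3)] by blast
    qed
  qed
  show "proj ` ideal_smult M I N \<subseteq> ideal_smult Q I (proj ` N)"
  proof (rule image_subsetI)
    fix x assume "x \<in> ideal_smult M I N"
    then show "proj x \<in> ideal_smult Q I (proj ` N)"
    proof induction
      case (smult a x)
      have "a \<odot>\<^bsub>Q\<^esub> proj x \<in> ideal_smult Q I (proj ` N)"
        using smult by (intro ideal_smult.smult imageI)
      moreover have "a \<odot>\<^bsub>Q\<^esub> proj x = proj (a \<odot>\<^bsub>M\<^esub> x)"
        using smult I N by (intro proj_smult) auto
      ultimately show ?case by simp
    next
      case (add x y)
      from ideal_smult.add[OF add.IH] show ?case using proj_add c add.hyps by simp
    qed
  qed
qed

lemma annihilator_quot_module:
  "annihilator R Q = {a \<in> carrier R. \<forall>x\<in>carrier M. a \<odot>\<^bsub>M\<^esub> x \<in> C}"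
proof -
  have "(\<forall>X\<in>carrier Q. a \<odot>\<^bsub>Q\<^esub> X = \<zero>\<^bsub>Q\<^esub>) \<longleftrightarrow> (\<forall>x\<in>carrier M. a \<odot>\<^bsub>M\<^esub> x \<in> C)"
    if a: "a \<in> carrier R" for a
  proof -
    have "(\<forall>X\<in>carrier Q. a \<odot>\<^bsub>Q\<^esub> X = \<zero>\<^bsub>Q\<^esub>) \<longleftrightarrow> (\<forall>x\<in>carrier M. a \<odot>\<^bsub>Q\<^esub> proj x = C)"
      unfolding quot_module_simps(1,2) by blast
    also have "\<dots> \<longleftrightarrow> (\<forall>x\<in>carrier M. a \<odot>\<^bsub>M\<^esub> x \<in> C)"
      using a proj_smult proj_eq_C_iff by simp
    finally show ?thesis .
  qed
  then show ?thesis unfolding annihilator_def by blast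
qed

text \<open>The third isomorphism theorem for lengths: \<open>(M / C) / I (M / C)\<close> is
  \<open>M / (C + I M)\<close>.\<close>

lemma module_length_quot_quot:
  assumes I: "ideal I R"
  shows "module_length R (quot_module Q (ideal_smult Q I (carrier Q))) =
    len sub (span R M (C \<union> ideal_smult M I (carrier M))) (carrier M)"
proof -
  interpret Q: module R Q by (rule module_quot_module)
  let ?X = "ideal_smult M I (carrier M)"
  have X: "sub ?X" by (rule sub_ideal_smult[OF I carrier_is_submodule])
  let ?S = "span R M (C \<union> ?X)"
  have S: "sub ?S" using sub_subset[OF C] sub_subset[OF X] by (intro sub_span) blast
  have sub': "submodule (ideal_smult Q I (carrier Q)) R Q"
    by (rule Q.sub_ideal_smult[OF I Q.carrier_is_submodule])
  have "ideal_smult Q I (carrier Q) = proj ` ?X"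
    unfolding quot_module_simps(1) using I by (intro ideal_smult_quot_module order_refl) (rule R.ideal_carrier_subset)
  also have "\<dots> = proj ` ?S"
  proof
    show "proj ` ?X \<subseteq> proj ` ?S" using span_superset[of "C \<union> ?X"] by blast
    show "proj ` ?S \<subseteq> proj ` ?X"
    proof (rule image_subsetI)
      fix s assume "s \<in> ?S"
      then obtain c x where cx: "c \<in> C" "x \<in> ?X" "s = c \<oplus>\<^bsub>M\<^esub> x" unfolding span_Un_iff[OF C X] by blast
      have cc: "c \<in> carrier M" "x \<in> carrier M" using sub_carr[OF C cx(1)] sub_carr[OF X cx(2)] .
      have "s \<ominus>\<^bsub>M\<^esub> x = c" using cc by (simp add: cx(3) a_minus_def M.a_assoc M.r_neg)
      then have "proj s = proj x" using proj_eq_iff[of s x] cc cx by simp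
      then show "proj s \<in> proj ` ?X" using cx(2) by blast
    qed
  qed
  finally have eq: "ideal_smult Q I (carrier Q) = proj ` ?S" .
  have CS: "C \<subseteq> ?S" using span_superset[of "C \<union> ?X"] by blast
  have "module_length R (quot_module Q (ideal_smult Q I (carrier Q))) =
      len (\<lambda>L. submodule L R Q) (ideal_smult Q I (carrier Q)) (carrier Q)"
    by (rule Q.module_length_quot_module[OF sub'])
  also have "\<dots> = len (\<lambda>L. submodule L R Q) (proj ` ?S) (proj ` carrier M)"
    unfolding eq by (simp only: quot_module_simps(1))
  also have "\<dots> = len sub ?S (carrier M)"
    by (rule len_quot_module[OF S carrier_is_submodule CS sub_subset[OF S]])
  finally show ?thesis .
qed

end

section \<open>Submodules as modules in their own right\<close>

lemma submodule_restrict_iff: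
  assumes A: "sub A"
  shows "submodule N R (M\<lparr>carrier := A\<rparr>) \<longleftrightarrow> sub N \<and> N \<subseteq> A"
proof -
  interpret A: module R "M\<lparr>carrier := A\<rparr>" by (rule submodule.submodule_is_module[OF A module_axioms])
  show ?thesis
  proof
    assume N: "submodule N R (M\<lparr>carrier := A\<rparr>)"
    have NA: "N \<subseteq> A" using A.sub_subset[OF N] by simp
    have sm: "a \<odot>\<^bsub>M\<^esub> x \<in> N" if "a \<in> carrier R" "x \<in> N" for a x using A.sub_smult[OF N that] by simp
    have "sub N"
    proof (rule submoduleI)
      show c: "N \<subseteq> carrier M" using NA sub_subset[OF A] by blast
      show "\<zero>\<^bsub>M\<^esub> \<in> N" using A.sub_zero[OF N] by simp
      show "x \<oplus>\<^bsub>M\<^esub> y \<in> N" if "x \<in> N" "y \<in> N" for x y using A.sub_add[OF N that] by simp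
      show "a \<odot>\<^bsub>M\<^esub> x \<in> N" if "a \<in> carrier R" "x \<in> N" for a x by (rule sm[OF that])
      show "\<ominus>\<^bsub>M\<^esub> x \<in> N" if "x \<in> N" for x
        using sm[of "\<ominus>\<^bsub>R\<^esub> \<one>\<^bsub>R\<^esub>" x] that minus_eq_smult[OF subsetD[OF c that]] by simp
    qed
    then show "sub N \<and> N \<subseteq> A" using NA by blast
  next
    assume N: "sub N \<and> N \<subseteq> A"
    then have sN: "sub N" by blast
    have sm: "a \<odot>\<^bsub>M\<^esub> x \<in> N" if "a \<in> carrier R" "x \<in> N" for a x by (rule sub_smult[OF sN that])
    show "submodule N R (M\<lparr>carrier := A\<rparr>)"
    \<comment> \<open>The additive inverse in the restricted record is described relative to the
      smaller carrier. Writing it as multiplication by \<open>-1\<close> avoids comparing the two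
      inverses.\<close>
    proof (rule A.submoduleI)
      show "\<ominus>\<^bsub>M\<lparr>carrier := A\<rparr>\<^esub> x \<in> N" if "x \<in> N" for x
      proof -
        have "x \<in> carrier (M\<lparr>carrier := A\<rparr>)" using that N by auto
        then show ?thesis using sm[of "\<ominus>\<^bsub>R\<^esub> \<one>\<^bsub>R\<^esub>" x] that by (simp add: A.minus_eq_smult)
      qed
    qed (use N sub_zero[OF sN] sub_add[OF sN] sm in auto)
  qed
qed

lemma ideal_smult_restrict: "ideal_smult (M\<lparr>carrier := A\<rparr>) I N = ideal_smult M I N"
proof
  show "ideal_smult (M\<lparr>carrier := A\<rparr>) I N \<subseteq> ideal_smult M I N"
  proof
    fix x assume "x \<in> ideal_smult (M\<lparr>carrier := A\<rparr>) I N"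
    then show "x \<in> ideal_smult M I N"
      by induction (auto intro: ideal_smult.intros)
  qed
  show "ideal_smult M I N \<subseteq> ideal_smult (M\<lparr>carrier := A\<rparr>) I N"
  proof
    fix x assume "x \<in> ideal_smult M I N"
    then show "x \<in> ideal_smult (M\<lparr>carrier := A\<rparr>) I N"
    proof induction
      case (smult a x)
      then show ?case using ideal_smult.smult[of a I x N "M\<lparr>carrier := A\<rparr>"] by simp
    next
      case (add x y)
      then show ?case using ideal_smult.add[of x "M\<lparr>carrier := A\<rparr>" I N y] by simp
    qed
  qed
qed

lemma len_restrict:
  assumes A: "sub A"
  shows "len (\<lambda>L. submodule L R (M\<lparr>carrier := A\<rparr>)) X A = len sub X A"
proof -
  have "has_chain (\<lambda>L. submodule L R (M\<lparr>carrier := A\<rparr>)) n X A \<longleftrightarrow> has_chain sub n X A" for n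
    unfolding has_chain_def submodule_restrict_iff[OF A] by (intro ex_cong1 conj_cong refl) blast
  then show ?thesis unfolding len_def by simp
qed

lemma span_restrict:
  assumes A: "sub A" and X: "X \<subseteq> A"
  shows "span R (M\<lparr>carrier := A\<rparr>) X = span R M X"
proof
  interpret A: module R "M\<lparr>carrier := A\<rparr>" by (rule submodule.submodule_is_module[OF A module_axioms])
  have sX: "sub (span R M X)" using X sub_subset[OF A] by (intro sub_span) blast
  have "span R M X \<subseteq> A" by (rule span_least[OF A X])
  then have "submodule (span R M X) R (M\<lparr>carrier := A\<rparr>)" using submodule_restrict_iff[OF A] sX by blast
  then show "span R (M\<lparr>carrier := A\<rparr>) X \<subseteq> span R M X" by (rule A.span_least) (rule span_superset)
  have "submodule (span R (M\<lparr>carrier := A\<rparr>) X) R (M\<lparr>carrier := A\<rparr>)" using X by (intro A.sub_span) simp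
  then have "sub (span R (M\<lparr>carrier := A\<rparr>) X)" using submodule_restrict_iff[OF A] by blast
  then show "span R M X \<subseteq> span R (M\<lparr>carrier := A\<rparr>) X" by (rule span_least) (rule A.span_superset)
qed

lemma module_length_restrict_quot:
  assumes A: "sub A" and I: "ideal I R"
  shows "module_length R (quot_module (M\<lparr>carrier := A\<rparr>)
      (ideal_smult (M\<lparr>carrier := A\<rparr>) I (carrier (M\<lparr>carrier := A\<rparr>)))) = len sub (ideal_smult M I A) A"
proof -
  interpret A: module R "M\<lparr>carrier := A\<rparr>" by (rule submodule.submodule_is_module[OF A module_axioms])
  have s: "submodule (ideal_smult (M\<lparr>carrier := A\<rparr>) I (carrier (M\<lparr>carrier := A\<rparr>))) R (M\<lparr>carrier := A\<rparr>)"
    by (rule A.sub_ideal_smult[OF I A.carrier_is_submodule])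
  show ?thesis using A.module_length_quot_module[OF s] len_restrict[OF A] by (simp add: ideal_smult_restrict)
qed

lemma module_length_restrict_quot_quot:
  assumes A: "sub A" and C: "sub C" and CA: "C \<subseteq> A" and I: "ideal I R"
  shows "module_length R (quot_module (quot_module (M\<lparr>carrier := A\<rparr>) C)
      (ideal_smult (quot_module (M\<lparr>carrier := A\<rparr>) C) I (carrier (quot_module (M\<lparr>carrier := A\<rparr>) C)))) =
    len sub (span R M (C \<union> ideal_smult M I A)) A"
proof -
  interpret A: module R "M\<lparr>carrier := A\<rparr>" by (rule submodule.submodule_is_module[OF A module_axioms])
  have C': "submodule C R (M\<lparr>carrier := A\<rparr>)" using submodule_restrict_iff[OF A] C CA by blast
  have "C \<union> ideal_smult M I A \<subseteq> A" using CA ideal_smult_le[OF I A] by blast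
  then show ?thesis
    using A.module_length_quot_quot[OF C' I] len_restrict[OF A] span_restrict[OF A]
    by (simp add: ideal_smult_restrict)
qed

lemma annihilator_restrict_quot:
  assumes A: "sub A" and C: "sub C" and CA: "C \<subseteq> A"
  shows "annihilator R (quot_module (M\<lparr>carrier := A\<rparr>) C) = {a \<in> carrier R. \<forall>x\<in>A. a \<odot>\<^bsub>M\<^esub> x \<in> C}"
proof -
  interpret A: module R "M\<lparr>carrier := A\<rparr>" by (rule submodule.submodule_is_module[OF A module_axioms])
  have C': "submodule C R (M\<lparr>carrier := A\<rparr>)" using submodule_restrict_iff[OF A] C CA by blast
  show ?thesis using A.annihilator_quot_module[OF C'] by simp
qed

end

section \<open>From Hilbert functions to Hilbert coefficients\<close>

lemma sum_atMost_change:
  fixes f :: "nat \<Rightarrow> int"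
  assumes "\<And>j. a < j \<Longrightarrow> f j = 0" "\<And>j. b < j \<Longrightarrow> f j = 0"
  shows "sum f {..a} = sum f {..b}"
proof -
  have "sum f {..a} = sum f {..a + b}" by (rule sum.mono_neutral_left) (use assms in auto)
  also have "\<dots> = sum f {..b}" by (rule sum.mono_neutral_right) (use assms in auto)
  finally show ?thesis .
qed

text \<open>For fixed large \<open>k\<close> the growth in \<open>n\<close> kills the coefficients
  of \<open>nbinom j n\<close> with \<open>j > r\<close>. These are combinations of the
  \<open>nbinom l k\<close> that vanish for all large \<open>k\<close>, so their entries in the
  table are zero. The second conclusion exchanges the variables; it stays conditional on
  \<open>s\<close> so that an infinite analytic spread is not excluded.\<close>

lemma bivariate_hilbert_polynomial:
  fixes H :: "nat \<Rightarrow> nat \<Rightarrow> nat"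
  assumes bi: "binumerical (\<lambda>n k. int (H n k))"
    and gr: "\<forall>\<^sub>F k in sequentially. growth (Suc r) (\<lambda>n. H n k)"
  obtains E d N where
    "\<And>n k. N \<le> n \<Longrightarrow> N \<le> k \<Longrightarrow> int (H n k) = (\<Sum>j\<le>r. \<Sum>l\<le>d. E j l * nbinom j n * nbinom l k)"
    "\<And>s j l. (\<And>n. growth s (\<lambda>k. H n k)) \<Longrightarrow> s \<le> l \<Longrightarrow> E j l = 0"
proof -
  have "\<exists>E d N. \<forall>n\<ge>N. \<forall>k\<ge>N. int (H n k) = (\<Sum>j\<le>d. \<Sum>l\<le>(d::nat). E j l * nbinom j n * nbinom l k)"
    by (rule binumerical_expansion[OF bi]) blast
  then obtain E0 d N0 where E0: "\<And>n k. N0 \<le> n \<Longrightarrow> N0 \<le> k \<Longrightarrow>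
      int (H n k) = (\<Sum>j\<le>d. \<Sum>l\<le>(d::nat). E0 j l * nbinom j n * nbinom l k)"
    by blast
  obtain N1 where N1: "\<And>k. N1 \<le> k \<Longrightarrow> growth (Suc r) (\<lambda>n. H n k)"
    using gr unfolding eventually_sequentially by blast
  have zero: "c l = 0" if "\<forall>\<^sub>F n in sequentially. (\<Sum>j\<le>d. c j * nbinom j n) = 0" "l \<le> d" for c l
    by (rule growth_coeffs_zero[where r = 0 and g = "\<lambda>_. 0" and d = d and c = c]) (use that in simp_all)
  have row: "E0 j l = 0" if j: "r < j" "j \<le> d" and l: "l \<le> d" for j l
  proof (rule zero[OF _ l], unfold eventually_sequentially, intro exI allI impI)
    fix k assume k: "max N0 N1 \<le> k"
    have "(\<Sum>j\<le>d. (\<Sum>l\<le>d. E0 j l * nbinom l k) * nbinom j n) = int (H n k)" if "N0 \<le> n" for n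
    proof -
      have "int (H n k) = (\<Sum>j\<le>d. \<Sum>l\<le>d. E0 j l * nbinom j n * nbinom l k)"
        using that k by (intro E0) auto
      then show ?thesis
        unfolding sum_distrib_right by (simp only: mult_ac)
    qed
    then have "\<forall>\<^sub>F n in sequentially. (\<Sum>j\<le>d. (\<Sum>l\<le>d. E0 j l * nbinom l k) * nbinom j n) = int (H n k)"
      unfolding eventually_sequentially by blast
    from growth_coeffs_zero[OF N1 this, of j] k j show "(\<Sum>l\<le>d. E0 j l * nbinom l k) = 0" by simp
  qed
  have col: "E0 j l = 0" if s: "\<And>n. growth s (\<lambda>k. H n k)" and l: "s \<le> l" "l \<le> d" and j: "j \<le> d" for s j l
  proof (rule zero[OF _ j, of "\<lambda>j. E0 j l"], unfold eventually_sequentially, intro exI allI impI)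
    fix n assume n: "N0 \<le> n"
    have "(\<Sum>l\<le>d. (\<Sum>j\<le>d. E0 j l * nbinom j n) * nbinom l k) = int (H n k)" if "N0 \<le> k" for k
      unfolding E0[OF n that] sum_distrib_right by (rule sum.swap)
    then have "\<forall>\<^sub>F k in sequentially. (\<Sum>l\<le>d. (\<Sum>j\<le>d. E0 j l * nbinom j n) * nbinom l k) = int (H n k)"
      unfolding eventually_sequentially by blast
    from growth_coeffs_zero[OF s this l] show "(\<Sum>j\<le>d. E0 j l * nbinom j n) = 0" .
  qed
  \<comment> \<open>Zero outside the table, so that the vanishing statement holds for all
    \<open>j\<close> and \<open>l\<close>.\<close>
  define E where "E j l = (if j \<le> d \<and> l \<le> d then E0 j l else 0)" for j l
  show ?thesis
  proof (rule that)
    show "int (H n k) = (\<Sum>j\<le>r. \<Sum>l\<le>d. E j l * nbinom j n * nbinom l k)" if "N0 \<le> n" "N0 \<le> k" for n k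
    proof -
      have "int (H n k) = (\<Sum>j\<le>d. \<Sum>l\<le>d. E j l * nbinom j n * nbinom l k)"
        unfolding E0[OF that] E_def by (intro sum.cong) auto
      also have "\<dots> = (\<Sum>j\<le>r. \<Sum>l\<le>d. E j l * nbinom j n * nbinom l k)"
      proof (rule sum_atMost_change)
        show "(\<Sum>l\<le>d. E j l * nbinom j n * nbinom l k) = 0" if "d < j" for j
          using that by (intro sum.neutral) (simp add: E_def)
        show "(\<Sum>l\<le>d. E j l * nbinom j n * nbinom l k) = 0" if "r < j" for j
          using that row by (intro sum.neutral) (simp add: E_def)
      qed
      finally show ?thesis .
    qed
    show "E j l = 0" if "\<And>n. growth s (\<lambda>k. H n k)" "s \<le> l" for s j l
      using col[OF that(1)] that(2) unfolding E_def by simp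
  qed
qed

fun nbinom_poly :: "nat \<Rightarrow> rat poly" where
  "nbinom_poly 0 = 1"
| "nbinom_poly (Suc l) = smult (1 / of_nat (Suc l)) (nbinom_poly l * [:of_nat (Suc l), 1:])"

lemma poly_nbinom_poly: "poly (nbinom_poly l) (of_nat k) = of_int (nbinom l k)"
proof (induction l)
  case (Suc l)
  have "rat_of_int (int (Suc l) * nbinom (Suc l) k) = of_int (nbinom l k * int (k + l + 1))"
    by (simp only: nbinom_rec)
  then have "rat_of_nat (Suc l) * of_int (nbinom (Suc l) k) = of_int (nbinom l k) * (of_nat k + of_nat (Suc l))"
    by (simp add: algebra_simps)
  then show ?case using Suc by (simp add: field_simps)
qed simp

lemma degree_nbinom_poly: "Polynomial.degree (nbinom_poly l) \<le> l"
proof (induction l)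
  case (Suc l)
  have "Polynomial.degree (nbinom_poly (Suc l)) \<le>
      Polynomial.degree (nbinom_poly l * [:of_nat (Suc l), 1:])"
    by (simp add: degree_smult_le)
  also have "\<dots> \<le> Polynomial.degree (nbinom_poly l) + Polynomial.degree [:rat_of_nat (Suc l), 1:]"
    by (rule degree_mult_le)
  also have "\<dots> \<le> Suc l" using Suc by simp
  finally show ?case .
qed simp

text \<open>The bound is asked only of indices with nonzero coefficient. If there are none, the
  polynomial is zero and has degree \<open>- \<infinity>\<close>, as is required when the bound is
  negative.\<close>

lemma eventually_poly_deg_le_nbinom_sum:
  assumes f: "\<forall>\<^sub>F k in sequentially. f k = (\<Sum>l\<le>d. c l * nbinom l k)"
    and b: "\<And>l. l \<le> d \<Longrightarrow> c l \<noteq> 0 \<Longrightarrow> ereal (real l) \<le> b"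
  shows "eventually_poly_deg_le f b"
proof -
  define p where "p = (\<Sum>l\<le>d. smult (of_int (c l)) (nbinom_poly l))"
  have "of_int (\<Sum>l\<le>d. c l * nbinom l k) = poly p (of_nat k)" for k
    unfolding p_def by (simp add: poly_sum poly_nbinom_poly)
  then have "\<forall>\<^sub>F k in sequentially. of_int (f k) = poly p (of_nat k)"
    using f by (auto elim: eventually_mono)
  moreover have "p = 0 \<or> ereal (real (Polynomial.degree p)) \<le> b"
  proof (cases "\<forall>l\<le>d. c l = 0")
    case True
    then show ?thesis unfolding p_def by simp
  next
    case False
    define m where "m = Max {l. l \<le> d \<and> c l \<noteq> 0}"
    have "m \<in> {l. l \<le> d \<and> c l \<noteq> 0}" unfolding m_def using False by (intro Max_in) auto
    then have m: "m \<le> d" "c m \<noteq> 0" by auto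
    have le: "l \<le> m" if "l \<le> d" "c l \<noteq> 0" for l unfolding m_def using that by (intro Max_ge) auto
    have "Polynomial.degree p \<le> m"
      unfolding p_def
    proof (rule degree_sum_le)
      show "Polynomial.degree (smult (rat_of_int (c l)) (nbinom_poly l)) \<le> m" if "l \<in> {..d}" for l
        using le[of l] that degree_nbinom_poly[of l] degree_smult_le[of "rat_of_int (c l)" "nbinom_poly l"]
        by (cases "c l = 0") auto
    qed simp
    then have "ereal (real (Polynomial.degree p)) \<le> ereal (real m)" by simp
    then show ?thesis using order_trans[OF _ b[OF m]] by blast
  qed
  ultimately show ?thesis unfolding eventually_poly_deg_le_def by blast
qed

text \<open>The signed differences of two candidate sequences, reindexed by the degree
  \<open>r - i\<close>, expand 0 in the basis \<open>nbinom\<close> and therefore vanish; indices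
  above \<open>r\<close> agree by the normalisation to zero.\<close>

lemma hilbert_coeff_eqI:
  assumes dim: "module_dim R N = ereal (real r)" and e: "is_hilbert_coeffs R \<mm> N r e" and z: "\<forall>i>r. e i = 0"
  shows "hilbert_coeff R \<mm> N = e"
  unfolding hilbert_coeff_def
proof (rule the_equality)
  show "\<exists>r. module_dim R N = ereal (real r) \<and> is_hilbert_coeffs R \<mm> N r e \<and> (\<forall>i>r. e i = 0)"
    using assms by blast
  fix e' assume "\<exists>r. module_dim R N = ereal (real r) \<and> is_hilbert_coeffs R \<mm> N r e' \<and> (\<forall>i>r. e' i = 0)"
  then have e': "is_hilbert_coeffs R \<mm> N r e'" "\<forall>i>r. e' i = 0" using dim by auto
  define c where "c j = (-1) ^ (r - j) * (e (r - j) - e' (r - j))" for j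
  have "\<forall>\<^sub>F n in sequentially. (\<Sum>j\<le>r. c j * nbinom j n) = 0"
    using e e'(1) unfolding is_hilbert_coeffs_def
  proof eventually_elim
    case (elim n)
    then have eq: "(\<Sum>i\<le>r. (-1) ^ i * e i * int ((n + r - i) choose (r - i))) =
        (\<Sum>i\<le>r. (-1) ^ i * e' i * int ((n + r - i) choose (r - i)))" by auto
    have "(\<Sum>j\<le>r. c j * nbinom j n) = (\<Sum>i\<le>r. c (r - i) * nbinom (r - i) n)"
      by (rule sum.reindex_bij_witness[of _ "\<lambda>i. r - i" "\<lambda>i. r - i"]) auto
    also have "\<dots> = (\<Sum>i\<le>r. (-1) ^ i * e i * int ((n + r - i) choose (r - i)) -
        (-1) ^ i * e' i * int ((n + r - i) choose (r - i)))"
      by (intro sum.cong refl) (simp add: c_def nbinom_def algebra_simps)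
    also have "\<dots> = 0" unfolding sum_subtractf using eq by simp
    finally show ?case .
  qed
  then have c0: "c j = 0" if "j \<le> r" for j
    by (intro growth_coeffs_zero[where r = 0 and g = "\<lambda>_. 0" and d = r and c = c]) (use that in simp_all)
  show "e' = e"
  proof
    fix i
    show "e' i = e i"
    proof (cases "i \<le> r")
      case True
      then show ?thesis using c0[of "r - i"] unfolding c_def by simp
    next
      case False
      then show ?thesis using z e'(2) by simp
    qed
  qed
qed

text \<open>No natural \<open>r\<close> has the value \<open>\<infinity>\<close>, so the description
  ranges over the empty predicate and yields the same default for every module of infinite
  dimension.\<close>

lemma hilbert_coeff_infinite_dim:
  "module_dim R N = \<infinity> \<Longrightarrow> hilbert_coeff R \<mm> N = (THE e. False)"
  unfolding hilbert_coeff_def by simp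

text \<open>\<open>E\<close> is indexed by the degree in \<open>n\<close>, while \<open>e_i\<close>
  belongs to degree \<open>r - i\<close> and carries the sign \<open>(-1)^i\<close>.\<close>

lemma hilbert_coeff_of_expansion:
  fixes E :: "nat \<Rightarrow> int"
  assumes dim: "module_dim R N = ereal (real r)"
    and len: "\<And>n. module_length R (quot_module N (ideal_smult N (ideal_pow R \<mm> (n + 1)) (carrier N))) = enat (H n)"
    and H: "\<forall>\<^sub>F n in sequentially. int (H n) = (\<Sum>j\<le>r. E j * nbinom j n)"
    and i: "i \<le> r"
  shows "hilbert_coeff R \<mm> N i = (-1) ^ i * E (r - i)"
proof -
  define e where "e i = (if i \<le> r then (-1) ^ i * E (r - i) else 0)" for i
  have "is_hilbert_coeffs R \<mm> N r e"
    unfolding is_hilbert_coeffs_def using H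
  proof eventually_elim
    case (elim n)
    have "(\<Sum>j\<le>r. E j * nbinom j n) = (\<Sum>i\<le>r. E (r - i) * nbinom (r - i) n)"
      by (rule sum.reindex_bij_witness[of _ "\<lambda>i. r - i" "\<lambda>i. r - i"]) auto
    also have "\<dots> = (\<Sum>i\<le>r. (-1) ^ i * e i * int ((n + r - i) choose (r - i)))"
    proof (rule sum.cong[OF refl])
      fix i assume "i \<in> {..r}"
      moreover have "(-1) ^ i * ((-1) ^ i * E (r - i)) = E (r - i)"
        unfolding mult.assoc[symmetric] power_mult_distrib[symmetric] by simp
      ultimately show "E (r - i) * nbinom (r - i) n = (-1) ^ i * e i * int ((n + r - i) choose (r - i))"
        by (simp add: e_def nbinom_def)
    qed
    finally show ?case using elim len by simp
  qed
  then have "hilbert_coeff R \<mm> N = e" by (rule hilbert_coeff_eqI[OF dim]) (simp add: e_def)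
  then show ?thesis using i by (simp add: e_def)
qed

lemma growth_Suc_shift:
  assumes "growth d f"
  shows "growth d (\<lambda>n. f (Suc n))"
proof (cases d)
  case 0
  then show ?thesis using assms eventually_sequentially_Suc[of "\<lambda>n. f n = 0"] by simp
next
  case (Suc e)
  then obtain C where C: "\<forall>\<^sub>F k in sequentially. f k \<le> C * (k + 1) ^ e" using assms by auto
  then have "\<forall>\<^sub>F k in sequentially. f (Suc k) \<le> C * (Suc k + 1) ^ e"
    using eventually_sequentially_Suc[of "\<lambda>k. f k \<le> C * (k + 1) ^ e"] by simp
  then have "\<forall>\<^sub>F k in sequentially. f (Suc k) \<le> (C * 2 ^ e) * (k + 1) ^ e"
  proof eventually_elim
    case (elim k)
    \<comment> \<open>The source of the factor \<open>2 ^ e\<close> in the constant: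
      \<open>k + 2 \<le> 2 * (k + 1)\<close>.\<close>
    have "(Suc k + 1) ^ e \<le> (2 * (k + 1)) ^ e" by (intro power_mono) auto
    then have "C * (Suc k + 1) ^ e \<le> C * (2 * (k + 1)) ^ e" by (rule mult_le_mono2)
    also have "\<dots> = (C * 2 ^ e) * (k + 1) ^ e" unfolding power_mult_distrib by (simp only: mult.assoc)
    finally show ?case by (rule order_trans[OF elim])
  qed
  then show ?thesis unfolding Suc growth.simps by (rule exI)
qed

text \<open>The value \<open>- \<infinity>\<close> belongs to a ring without primes; a nonempty
  finite set of chain lengths attains its supremum.\<close>

lemma krull_dim_cases:
  obtains "krull_dim R = - \<infinity>" | "krull_dim R = \<infinity>" | r where "krull_dim R = ereal (real r)"
proof -
  define T where "T = {n. \<exists>P :: nat \<Rightarrow> 'a set. (\<forall>i\<le>n. primeideal (P i) R) \<and> (\<forall>i<n. P i \<subset> P (Suc i))}"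
  have kd: "krull_dim R = Sup ((\<lambda>n. ereal (real n)) ` T)"
    unfolding krull_dim_def T_def by (rule arg_cong[of _ _ Sup]) blast
  show ?thesis
  proof (cases "finite T")
    case False
    have "krull_dim R = \<infinity>"
      unfolding kd
    proof (rule SUP_PInfty)
      fix n :: nat
      obtain m where "m \<in> T" "n \<le> m" using False by (metis finite_nat_set_iff_bounded_le nat_le_linear)
      then show "\<exists>i\<in>T. ereal (real n) \<le> ereal (real i)" by auto
    qed
    then show ?thesis using that(2) by blast
  next
    case True
    show ?thesis
    proof (cases "T = {}")
      case True
      then show ?thesis using that(1) kd by (simp add: bot_ereal_def)
    next
      case False
      have "krull_dim R = ereal (real (Max T))"
        unfolding kd
      proof (rule antisym)
        show "(SUP n\<in>T. ereal (real n)) \<le> ereal (real (Max T))" using True by (intro SUP_least) simp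
        show "ereal (real (Max T)) \<le> (SUP n\<in>T. ereal (real n))" using True False by (intro SUP_upper Max_in)
      qed
      then show ?thesis using that(3) by blast
    qed
  qed
qed

section \<open>Chains of primes in quotient rings\<close>

lemma (in cring) primeideal_quotient:
  assumes A: "ideal A R" and P: "primeideal P R" and AP: "A \<subseteq> P"
  shows "primeideal ((+>) A ` P) (R Quot A)"
    and "x \<in> carrier R \<Longrightarrow> A +> x \<in> (+>) A ` P \<longleftrightarrow> x \<in> P"
proof -
  interpret A: ideal A R by (rule A)
  interpret P: primeideal P R by (rule P)
  interpret h: ring_hom_cring R "R Quot A" "(+>) A" by (rule A.rcos_ring_hom_cring[OF is_cring])
  have mem: "A +> x \<in> (+>) A ` P \<longleftrightarrow> x \<in> P" if x: "x \<in> carrier R" for x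
  proof
    assume "A +> x \<in> (+>) A ` P"
    then obtain y where y: "y \<in> P" "A +> x = A +> y" by blast
    then have "x \<ominus> y \<in> P" using coset_eq_iff[OF A x P.Icarr[OF y(1)]] AP by blast
    then have "x \<ominus> y \<oplus> y \<in> P" using y(1) by (rule P.a_closed)
    then show "x \<in> P" using x P.Icarr[OF y(1)] by (simp add: a_minus_def a_assoc l_neg)
  qed blast
  have carr: "carrier (R Quot A) = (+>) A ` carrier R" unfolding FactRing_def A_RCOSETS_def' by auto
  show "x \<in> carrier R \<Longrightarrow> A +> x \<in> (+>) A ` P \<longleftrightarrow> x \<in> P" by (rule mem)
  show "primeideal ((+>) A ` P) (R Quot A)"
  proof (rule primeidealI[OF ring_ideal_imp_quot_ideal[OF A P.is_ideal] A.quotient_is_cring[OF is_cring]])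
    show "carrier (R Quot A) \<noteq> (+>) A ` P"
    proof
      assume "carrier (R Quot A) = (+>) A ` P"
      then have "A +> \<one> \<in> (+>) A ` P" using carr by blast
      then have "\<one> \<in> P" using mem[OF one_closed] by blast
      then show False using P.one_imp_carrier P.I_notcarr by simp
    qed
    fix X Y assume "X \<in> carrier (R Quot A)" "Y \<in> carrier (R Quot A)" and XY: "X \<otimes>\<^bsub>R Quot A\<^esub> Y \<in> (+>) A ` P"
    then obtain x y where xy: "x \<in> carrier R" "X = A +> x" "y \<in> carrier R" "Y = A +> y" unfolding carr by blast
    then have "A +> (x \<otimes> y) \<in> (+>) A ` P" using XY h.hom_mult[of x y] by simp
    then have "x \<otimes> y \<in> P" using mem[OF m_closed[OF xy(1,3)]] by blast
    then show "X \<in> (+>) A ` P \<or> Y \<in> (+>) A ` P" using P.I_prime[of x y] xy by blast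
  qed
qed

text \<open>A chain of \<open>n\<close> primes above \<open>A\<close> has \<open>n - 1\<close>
  inclusions in the quotient, whence \<open>Suc r\<close> in the bound.\<close>

lemma (in cring) prime_chain_le_krull_dim_quotient:
  assumes A: "ideal A R" and dim: "krull_dim (R Quot A) = ereal (real r)"
    and P: "\<And>i. i < n \<Longrightarrow> primeideal (P i) R \<and> A \<subseteq> P i" and lt: "\<And>i. Suc i < n \<Longrightarrow> P i \<subset> P (Suc i)"
  shows "n \<le> Suc r"
proof (cases n)
  case (Suc m)
  have "(+>) A ` P i \<subset> (+>) A ` P (Suc i)" if "i < m" for i
  proof -
    have i: "i < n" "Suc i < n" using that Suc by auto
    obtain x where x: "x \<in> P (Suc i)" "x \<notin> P i" using lt[OF i(2)] by blast
    have "primeideal (P (Suc i)) R" using P[OF i(2)] by blast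
    then have "x \<in> carrier R" using x(1) by (rule ideal.Icarr[OF primeideal.axioms(1)])
    then have "A +> x \<notin> (+>) A ` P i" using primeideal_quotient(2)[OF A, of "P i" x] P[OF i(1)] x(2) by blast
    then show ?thesis using x(1) lt[OF i(2)] by blast
  qed
  moreover have "primeideal ((+>) A ` P i) (R Quot A)" if "i \<le> m" for i
    using primeideal_quotient(1)[OF A] P[of i] that Suc by simp
  ultimately have "ereal (real m) \<le> krull_dim (R Quot A)"
    unfolding krull_dim_def
    by (intro Sup_upper CollectI exI[of _ m] conjI refl exI[of _ "\<lambda>i. (+>) A ` P i"]) auto
  then show ?thesis using dim Suc by simp
qed simp

lemma eventual_value_eq:
  assumes "\<forall>\<^sub>F k in sequentially. f k = c"
  shows "eventual_value f = c"
  unfolding eventual_value_def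
proof (rule the_equality)
  show "\<forall>\<^sub>F k in sequentially. f k = c" by (rule assms)
  fix c' assume "\<forall>\<^sub>F k in sequentially. f k = c'"
  with assms have "\<forall>\<^sub>F k in sequentially. c' = c" by eventually_elim simp
  then show "c' = c" by simp
qed

lemma eventual_value_shift: "eventual_value (\<lambda>k. f (k + n)) = eventual_value f"
  unfolding eventual_value_def eventually_sequentially_seg[of "\<lambda>k. f k = _"] ..

text \<open>Composition with \<open>X - n\<close> undoes the shift and preserves the degree.\<close>

lemma eventually_poly_deg_le_shift:
  assumes "eventually_poly_deg_le (\<lambda>k. f (k + n)) b"
  shows "eventually_poly_deg_le f b"
proof -
  from assms obtain p :: "rat poly" where "(p = 0 \<or> ereal (real (Polynomial.degree p)) \<le> b) \<and>
    (\<forall>\<^sub>F k in sequentially. of_int (f (k + n)) = poly p (of_nat k))"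
    unfolding eventually_poly_deg_le_def by (rule exE)
  then have p: "p = 0 \<or> ereal (real (Polynomial.degree p)) \<le> b"
    "\<forall>\<^sub>F k in sequentially. of_int (f (k + n)) = poly p (of_nat k)" by simp_all
  define q where "q = pcompose p [:- of_nat n, 1:]"
  have "of_int (f (k + n)) = poly q (of_nat (k + n)) \<longleftrightarrow> of_int (f (k + n)) = poly p (of_nat k)" for k
    unfolding q_def by (simp add: poly_pcompose)
  then have "\<forall>\<^sub>F k in sequentially. of_int (f (k + n)) = poly q (of_nat (k + n))" using p(2) by simp
  then have "\<forall>\<^sub>F k in sequentially. of_int (f k) = poly q (of_nat k)"
    by (rule eventually_sequentially_seg[of "\<lambda>k. of_int (f k) = poly q (of_nat k)" n, THEN iffD1])
  moreover have "q = 0 \<or> ereal (real (Polynomial.degree q)) \<le> b"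
    using p(1) unfolding q_def by (auto simp: degree_pcompose)
  ultimately show ?thesis unfolding eventually_poly_deg_le_def by blast
qed

lemma (in noetherian_ring) ideal_chain_stabilizes:
  assumes f: "\<And>k. ideal (f k) R" and inc: "\<And>k. f k \<subseteq> f (Suc k)"
  obtains N where "\<And>k. N \<le> k \<Longrightarrow> f k = f N"
proof -
  have mono: "f i \<subseteq> f j" if "i \<le> j" for i j
    using that by (induction j rule: dec_induct) (use inc in blast)+
  have "range f \<noteq> {}" by simp
  from wf_ideals this show ?thesis
  proof (rule wfE_min')
    fix Z assume Z: "Z \<in> range f"
      "\<And>Y. (Y, Z) \<in> {(I', I). I \<in> {I. ideal I R} \<and> I' \<in> {I. ideal I R} \<and> I \<subset> I'} \<Longrightarrow> Y \<notin> range f"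
    then obtain N where N: "Z = f N" by blast
    show ?thesis
    proof (rule that)
      fix k assume "N \<le> k"
      then have "f N \<subseteq> f k" by (rule mono)
      moreover have "\<not> f N \<subset> f k" using Z(2)[of "f k"] f unfolding N by blast
      ultimately show "f k = f N" by (simp add: psubset_eq)
    qed
  qed
qed

section \<open>Hilbert coefficients of a graded family of modules\<close>

text \<open>In the three applications \<open>C k\<close> is \<open>I^(k+1) M\<close>,
  \<open>0\<close> and \<open>J^(k+n0) M\<close>, with \<open>A k\<close> equal to
  \<open>I^k M\<close> twice and then to \<open>I^(k+n0) M\<close>. The assumption \<open>JC\<close>
  makes the sum of all \<open>A k / C k\<close> a graded module over the Rees algebra of the acting
  ideal, and \<open>A_Suc\<close>, \<open>A_0\<close> say that \<open>E0\<close> generates it in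
  degree 0.\<close>

locale graded_family = fiber R \<mm> J + M?: module R M
  for R :: "('a, 'r) ring_scheme" (structure) and \<mm> J :: "'a set" and M :: "('a, 'b, 's) module_scheme" +
  fixes A C :: "nat \<Rightarrow> 'b set" and E0 :: "'b set"
  assumes A: "submodule (A k) R M" and C: "submodule (C k) R M" and CA: "C k \<subseteq> A k"
    and JC: "a \<in> J \<Longrightarrow> x \<in> C k \<Longrightarrow> a \<odot>\<^bsub>M\<^esub> x \<in> C (Suc k)"
    and A_Suc: "A (Suc k) = span R M (C (Suc k) \<union> ideal_smult M J (A k))"
    and A_0: "A 0 = span R M (C 0 \<union> E0)" and E0: "finite E0" "E0 \<subseteq> carrier M"
begin

definition fil :: "nat \<Rightarrow> nat \<Rightarrow> 'b set" where
  "fil n k = span R M (C k \<union> ideal_smult M (mpow n) (A k))"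

definition ann :: "nat \<Rightarrow> 'a set" where
  "ann k = {a \<in> carrier R. \<forall>x\<in>A k. a \<odot>\<^bsub>M\<^esub> x \<in> C k}"

lemma ann_ideal: "ideal (ann k) R"
proof -
  have "ideal (\<Inter>x\<in>A k. {a \<in> carrier R. a \<odot>\<^bsub>M\<^esub> x \<in> C k}) R"
  proof (rule i_Intersect)
    show "(\<lambda>x. {a \<in> carrier R. a \<odot>\<^bsub>M\<^esub> x \<in> C k}) ` A k \<noteq> {}" using M.sub_zero[OF A[of k]] by blast
    fix I assume "I \<in> (\<lambda>x. {a \<in> carrier R. a \<odot>\<^bsub>M\<^esub> x \<in> C k}) ` A k"
    then obtain x where x: "x \<in> A k" "I = {a \<in> carrier R. a \<odot>\<^bsub>M\<^esub> x \<in> C k}" by blast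
    show "ideal I R" unfolding x(2) by (rule M.ideal_colon[OF oneideal C M.sub_carr[OF A x(1)]])
  qed
  moreover have "(\<Inter>x\<in>A k. {a \<in> carrier R. a \<odot>\<^bsub>M\<^esub> x \<in> C k}) = ann k"
    unfolding ann_def using M.sub_zero[OF A[of k]] by auto
  ultimately show ?thesis by simp
qed

text \<open>\<open>A (Suc k) / C (Suc k)\<close> is generated by \<open>J\<close> times the
  preceding quotient, so an element that kills the latter kills the former. Hence the annihilators
  ascend and stabilise, which makes the dimension eventually constant.\<close>

lemma ann_mono: "ann k \<subseteq> ann (Suc k)"
proof
  fix a assume a: "a \<in> ann k"
  then have ac: "a \<in> carrier R" unfolding ann_def by simp
  have "A (Suc k) \<subseteq> {x \<in> carrier M. a \<odot>\<^bsub>M\<^esub> x \<in> C (Suc k)}"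
    unfolding A_Suc
  proof (rule M.span_least[OF M.sub_preimage[OF C ac]], rule Un_least)
    show "C (Suc k) \<subseteq> {x \<in> carrier M. a \<odot>\<^bsub>M\<^esub> x \<in> C (Suc k)}"
      using M.sub_smult[OF C ac] M.sub_carr[OF C] by blast
    show "ideal_smult M J (A k) \<subseteq> {x \<in> carrier M. a \<odot>\<^bsub>M\<^esub> x \<in> C (Suc k)}"
    proof (rule M.ideal_smult_subset[OF M.sub_preimage[OF C ac]])
      fix b x assume b: "b \<in> J" and x: "x \<in> A k"
      have bc: "b \<in> carrier R" by (rule ideal.Icarr[OF J b])
      have xc: "x \<in> carrier M" by (rule M.sub_carr[OF A x])
      have "a \<odot>\<^bsub>M\<^esub> x \<in> C k" using a x unfolding ann_def by blast
      then have "b \<odot>\<^bsub>M\<^esub> (a \<odot>\<^bsub>M\<^esub> x) \<in> C (Suc k)" by (rule JC[OF b])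
      moreover have "b \<odot>\<^bsub>M\<^esub> (a \<odot>\<^bsub>M\<^esub> x) = a \<odot>\<^bsub>M\<^esub> (b \<odot>\<^bsub>M\<^esub> x)"
        using ac bc xc by (simp add: M.smult_assoc1[symmetric] m_comm)
      ultimately show "b \<odot>\<^bsub>M\<^esub> x \<in> {x \<in> carrier M. a \<odot>\<^bsub>M\<^esub> x \<in> C (Suc k)}" using bc xc by simp
    qed
  qed
  then show "a \<in> ann (Suc k)" unfolding ann_def using ac by blast
qed

text \<open>Two estimates of one function. In \<open>k\<close>: the quotient of step
  \<open>j\<close> by step \<open>Suc j\<close> is generated by products of \<open>J^k\<close> with
  the finitely many monomials of bidegree \<open>(j, 0)\<close>, and \<open>\<mm> J^k\<close> sends
  these into step \<open>Suc j\<close>. In \<open>n\<close>: \<open>A k\<close> is generated modulo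
  \<open>C k\<close> by finitely many elements, which \<open>ann k + \<mm>^(n+1)\<close> sends into
  \<open>fil (Suc n) k\<close>.\<close>

theorem hilbert_function:
  obtains H where "\<And>n k. len (\<lambda>L. submodule L R M) (fil (Suc n) k) (A k) = enat (H n k)"
    "binumerical (\<lambda>n k. int (H n k))"
    "\<And>s n. growth s (hQ bottom) \<Longrightarrow> growth s (\<lambda>k. H n k)"
    "\<And>d k. growth d (hloc (ann k)) \<Longrightarrow> growth d (\<lambda>n. H n k)"
proof -
  obtain z :: "nat \<Rightarrow> 'a" and p q where z: "\<mm> = genideal R (z ` {..<p})" "p \<le> q"
    "J = genideal R (z ` {p..<q})" "\<And>i. i < q \<Longrightarrow> z i \<in> carrier R" using fam_generators by blast
  obtain g and e :: "nat \<Rightarrow> 'b" where e: "e ` {..<g} = E0" using finite_set_as_image[OF E0(1)] .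
  have zJ: "z i \<in> J" if "i \<in> {p..<q}" for i
  proof -
    have "z ` {p..<q} \<subseteq> genideal R (z ` {p..<q})" by (rule genideal_self) (use z(4) in auto)
    then show ?thesis using that z(3) by blast
  qed
  have "bigraded R M \<mm> z {..<p} {p..<q} {..<g} e C"
  proof (intro bigraded.intro bigraded_axioms.intro M.module_axioms mx z(1) C)
    show "z i \<in> carrier R" if "i \<in> {..<p} \<union> {p..<q}" for i using that z(2,4) by auto
    show "z i \<odot>\<^bsub>M\<^esub> x \<in> C (Suc k)" if "i \<in> {p..<q}" "x \<in> C k" for i x k
      by (rule JC[OF zJ[OF that(1)] that(2)])
    show "e \<gamma> \<in> carrier M" if "\<gamma> \<in> {..<g}" for \<gamma> using that e E0(2) by blast
  qed auto
  then interpret B: bigraded R M \<mm> z "{..<p}" "{p..<q}" "{..<g}" e C .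
  have J_gen: "a \<odot>\<^bsub>M\<^esub> x \<in> L"
    if "submodule L R M" "x \<in> carrier M" "\<And>i. i \<in> {p..<q} \<Longrightarrow> z i \<odot>\<^bsub>M\<^esub> x \<in> L" "a \<in> J" for a x L
    by (rule M.genideal_smult_in[OF that(1,2), of "z ` {p..<q}"]) (use that z(3,4) in auto)
  have F0: "B.F 0 k = A k" for k
  proof (induction k)
    case 0
    show ?case unfolding B.F_0_0 e A_0 ..
  next
    case (Suc k)
    have s: "submodule (span R M (C (Suc k) \<union> {z i \<odot>\<^bsub>M\<^esub> x |i x. i \<in> {p..<q} \<and> x \<in> A k})) R M"
      using B.sub_F[of 0 "Suc k"] unfolding B.F_Suc2 Suc .
    show ?case unfolding B.F_Suc2 Suc A_Suc
    proof
      show "span R M (C (Suc k) \<union> {z i \<odot>\<^bsub>M\<^esub> x |i x. i \<in> {p..<q} \<and> x \<in> A k})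
          \<subseteq> span R M (C (Suc k) \<union> ideal_smult M J (A k))"
        by (rule M.span_mono) (use zJ ideal_smult.smult[of _ J _ "A k" M] in blast)
      show "span R M (C (Suc k) \<union> ideal_smult M J (A k))
          \<subseteq> span R M (C (Suc k) \<union> {z i \<odot>\<^bsub>M\<^esub> x |i x. i \<in> {p..<q} \<and> x \<in> A k})" (is "_ \<subseteq> ?S")
      proof (rule M.span_least[OF s], rule Un_least)
        show "C (Suc k) \<subseteq> ?S" using M.span_superset[of "C (Suc k) \<union> {z i \<odot>\<^bsub>M\<^esub> x |i x. i \<in> {p..<q} \<and> x \<in> A k}"] by blast
        show "ideal_smult M J (A k) \<subseteq> ?S"
        proof (rule M.ideal_smult_subset[OF s])
          fix a x assume a: "a \<in> J" and x: "x \<in> A k"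
          show "a \<odot>\<^bsub>M\<^esub> x \<in> ?S"
          proof (rule J_gen[OF s M.sub_carr[OF A x] _ a])
            show "z i \<odot>\<^bsub>M\<^esub> x \<in> ?S" if "i \<in> {p..<q}" for i
              using that x by (intro M.span_base) blast
          qed
        qed
      qed
    qed
  qed
  have Fn: "B.F n k = fil n k" for n k
    unfolding fil_def B.F_eq[of n k] F0 ..
  have jp_F: "c \<odot>\<^bsub>M\<^esub> x \<in> B.F j (l + k)" if "c \<in> jp l" "x \<in> B.F j k" for c x j l k
    using that(1)
  proof (induction l arbitrary: c)
    case 0
    then show ?case using M.sub_smult[OF B.sub_F _ that(2)] by simp
  next
    case (Suc l)
    have xc: "x \<in> carrier M" by (rule M.sub_carr[OF B.sub_F that(2)])
    have I: "ideal {c \<in> carrier R. c \<odot>\<^bsub>M\<^esub> x \<in> B.F j (Suc l + k)} R"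
      by (rule M.ideal_colon[OF oneideal B.sub_F xc])
    have "ideal_prod R J (jp l) \<subseteq> {c \<in> carrier R. c \<odot>\<^bsub>M\<^esub> x \<in> B.F j (Suc l + k)}"
    proof (rule ideal_prod_subset[OF I])
      fix a b assume a: "a \<in> J" and b: "b \<in> jp l"
      have "b \<odot>\<^bsub>M\<^esub> x \<in> B.F j (l + k)" by (rule Suc.IH[OF b])
      then have "a \<odot>\<^bsub>M\<^esub> (b \<odot>\<^bsub>M\<^esub> x) \<in> B.F j (Suc (l + k))"
        using B.z_F2 by (intro J_gen[OF B.sub_F _ _ a] M.sub_carr[OF B.sub_F]) auto
      then show "a \<otimes> b \<in> {c \<in> carrier R. c \<odot>\<^bsub>M\<^esub> x \<in> B.F j (Suc l + k)}"
        using ideal.Icarr[OF J a] jp_carr[OF b] xc by (simp add: M.smult_assoc1)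
    qed
    then show ?case using Suc.prems unfolding ideal_pow_Suc'[OF J] by blast
  qed
  \<comment> \<open>Collecting the factors from the second kind of variables writes a monomial of
    bidegree \<open>(j, k)\<close> as an element of \<open>J^k\<close> times a monomial of bidegree
    \<open>(j, 0)\<close>.\<close>
  have val_split: "\<exists>c\<in>jp k. \<exists>r\<in>B.idx j 0. B.val t = c \<odot>\<^bsub>M\<^esub> B.val r" if "t \<in> B.idx j k" for t j k
    using that
  proof (induction k arbitrary: t)
    case 0
    have "B.val t = \<one> \<odot>\<^bsub>M\<^esub> B.val t" using B.val_closed[OF 0] by simp
    then show ?case using 0 by (metis ideal_pow_0 one_closed)
  next
    case (Suc k)
    obtain t' i where t': "t' \<in> B.idx j k" "i \<in> {p..<q}" "B.val t = z i \<odot>\<^bsub>M\<^esub> B.val t'"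
      using B.idx_Suc2_cases[OF Suc.prems] .
    obtain c r where cr: "c \<in> jp k" "r \<in> B.idx j 0" "B.val t' = c \<odot>\<^bsub>M\<^esub> B.val r"
      using Suc.IH[OF t'(1)] by blast
    have "z i \<otimes> c \<in> jp (Suc k)" unfolding ideal_pow_Suc'[OF J] by (intro ideal_prod.prod zJ t' cr)
    moreover have "B.val t = (z i \<otimes> c) \<odot>\<^bsub>M\<^esub> B.val r"
      using t' cr jp_carr[OF cr(1)] ideal.Icarr[OF J zJ[OF t'(2)]] B.val_closed[OF cr(2)]
      by (simp add: M.smult_assoc1)
    ultimately show ?case using cr(2) by blast
  qed
  have step: "(\<Sum>\<gamma><g. hcount ({..<p} \<union> {p..<q}) {..<p} (B.nonstd \<gamma>) j k) \<le> card (B.val ` B.idx j 0) * hQ bottom k" for j k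
  proof -
    define W where "W = B.val ` B.idx j 0"
    have W: "finite W" "W \<subseteq> carrier M" unfolding W_def using B.finite_idx B.val_idx_carrier by auto
    have WF: "w \<in> B.F j 0" if "w \<in> W" for w
      using that unfolding W_def B.F_def by (intro M.span_base) simp
    have "B.F j k \<subseteq> span R M (B.F (Suc j) k \<union> {c \<odot>\<^bsub>M\<^esub> w |c w. c \<in> jp k \<and> w \<in> W})"
      unfolding B.F_def[of j k]
    proof (rule M.span_mono, rule Un_mono[OF B.C_F], rule image_subsetI)
      fix t assume "t \<in> B.idx j k"
      from val_split[OF this] show "B.val t \<in> {c \<odot>\<^bsub>M\<^esub> w |c w. c \<in> jp k \<and> w \<in> W}"
        unfolding W_def by blast
    qed
    then have "len (\<lambda>L. submodule L R M) (B.F (Suc j) k) (B.F j k) \<le>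
        len (\<lambda>L. submodule L R M) (B.F (Suc j) k) (span R M (B.F (Suc j) k \<union> {c \<odot>\<^bsub>M\<^esub> w |c w. c \<in> jp k \<and> w \<in> W}))"
      by (rule len_mono[OF order_refl])
    also have "\<dots> \<le> enat (card W) * ilen R (bottom k) (jp k)"
    proof (rule M.len_span_family_le[OF W B.sub_F jp_ideal bottom_subset])
      fix b w assume b: "b \<in> bottom k" and w: "w \<in> W"
      have wc: "w \<in> carrier M" using W(2) w by blast
      have I: "ideal {c \<in> carrier R. c \<odot>\<^bsub>M\<^esub> w \<in> B.F (Suc j) k} R"
        by (rule M.ideal_colon[OF oneideal B.sub_F wc])
      have "ideal_prod R \<mm> (jp k) \<subseteq> {c \<in> carrier R. c \<odot>\<^bsub>M\<^esub> w \<in> B.F (Suc j) k}"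
      proof (rule ideal_prod_subset[OF I])
        fix a c assume a: "a \<in> \<mm>" and c: "c \<in> jp k"
        have "c \<odot>\<^bsub>M\<^esub> w \<in> B.F j k" using jp_F[OF c WF[OF w]] by simp
        then have "a \<odot>\<^bsub>M\<^esub> (c \<odot>\<^bsub>M\<^esub> w) \<in> B.F (Suc j) k" by (rule B.m_F[OF a])
        then show "a \<otimes> c \<in> {c \<in> carrier R. c \<odot>\<^bsub>M\<^esub> w \<in> B.F (Suc j) k}"
          using ideal.Icarr[OF m_ideal a] jp_carr[OF c] wc by (simp add: M.smult_assoc1)
      qed
      then show "b \<odot>\<^bsub>M\<^esub> w \<in> B.F (Suc j) k" using b unfolding bottom_def by blast
    qed
    finally show ?thesis unfolding B.len_F_step hQ[OF bottom_fam] W_def by simp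
  qed
  show ?thesis
  proof (rule that[of B.H])
    show "len (\<lambda>L. submodule L R M) (fil (Suc n) k) (A k) = enat (B.H n k)" for n k
      using B.len_F[of n k] unfolding Fn[of "Suc n"] F0 .
    show "binumerical (\<lambda>n k. int (B.H n k))" by (rule B.H_binumerical)
    \<comment> \<open>The factor in the estimate adds up, for \<open>j \<le> n\<close>, the numbers
      of values of monomials of bidegree \<open>(j, 0)\<close>; it does not depend on
      \<open>k\<close>.\<close>
    show "growth s (\<lambda>k. B.H n k)" if gr: "growth s (hQ bottom)" for s n
    proof (rule growth_le[OF growth_scale[OF gr, of "\<Sum>j\<le>n. card (B.val ` B.idx j 0)"]], rule always_eventually, rule allI)
      show "B.H n k \<le> (\<Sum>j\<le>n. card (B.val ` B.idx j 0)) * hQ bottom k" for k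
        unfolding B.H_def sum_distrib_right by (rule sum_mono) (rule step)
    qed
    show "growth d (\<lambda>n. B.H n k)" if gr: "growth d (hloc (ann k))" for d k
    proof -
      \<comment> \<open>Monomials of bidegree \<open>(0, k)\<close>, which generate
        \<open>A k\<close> modulo \<open>C k\<close>; their number does not depend on
        \<open>n\<close>.\<close>
      define W where "W = B.val ` B.idx 0 k"
      have W: "finite W" "W \<subseteq> carrier M" unfolding W_def using B.finite_idx B.val_idx_carrier by auto
      have "B.H n k \<le> card W * hloc (ann k) (Suc n)" for n
      proof -
        have F: "submodule (fil (Suc n) k) R M" using B.sub_F[of "Suc n" k] unfolding Fn .
        have C_fil: "C k \<subseteq> fil (Suc n) k" using B.C_F[of k "Suc n"] unfolding Fn .
        have WA: "w \<in> A k" if "w \<in> W" for w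
          unfolding F0[symmetric] B.F_def using that unfolding W_def by (intro M.span_base) simp
        have "A k \<subseteq> span R M (fil (Suc n) k \<union> {c \<odot>\<^bsub>M\<^esub> w |c w. c \<in> carrier R \<and> w \<in> W})"
          unfolding F0[symmetric, of k] B.F_def
        proof (rule M.span_mono, rule Un_mono[OF C_fil], rule subsetI)
          fix w assume w: "w \<in> B.val ` B.idx 0 k"
          then have "w = \<one> \<odot>\<^bsub>M\<^esub> w" using B.val_closed by auto
          then show "w \<in> {c \<odot>\<^bsub>M\<^esub> w |c w. c \<in> carrier R \<and> w \<in> W}"
            using w unfolding W_def by blast
        qed
        then have "len (\<lambda>L. submodule L R M) (fil (Suc n) k) (A k) \<le>
            len (\<lambda>L. submodule L R M) (fil (Suc n) k) (span R M (fil (Suc n) k \<union> {c \<odot>\<^bsub>M\<^esub> w |c w. c \<in> carrier R \<and> w \<in> W}))"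
          by (rule len_mono[OF order_refl])
        also have "\<dots> \<le> enat (card W) * ilen R (loc (ann k) (Suc n)) (carrier R)"
        proof (rule M.len_span_family_le[OF W F oneideal ideal_carrier_subset[OF loc_ideal[OF ann_ideal]]])
          fix b w assume b: "b \<in> loc (ann k) (Suc n)" and w: "w \<in> W"
          have wc: "w \<in> carrier M" using W(2) w by blast
          have I: "ideal {c \<in> carrier R. c \<odot>\<^bsub>M\<^esub> w \<in> fil (Suc n) k} R"
            by (rule M.ideal_colon[OF oneideal F wc])
          have "loc (ann k) (Suc n) \<subseteq> {c \<in> carrier R. c \<odot>\<^bsub>M\<^esub> w \<in> fil (Suc n) k}"
            unfolding loc_def
          proof (rule ispan_least[OF I], rule Un_least)
            show "ann k \<subseteq> {c \<in> carrier R. c \<odot>\<^bsub>M\<^esub> w \<in> fil (Suc n) k}"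
              unfolding ann_def using WA[OF w] C_fil by blast
            show "mpow (Suc n) \<subseteq> {c \<in> carrier R. c \<odot>\<^bsub>M\<^esub> w \<in> fil (Suc n) k}"
            proof
              fix c assume c: "c \<in> mpow (Suc n)"
              have "c \<odot>\<^bsub>M\<^esub> w \<in> ideal_smult M (mpow (Suc n)) (A k)"
                by (rule ideal_smult.smult[OF c WA[OF w]])
              then have "c \<odot>\<^bsub>M\<^esub> w \<in> fil (Suc n) k" unfolding fil_def by (intro M.span_base) simp
              then show "c \<in> {c \<in> carrier R. c \<odot>\<^bsub>M\<^esub> w \<in> fil (Suc n) k}"
                using ideal.Icarr[OF mpow_ideal c] by simp
            qed
          qed
          then show "b \<odot>\<^bsub>M\<^esub> w \<in> fil (Suc n) k" using b by blast
        qed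
        finally show ?thesis
          using B.len_F[of n k] unfolding Fn[of "Suc n"] F0 hloc[OF ann_ideal] by simp
      qed
      \<comment> \<open>\<open>H n k\<close> is compared with the colength at exponent
        \<open>Suc n\<close>, hence the shift by one in the growth statement.\<close>
      then show ?thesis
        by (intro growth_le[OF growth_scale[OF growth_Suc_shift[OF gr], of "card W"]] always_eventually allI)
    qed
  qed
qed

text \<open>\<open>N k\<close> enters only through its annihilator and its lengths, so its elements
  may have any type: elements of \<open>M\<close> for \<open>I^k M\<close>, cosets for the two
  quotients.\<close>

theorem hilbert_coeff_eventually_poly:
  fixes N :: "nat \<Rightarrow> ('a, 'c, 't) module_scheme"
  assumes annN: "\<And>k. annihilator R (N k) = ann k"
    and lenN: "\<And>n k. module_length R (quot_module (N k) (ideal_smult (N k) (mpow (n + 1)) (carrier (N k)))) =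
      len (\<lambda>L. submodule L R M) (fil (Suc n) k) (A k)"
    and i: "ereal (real i) \<le> eventual_value (\<lambda>k. module_dim R (N k))"
  shows "eventually_poly_deg_le (\<lambda>k. hilbert_coeff R \<mm> (N k) i)
    (eventual_value (\<lambda>k. module_dim R (N k)) + analytic_spread R \<mm> J - ereal (real i) - 1)"
proof -
  have "\<exists>K. \<forall>k\<ge>K. ann k = ann K"
    by (rule ideal_chain_stabilizes[of ann, OF ann_ideal ann_mono]) blast
  then obtain K where K: "\<And>k. K \<le> k \<Longrightarrow> ann k = ann K" by blast
  define d where "d = krull_dim (R Quot ann K)"
  have dim: "module_dim R (N k) = d" if "K \<le> k" for k
    unfolding module_dim_def annN d_def using K[OF that] by simp
  then have "\<forall>\<^sub>F k in sequentially. module_dim R (N k) = d"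
    unfolding eventually_sequentially by blast
  then have ev: "eventual_value (\<lambda>k. module_dim R (N k)) = d" by (rule eventual_value_eq)
  \<comment> \<open>The value \<open>- \<infinity>\<close> is excluded by the assumption on
    \<open>i\<close>.\<close>
  consider "d = \<infinity>" | r where "d = ereal (real r)"
    using krull_dim_cases[of "R Quot ann K"] i unfolding ev d_def by fastforce
  then show ?thesis
  proof cases
    case 1
    \<comment> \<open>In infinite dimension the coefficient is a fixed default value, so the
      sequence is eventually constant, and the degree bound is infinite.\<close>
    define c where "c = (THE e :: nat \<Rightarrow> int. False) i"
    have "hilbert_coeff R \<mm> (N k) i = c" if "K \<le> k" for k
      using hilbert_coeff_infinite_dim[of R "N k" \<mm>] dim[OF that] 1 unfolding c_def by simp
    then have "\<forall>\<^sub>F k in sequentially. hilbert_coeff R \<mm> (N k) i = (\<Sum>l\<le>0. c * nbinom l k)"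
      unfolding eventually_sequentially by auto
    then show ?thesis
      unfolding ev 1 by (rule eventually_poly_deg_le_nbinom_sum) simp
  next
    case (2 r)
    have ir: "i \<le> r" using i unfolding ev 2 by simp
    obtain H where H: "\<And>n k. len (\<lambda>L. submodule L R M) (fil (Suc n) k) (A k) = enat (H n k)"
      "binumerical (\<lambda>n k. int (H n k))"
      "\<And>s n. growth s (hQ bottom) \<Longrightarrow> growth s (\<lambda>k. H n k)"
      "\<And>d k. growth d (hloc (ann k)) \<Longrightarrow> growth d (\<lambda>n. H n k)"
      using hilbert_function by metis
    have "growth (Suc r) (hloc (ann k))" if "K \<le> k" for k
    proof (rule hloc_growth[OF ann_ideal])
      show "n \<le> Suc r" if "\<And>i. i < n \<Longrightarrow> primeideal (P i) R \<and> ann k \<subseteq> P i"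
        "\<And>i. Suc i < n \<Longrightarrow> P i \<subset> P (Suc i)" for n P
        by (rule prime_chain_le_krull_dim_quotient[OF ann_ideal[of K], of r n P])
           (use that 2 K[OF \<open>K \<le> k\<close>] in \<open>simp_all add: d_def\<close>)
    qed
    then have gr: "\<forall>\<^sub>F k in sequentially. growth (Suc r) (\<lambda>n. H n k)"
      unfolding eventually_sequentially using H(4) by blast
    have "\<exists>E D N0. (\<forall>n\<ge>N0. \<forall>k\<ge>N0. int (H n k) = (\<Sum>j\<le>r. \<Sum>l\<le>(D::nat). E j l * nbinom j n * nbinom l k)) \<and>
        (\<forall>s j l. (\<forall>n. growth s (\<lambda>k. H n k)) \<longrightarrow> s \<le> l \<longrightarrow> E j l = 0)"
      by (rule bivariate_hilbert_polynomial[OF H(2) gr]) blast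
    then obtain E D N0 where E: "\<And>n k. N0 \<le> n \<Longrightarrow> N0 \<le> k \<Longrightarrow>
        int (H n k) = (\<Sum>j\<le>r. \<Sum>l\<le>(D::nat). E j l * nbinom j n * nbinom l k)"
      and E_zero: "\<And>s j l. (\<forall>n. growth s (\<lambda>k. H n k)) \<Longrightarrow> s \<le> l \<Longrightarrow> E j l = 0" by blast
    \<comment> \<open>The threshold \<open>N0\<close> is uniform in \<open>k\<close>, so for each
      \<open>k\<close> beyond it the inner sums over \<open>l\<close> are the coefficients of the
      expansion in \<open>n\<close>.\<close>
    have hc: "hilbert_coeff R \<mm> (N k) i = (-1) ^ i * (\<Sum>l\<le>D. E (r - i) l * nbinom l k)"
      if "max K N0 \<le> k" for k
    proof (rule hilbert_coeff_of_expansion[where E = "\<lambda>j. \<Sum>l\<le>D. E j l * nbinom l k" and r = r and H = "\<lambda>n. H n k"])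
      show "module_dim R (N k) = ereal (real r)" using dim[of k] that 2 by simp
      show "module_length R (quot_module (N k) (ideal_smult (N k) (mpow (n + 1)) (carrier (N k)))) = enat (H n k)" for n
        unfolding lenN by (rule H(1))
      have "int (H n k) = (\<Sum>j\<le>r. (\<Sum>l\<le>D. E j l * nbinom l k) * nbinom j n)" if "N0 \<le> n" for n
      proof -
        have "int (H n k) = (\<Sum>j\<le>r. \<Sum>l\<le>D. E j l * nbinom j n * nbinom l k)"
          using that \<open>max K N0 \<le> k\<close> by (intro E) auto
        then show ?thesis unfolding sum_distrib_right by (simp only: mult_ac)
      qed
      then show "\<forall>\<^sub>F n in sequentially. int (H n k) = (\<Sum>j\<le>r. (\<Sum>l\<le>D. E j l * nbinom l k) * nbinom j n)"
        unfolding eventually_sequentially by blast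
    qed (rule ir)
    have "\<forall>\<^sub>F k in sequentially. hilbert_coeff R \<mm> (N k) i = (\<Sum>l\<le>D. ((-1) ^ i * E (r - i) l) * nbinom l k)"
      unfolding eventually_sequentially
      using hc by (intro exI[of _ "max K N0"]) (simp add: sum_distrib_left mult.assoc)
    then show ?thesis
    proof (rule eventually_poly_deg_le_nbinom_sum)
      fix l assume "(-1) ^ i * E (r - i) l \<noteq> 0"
      then have nz: "E (r - i) l \<noteq> 0" by auto
      show "ereal (real l) \<le> eventual_value (\<lambda>k. module_dim R (N k)) + analytic_spread R \<mm> J - ereal (real i) - 1"
      proof (cases "\<exists>s. analytic_spread R \<mm> J = ereal (real s)")
        case True
        then obtain s where s: "analytic_spread R \<mm> J = ereal (real s)" by blast
        \<comment> \<open>Entries with \<open>l \<ge> s\<close> vanish; for \<open>s = 0\<close> no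
          nonzero entry is left.\<close>
        have "l < s" using E_zero[of s l "r - i"] H(3)[OF fiber_growth[OF s]] nz by force
        then have "real l \<le> real r + real s - real i - 1" using ir by simp
        then show ?thesis unfolding ev 2 s by (simp add: one_ereal_def)
      next
        case False
        \<comment> \<open>The prime \<open>irrelevant\<close> rules out the value
          \<open>- \<infinity>\<close>, and for infinite spread the bound is infinite.\<close>
        then have "analytic_spread R \<mm> J = \<infinity>"
          using krull_dim_cases[of FC] analytic_spread_nonneg unfolding analytic_spread_def by fastforce
        then show ?thesis unfolding ev 2 by simp
      qed
    qed
  qed
qed

end

section \<open>Powers of an ideal acting on a module\<close>

context module
begin

lemma pow_sub_0: "pow_sub R M I 0 = carrier M"
  unfolding pow_sub_def by (simp add: ideal_smult_carrier[OF carrier_is_submodule])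

lemma sub_pow_sub: "ideal I R \<Longrightarrow> sub (pow_sub R M I k)"
  unfolding pow_sub_def by (intro sub_ideal_smult R.ideal_pow_ideal carrier_is_submodule)

lemma pow_sub_Suc: "ideal I R \<Longrightarrow> pow_sub R M I (Suc k) = ideal_smult M I (pow_sub R M I k)"
  unfolding pow_sub_def R.ideal_pow_Suc'
  by (rule ideal_smult_assoc[OF _ R.ideal_pow_ideal carrier_is_submodule])

lemma pow_sub_Suc_subset: "ideal I R \<Longrightarrow> pow_sub R M I (Suc k) \<subseteq> pow_sub R M I k"
  unfolding pow_sub_Suc by (intro ideal_smult_le sub_pow_sub)

lemma pow_sub_mono:
  assumes "ideal I R" "ideal J R" "J \<subseteq> I"
  shows "pow_sub R M J k \<subseteq> pow_sub R M I k"
proof (induction k)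
  case (Suc k)
  then show ?case unfolding pow_sub_Suc[OF assms(1)] pow_sub_Suc[OF assms(2)] by (intro ideal_smult_mono assms)
qed (simp add: pow_sub_0)

lemma ideal_smult_span:
  assumes Z: "Z \<subseteq> carrier R" and E: "E \<subseteq> carrier M"
  shows "ideal_smult M (genideal R Z) (span R M E) = span R M {z \<odot>\<^bsub>M\<^esub> e | z e. z \<in> Z \<and> e \<in> E}" (is "_ = span R M ?S")
proof
  have Sc: "?S \<subseteq> carrier M" using Z E by blast
  have S: "sub (span R M ?S)" by (rule sub_span[OF Sc])
  show "ideal_smult M (genideal R Z) (span R M E) \<subseteq> span R M ?S"
  proof (rule ideal_smult_subset[OF S])
    fix a x assume a: "a \<in> genideal R Z" and x: "x \<in> span R M E"
    have xc: "x \<in> carrier M" using span_subset_carrier[OF E] x by blast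
    show "a \<odot>\<^bsub>M\<^esub> x \<in> span R M ?S"
    proof (rule genideal_smult_in[OF S xc Z _ a])
      fix z assume z: "z \<in> Z"
      show "z \<odot>\<^bsub>M\<^esub> x \<in> span R M ?S"
        by (rule smult_span_in[OF S _ E _ x]) (use z Z in \<open>auto intro: span_base\<close>)
    qed
  qed
  have "sub (ideal_smult M (genideal R Z) (span R M E))"
    by (intro sub_ideal_smult R.genideal_ideal Z sub_span E)
  then show "span R M ?S \<subseteq> ideal_smult M (genideal R Z) (span R M E)"
  proof (rule span_least, clarify)
    fix z e assume "z \<in> Z" "e \<in> E"
    then show "z \<odot>\<^bsub>M\<^esub> e \<in> ideal_smult M (genideal R Z) (span R M E)"
      using R.genideal_self[OF Z] span_base[of e E] by (intro ideal_smult.smult) auto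
  qed
qed

text \<open>Products of generators of \<open>I\<close> with generators of one power generate the
  next. All powers are covered because the family for \<open>I^k M / J^k M\<close> starts at the
  reduction index instead of 0.\<close>

lemma pow_sub_finitely_generated:
  assumes "noetherian_ring R" "finitely_generated_module R M" and I: "ideal I R"
  shows "\<exists>E. finite E \<and> E \<subseteq> carrier M \<and> pow_sub R M I k = span R M E"
proof (induction k)
  case 0
  obtain E where E: "finite E" "E \<subseteq> carrier M" "\<And>N. sub N \<Longrightarrow> E \<subseteq> N \<Longrightarrow> N = carrier M"
    using assms(2) unfolding finitely_generated_module_def by blast
  have "span R M E = carrier M" by (rule E(3)[OF sub_span[OF E(2)] span_superset])
  then show ?case using E(1,2) pow_sub_0 by metis
next
  case (Suc k)
  then obtain E where E: "finite E" "E \<subseteq> carrier M" "pow_sub R M I k = span R M E" by blast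
  obtain Z where Z: "Z \<subseteq> carrier R" "finite Z" "I = genideal R Z"
    using noetherian_ring.finetely_gen[OF assms(1) I] by blast
  have "{z \<odot>\<^bsub>M\<^esub> e | z e. z \<in> Z \<and> e \<in> E} = (\<lambda>(z, e). z \<odot>\<^bsub>M\<^esub> e) ` (Z \<times> E)" by auto
  then have "finite {z \<odot>\<^bsub>M\<^esub> e | z e. z \<in> Z \<and> e \<in> E}" using E Z by simp
  moreover have "{z \<odot>\<^bsub>M\<^esub> e | z e. z \<in> Z \<and> e \<in> E} \<subseteq> carrier M" using E Z by blast
  moreover have "pow_sub R M I (Suc k) = span R M {z \<odot>\<^bsub>M\<^esub> e | z e. z \<in> Z \<and> e \<in> E}"
    unfolding pow_sub_Suc[OF I] E(3) using ideal_smult_span[OF Z(1) E(2)] Z(3) by simp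
  ultimately show ?case by blast
qed

text \<open>The equality propagates because products of ideals commute: an additional factor
  \<open>I\<close> is moved past \<open>J\<close> and absorbed by the power of \<open>I\<close>
  behind it.\<close>

lemma pow_sub_reduction:
  assumes I: "ideal I R" and J: "ideal J R"
    and red: "pow_sub R M I (Suc n) = ideal_smult M J (pow_sub R M I n)"
  shows "pow_sub R M I (Suc (k + n)) = ideal_smult M J (pow_sub R M I (k + n))"
proof (induction k)
  case (Suc k)
  let ?X = "pow_sub R M I (k + n)"
  have X: "sub ?X" by (rule sub_pow_sub[OF I])
  have "pow_sub R M I (Suc (Suc k + n)) = ideal_smult M I (ideal_smult M J ?X)"
    using pow_sub_Suc[OF I, of "Suc k + n"] Suc by simp
  also have "\<dots> = ideal_smult M (ideal_prod R I J) ?X" by (rule ideal_smult_assoc[OF I J X, symmetric])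
  also have "\<dots> = ideal_smult M (ideal_prod R J I) ?X" using R.ideal_prod_commute[OF I J] by simp
  also have "\<dots> = ideal_smult M J (ideal_smult M I ?X)" by (rule ideal_smult_assoc[OF J I X])
  also have "\<dots> = ideal_smult M J (pow_sub R M I (Suc k + n))" using pow_sub_Suc[OF I, of "k + n"] by simp
  finally show ?case .
qed (use red in simp)

end

theorem corollary5p4:
  fixes R :: "('a, 'r) ring_scheme" and M :: "('a, 'b, 's) module_scheme"
    and \<mm> I J :: "'a set"
  assumes "noetherian_local_ring R \<mm>"
    and "Module.module R M"
    and "finitely_generated_module R M"
    and "ideal I R"
    and "is_reduction R M I J"
  shows "(\<forall>i. ereal (real i) \<le> alpha_dim R M I \<longrightarrow>
           eventually_poly_deg_le (\<lambda>k. hilbert_coeff R \<mm> (pow_succ_quot R M I k) i)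
             (alpha_dim R M I + analytic_spread R \<mm> I - ereal (real i) - 1)) \<and>
         (\<forall>i. ereal (real i) \<le> beta_dim R M I \<longrightarrow>
           eventually_poly_deg_le (\<lambda>k. hilbert_coeff R \<mm> (pow_module R M I k) i)
             (beta_dim R M I + analytic_spread R \<mm> I - ereal (real i) - 1)) \<and>
         (\<forall>i. ereal (real i) \<le> gamma_dim R M I J \<longrightarrow>
           eventually_poly_deg_le (\<lambda>k. hilbert_coeff R \<mm> (pow_pow_quot R M I J k) i)
             (gamma_dim R M I J + analytic_spread R \<mm> J - ereal (real i) - 1))"
proof -
  interpret M: module R M by (rule assms(2))
  have noeth: "noetherian_ring R" using assms(1) by (rule noetherian_local_ring.axioms(2))
  have "noetherian_cring_max R \<mm>"
    by (rule noetherian_cring_max.intro[OF M.R.is_cring noeth])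
       (rule noetherian_cring_max_axioms.intro[OF noetherian_local_ring.maximal[OF assms(1)]])
  then have fib: "fiber R \<mm> L" if "ideal L R" for L
    using that by (intro fiber.intro fiber_axioms.intro)
  have J: "ideal J R" and JI: "J \<subseteq> I"
    using assms(5) unfolding is_reduction_def by auto
  obtain n0 where n0: "pow_sub R M I (Suc n0) = ideal_smult M J (pow_sub R M I n0)"
    using assms(5) unfolding is_reduction_def by auto
  note I = assms(4)
  let ?P = "pow_sub R M I"
  have mpow_ideal: "ideal (ideal_pow R \<mm> n) R" for n
    using noetherian_local_ring.maximal[OF assms(1)] by (intro M.R.ideal_pow_ideal maximalideal.axioms)
  have smult_pow: "a \<odot>\<^bsub>M\<^esub> x \<in> pow_sub R M L (Suc k)" if "ideal L R" "a \<in> L" "x \<in> pow_sub R M L k" for L a x k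
    unfolding M.pow_sub_Suc[OF that(1)] by (rule ideal_smult.smult[OF that(2,3)])
  have zero: "submodule {\<zero>\<^bsub>M\<^esub>} R M" by (rule M.submoduleI) (auto simp: M.M.minus_equality)
  have un_id: "span R M (C \<union> X) = X" if "C \<subseteq> X" "submodule X R M" for C X
    using that M.span_id[of X] by (simp add: Un_absorb1)
  obtain E where E: "finite E" "E \<subseteq> carrier M" "?P 0 = span R M E"
    using M.pow_sub_finitely_generated[OF noeth assms(3) I] by blast
  obtain E' where E': "finite E'" "E' \<subseteq> carrier M" "?P n0 = span R M E'"
    using M.pow_sub_finitely_generated[OF noeth assms(3) I] by blast
  have span_gen: "X = span R M (C \<union> E)" if "X = span R M E" "C \<subseteq> X" "E \<subseteq> carrier M" for X C E
  proof
    show "X \<subseteq> span R M (C \<union> E)" unfolding that(1) by (rule M.span_mono) blast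
    show "span R M (C \<union> E) \<subseteq> X"
      using M.sub_span[OF that(3)] that(2) M.span_superset[of E] unfolding that(1) by (intro M.span_least) auto
  qed
  have a: "eventually_poly_deg_le (\<lambda>k. hilbert_coeff R \<mm> (pow_succ_quot R M I k) i)
      (alpha_dim R M I + analytic_spread R \<mm> I - ereal (real i) - 1)"
    if i: "ereal (real i) \<le> alpha_dim R M I" for i
  proof -
    \<comment> \<open>Here \<open>C (Suc k)\<close> is \<open>I^(k+2) M\<close>, which already lies
      in \<open>I\<close> times \<open>I^k M\<close>, so the recursion of the locale reduces to that
      of the powers.\<close>
    interpret G: graded_family R \<mm> I M ?P "\<lambda>k. ?P (Suc k)" E
    proof (intro graded_family.intro graded_family_axioms.intro fib I assms(2) M.sub_pow_sub
        M.pow_sub_Suc_subset smult_pow E)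
      show "?P (Suc k) = span R M (?P (Suc (Suc k)) \<union> ideal_smult M I (?P k))" for k
        unfolding M.pow_sub_Suc[OF I, of k, symmetric]
        by (rule un_id[OF M.pow_sub_Suc_subset[OF I] M.sub_pow_sub[OF I], symmetric])
      show "?P 0 = span R M (?P (Suc 0) \<union> E)"
        by (rule span_gen[OF E(3) M.pow_sub_Suc_subset[OF I] E(2)])
    qed
    show ?thesis
      unfolding alpha_dim_def
    proof (rule G.hilbert_coeff_eventually_poly)
      show "annihilator R (pow_succ_quot R M I k) = G.ann k" for k
        unfolding pow_succ_quot_def pow_module_def G.ann_def
        using M.annihilator_restrict_quot[OF G.A G.C G.CA, of k] by simp
      show "module_length R (quot_module (pow_succ_quot R M I k) (ideal_smult (pow_succ_quot R M I k)
          (ideal_pow R \<mm> (n + 1)) (carrier (pow_succ_quot R M I k)))) = len M.sub (G.fil (Suc n) k) (?P k)" for n k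
        unfolding pow_succ_quot_def pow_module_def G.fil_def
        using M.module_length_restrict_quot_quot[OF G.A G.C G.CA mpow_ideal, of k "Suc n"] by simp
    qed (use i in \<open>simp add: alpha_dim_def\<close>)
  qed
  have b: "eventually_poly_deg_le (\<lambda>k. hilbert_coeff R \<mm> (pow_module R M I k) i)
      (beta_dim R M I + analytic_spread R \<mm> I - ereal (real i) - 1)"
    if i: "ereal (real i) \<le> beta_dim R M I" for i
  proof -
    have z: "{\<zero>\<^bsub>M\<^esub>} \<subseteq> X" if "submodule X R M" for X using M.sub_zero[OF that] by simp
    \<comment> \<open>With only zero divided out, \<open>ann k\<close> is the annihilator of
      \<open>I^k M\<close> itself.\<close>
    interpret G: graded_family R \<mm> I M ?P "\<lambda>k. {\<zero>\<^bsub>M\<^esub>}" E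
    proof (intro graded_family.intro graded_family_axioms.intro fib I assms(2) M.sub_pow_sub zero z E)
      show "a \<odot>\<^bsub>M\<^esub> x \<in> {\<zero>\<^bsub>M\<^esub>}" if "a \<in> I" "x \<in> {\<zero>\<^bsub>M\<^esub>}" for a x
        using that ideal.Icarr[OF I that(1)] by simp
      show "?P (Suc k) = span R M ({\<zero>\<^bsub>M\<^esub>} \<union> ideal_smult M I (?P k))" for k
        unfolding M.pow_sub_Suc[OF I, of k, symmetric]
        by (rule un_id[OF z[OF M.sub_pow_sub[OF I]] M.sub_pow_sub[OF I], symmetric])
      show "?P 0 = span R M ({\<zero>\<^bsub>M\<^esub>} \<union> E)"
        by (rule span_gen[OF E(3) z[OF M.sub_pow_sub[OF I]] E(2)])
    qed
    show ?thesis
      unfolding beta_dim_def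
    proof (rule G.hilbert_coeff_eventually_poly)
      show "annihilator R (pow_module R M I k) = G.ann k" for k
        unfolding pow_module_def G.ann_def annihilator_def by simp
      have "G.fil (Suc n) k = ideal_smult M (ideal_pow R \<mm> (Suc n)) (?P k)" for n k
        unfolding G.fil_def
        by (rule un_id[OF z]) (intro M.sub_ideal_smult mpow_ideal M.sub_pow_sub I)+
      then show "module_length R (quot_module (pow_module R M I k) (ideal_smult (pow_module R M I k)
          (ideal_pow R \<mm> (n + 1)) (carrier (pow_module R M I k)))) = len M.sub (G.fil (Suc n) k) (?P k)" for n k
        unfolding pow_module_def
        using M.module_length_restrict_quot[OF G.A mpow_ideal, of k "Suc n"] by simp
    qed (use i in \<open>simp add: beta_dim_def\<close>)
  qed
  have c: "eventually_poly_deg_le (\<lambda>k. hilbert_coeff R \<mm> (pow_pow_quot R M I J k) i)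
      (gamma_dim R M I J + analytic_spread R \<mm> J - ereal (real i) - 1)"
    if i: "ereal (real i) \<le> gamma_dim R M I J" for i
  proof -
    \<comment> \<open>Both sequences start at the reduction index \<open>n0\<close>, from which on
      the next power of \<open>I\<close> is obtained by multiplying with \<open>J\<close>. The
      acting ideal is therefore \<open>J\<close>, and it is the spread of \<open>J\<close> that
      appears in the bound.\<close>
    interpret G: graded_family R \<mm> J M "\<lambda>k. ?P (k + n0)" "\<lambda>k. pow_sub R M J (k + n0)" E'
    proof (intro graded_family.intro graded_family_axioms.intro fib I J JI assms(2) M.sub_pow_sub
        M.pow_sub_mono E')
      show "a \<odot>\<^bsub>M\<^esub> x \<in> pow_sub R M J (Suc k + n0)" if "a \<in> J" "x \<in> pow_sub R M J (k + n0)" for a x k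
        using smult_pow[OF J that] by simp
      show "?P (Suc k + n0) = span R M (pow_sub R M J (Suc k + n0) \<union> ideal_smult M J (?P (k + n0)))" for k
        unfolding M.pow_sub_reduction[OF I J n0, symmetric]
        using un_id[OF M.pow_sub_mono[OF I J JI] M.sub_pow_sub[OF I], of "Suc k + n0"] by simp
      show "?P (0 + n0) = span R M (pow_sub R M J (0 + n0) \<union> E')"
        using span_gen[OF E'(3) M.pow_sub_mono[OF I J JI] E'(2)] by simp
    qed
    have ev: "eventual_value (\<lambda>k. module_dim R (pow_pow_quot R M I J (k + n0))) = gamma_dim R M I J"
      unfolding gamma_dim_def by (rule eventual_value_shift)
    show ?thesis
    \<comment> \<open>Neither the eventual dimension nor the degree of the polynomial changes under
      the shift by \<open>n0\<close>.\<close>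
    proof (rule eventually_poly_deg_le_shift[of _ n0], unfold ev[symmetric],
        rule G.hilbert_coeff_eventually_poly)
      show "annihilator R (pow_pow_quot R M I J (k + n0)) = G.ann k" for k
        unfolding pow_pow_quot_def pow_module_def G.ann_def
        using M.annihilator_restrict_quot[OF G.A G.C G.CA, of k] by simp
      show "module_length R (quot_module (pow_pow_quot R M I J (k + n0)) (ideal_smult (pow_pow_quot R M I J (k + n0))
          (ideal_pow R \<mm> (n + 1)) (carrier (pow_pow_quot R M I J (k + n0))))) =
          len M.sub (G.fil (Suc n) k) (?P (k + n0))" for n k
        unfolding pow_pow_quot_def pow_module_def G.fil_def
        using M.module_length_restrict_quot_quot[OF G.A G.C G.CA mpow_ideal, of k "Suc n"] by simp
    qed (use i ev in simp)
  qed
  show ?thesis using a b c by blast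
qed

end
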